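(* Let $N\ge2$. For every $u\in C_0^\infty(B_1^N)$ with $\int_{\mathbb{S}^{N-1}}u(r\omega)\,dS_\omega=0$ for all $r\in[0,1)$, $$\frac{N^2}{4}\int_{B_1^N}\frac{|u|^2}{|x|^2}\,dx\le\int_{B_1^N}|\nabla u|^2\,dx,$$ and, in the case $N=2$, for every such $u \in C_0^\infty(B_1^2)$, $$\frac54\int_{B_1^2}\frac{|u|^2}{|x|^2\left(\log\frac{e}{|x|}\right)^2}\,dx\le\int_{B_1^2}|\nabla u|^2\,dx.$$ Moreover, $\frac{N^2}{4}$ is the best constant in the first inequality, and it is not attained.
   Context: $B_1^N$ is the open unit ball of $\mathbb{R}^N$, $\mathbb{S}^{N-1}$ the unit sphere, $dS_\omega$ its surface measure, and $C_0^\infty$ denotes smooth real-valued functions with compact support. "Best constant" means the largest constant for which the inequality holds for all admissible $u$; "not attained" means that equality does not hold for any admissible $u\neq0$. *)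

theory Defs
  imports "HOL-Analysis.Analysis"
begin

(* In finite dimension, f is C^(k+1) iff it is differentiable and all its directional
   derivatives x \<mapsto> f'(x) v are C^k. *)
primrec C_k :: "nat \<Rightarrow> ('a::euclidean_space \<Rightarrow> real) \<Rightarrow> bool" where
  "C_k 0 f \<longleftrightarrow> continuous_on UNIV f"
| "C_k (Suc k) f \<longleftrightarrow> (\<forall>x. f differentiable (at x)) \<and>
     (\<forall>v. C_k k (\<lambda>x. frechet_derivative f (at x) v))"

definition smooth :: "('a::euclidean_space \<Rightarrow> real) \<Rightarrow> bool" where
  "smooth f \<longleftrightarrow> (\<forall>k. C_k k f)"

(* Elements of C_0^\<infinity>(U), U open, are identified with their extension by zero
   to the whole space. *)
definition test_functions :: "'a::euclidean_space set \<Rightarrow> ('a \<Rightarrow> real) set" where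
  "test_functions U =
     {u. smooth u \<and> compact (closure {x. u x \<noteq> 0}) \<and> closure {x. u x \<noteq> 0} \<subseteq> U}"

definition grad :: "(real ^ 'n \<Rightarrow> real) \<Rightarrow> real ^ 'n \<Rightarrow> real ^ 'n" where
  "grad u x = (\<chi> i. frechet_derivative u (at x) (axis i 1))"

(* Surface measure of the unit sphere as cone measure:
   \<sigma>(A) = N * |{r *\<^sub>R \<omega> | 0 < r < 1, \<omega> \<in> A}|, where N is the dimension and sgn x = x / |x|.
   It is normalised by the area of the sphere, see emeasure_surface_measure_sphere. *)
definition surface_measure :: "'a::euclidean_space measure" where
  "surface_measure = scale_measure (of_nat DIM('a))
     (distr (restrict_space lborel (ball 0 1 - {0})) (restrict_space borel (sphere 0 1)) sgn)"

lemma sgn_measurable_sphere: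
  "sgn \<in> measurable (restrict_space lborel (ball 0 1 - {0}))
     (restrict_space borel (sphere 0 (1::real) :: 'a::euclidean_space set))"
proof (rule measurable_restrict_space2)
  show "sgn \<in> space (restrict_space lborel (ball 0 1 - {0})) \<rightarrow> sphere (0::'a) 1"
    by (auto simp: space_restrict_space norm_sgn)
  have "(sgn :: 'a \<Rightarrow> 'a) \<in> borel_measurable borel"
    unfolding sgn_div_norm by measurable
  then show "sgn \<in> borel_measurable (restrict_space lborel (ball 0 1 - {0 :: 'a}))"
    by (intro measurable_restrict_space1) simp
qed

lemma emeasure_surface_measure:
  fixes A :: "'a::euclidean_space set"
  assumes "A \<in> sets borel" "A \<subseteq> sphere 0 1"
  shows "emeasure surface_measure A =
    of_nat DIM('a) * emeasure lborel {r *\<^sub>R \<omega> | r \<omega>. 0 < r \<and> r < 1 \<and> \<omega> \<in> A}"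
proof -
  have A: "A \<in> sets (restrict_space borel (sphere 0 1))"
    using assms by (simp add: sets_restrict_space_iff)
  have eq: "sgn -` A \<inter> (ball 0 1 - {0}) = {r *\<^sub>R \<omega> | r \<omega>. 0 < r \<and> r < 1 \<and> \<omega> \<in> A}"
  proof (intro set_eqI iffI)
    fix x assume "x \<in> sgn -` A \<inter> (ball 0 1 - {0})"
    then have "x = norm x *\<^sub>R sgn x \<and> 0 < norm x \<and> norm x < 1 \<and> sgn x \<in> A"
      by (auto simp: sgn_div_norm)
    then show "x \<in> {r *\<^sub>R \<omega> | r \<omega>. 0 < r \<and> r < 1 \<and> \<omega> \<in> A}" by blast
  next
    fix x assume "x \<in> {r *\<^sub>R \<omega> | r \<omega>. 0 < r \<and> r < 1 \<and> \<omega> \<in> A}"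
    then obtain r \<omega> where "x = r *\<^sub>R \<omega>" "0 < r" "r < 1" "\<omega> \<in> A" by auto
    moreover have "norm \<omega> = 1" using assms(2) \<open>\<omega> \<in> A\<close> by auto
    ultimately show "x \<in> sgn -` A \<inter> (ball 0 1 - {0})" by (auto simp: sgn_div_norm)
  qed
  show ?thesis
    unfolding surface_measure_def
    by (simp add: emeasure_distr[OF sgn_measurable_sphere A] space_restrict_space
        emeasure_restrict_space flip: eq)
qed

lemma emeasure_surface_measure_sphere:
  "emeasure surface_measure (sphere (0::'a::euclidean_space) 1) =
     of_nat DIM('a) * ennreal (unit_ball_vol DIM('a))"
proof -
  have "{r *\<^sub>R \<omega> | r \<omega>. 0 < r \<and> r < 1 \<and> \<omega> \<in> sphere (0::'a) 1} = ball 0 1 - {0}"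
  proof (intro set_eqI iffI)
    fix x :: 'a assume "x \<in> ball 0 1 - {0}"
    then have "x = norm x *\<^sub>R sgn x \<and> 0 < norm x \<and> norm x < 1 \<and> sgn x \<in> sphere 0 1"
      by (auto simp: sgn_div_norm)
    then show "x \<in> {r *\<^sub>R \<omega> | r \<omega>. 0 < r \<and> r < 1 \<and> \<omega> \<in> sphere 0 1}" by blast
  qed auto
  then show ?thesis
    by (simp add: emeasure_surface_measure emeasure_Diff emeasure_ball)
qed

definition mean_zero_test_functions :: "('a::euclidean_space \<Rightarrow> real) set" where
  "mean_zero_test_functions =
     {u \<in> test_functions (ball 0 1). \<forall>r\<in>{0..<1}. (LINT \<omega>|surface_measure. u (r *\<^sub>R \<omega>)) = 0}"

end

theory Submission
  imports Defs
begin

text \<open>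
  Split the energy into its radial and tangential parts. Integrating the square of
  \<open>\<partial>\<^sub>r u + (N - 2) / 2 * u / r\<close> by Euler's identity for homogeneous functions bounds the radial part
  by \<open>(N - 2)\<^sup>2 / 4\<close>, up to that square; since \<open>u 0 = 0\<close>, no boundary term appears at the origin. The
  tangential part is at least \<open>N - 1\<close> times the Hardy integral by the Poincare inequality for mean-zero
  functions on the sphere, and \<open>(N - 2)\<^sup>2 / 4 + N - 1 = N\<^sup>2 / 4\<close>. For \<open>N = 2\<close> the radial constant is
  \<open>1 / 4\<close> with the logarithmic weight, which is at most the Hardy weight, and \<open>1 / 4 + 1 = 5 / 4\<close>.

  The Poincare inequality is obtained from one-dimensional Wirtinger inequalities. For \<open>(x, y)\<close> uniformly
  distributed in the unit ball of \<open>\<real>\<^sup>N \<times> \<real>\<^sup>N\<close> and \<open>F\<close> the 1-homogeneous extension of a function on the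
  sphere, apply Wirtinger along \<open>cos t * x + sin t * y\<close>, whose law does not depend on \<open>t\<close>. As \<open>F\<close> has
  mean zero, \<open>F x\<close> and \<open>F y\<close> are uncorrelated, and one gets \<open>E (F x)\<^sup>2 \<le> E (\<nabla>F x \<bullet> y)\<^sup>2\<close>, which is the
  Poincare inequality with the sharp constant.
\<close>

section \<open>Polar coordinates\<close>

text \<open>In the Poincare step the obstacle is that a function with mean zero on the sphere need
  not have mean zero along a single closed curve \<open>cos t * x + sin t * y\<close>, as Wirtinger
  would require. The odd part of \<open>F\<close> changes sign under a half turn, so it has the
  sharp frequency 1 without further work. The even part is made antiperiodic by subtracting its
  value a quarter turn later; its least frequency is then 2, and this slack pays for a crude
  splitting of the difference. Zero mean enters only through the vanishing correlation. Sharpness: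
  the radial and the tangential step are both equalities for \<open>(x . e) |x|^(-N/2)\<close>, a
  linear form times a radial power, whose Hardy integral diverges logarithmically. A cutoff in
  \<open>ln |x| / R\<close> makes it admissible and changes the quotient by exactly
  \<open>m / R^2\<close>, with \<open>m\<close> independent of \<open>R\<close>. Non-attainment:
  equality forces the radial square to vanish, hence homogeneity of degree
  \<open>-(N - 2) / 2\<close> along rays, which compact support excludes.\<close>

definition radial_measure :: "nat \<Rightarrow> real measure" where
  "radial_measure n = density lborel (\<lambda>r. ennreal (indicator {0<..} r * r ^ (n - 1)))"

lemma borel_measurable_sgn_euclidean [measurable]: "(sgn :: 'a::euclidean_space \<Rightarrow> 'a) \<in> borel_measurable borel"
  unfolding sgn_div_norm by measurable

lemma sets_radial_measure [measurable_cong, simp]: "sets (radial_measure n) = sets borel"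
  and space_radial_measure [simp]: "space (radial_measure n) = UNIV"
  by (auto simp: radial_measure_def)

lemma space_surface_measure [simp]: "space (surface_measure :: 'a::euclidean_space measure) = sphere 0 1"
  and sets_surface_measure [measurable_cong]:
    "sets (surface_measure :: 'a::euclidean_space measure) = sets (restrict_space borel (sphere 0 1))"
  by (auto simp: surface_measure_def space_scale_measure)

lemma finite_measure_surface_measure: "finite_measure (surface_measure :: 'a::euclidean_space measure)"
proof (rule finite_measureI)
  have "emeasure surface_measure (sphere (0::'a) 1) < \<infinity>"
    by (simp add: emeasure_surface_measure_sphere ennreal_mult_less_top of_nat_less_top)
  then show "emeasure surface_measure (space (surface_measure :: 'a measure)) \<noteq> \<infinity>"
    by simp
qed

lemma sigma_finite_radial_measure: "sigma_finite_measure (radial_measure n)"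
  unfolding radial_measure_def
  by (subst sigma_finite_measure.sigma_finite_iff_density_finite[OF sigma_finite_lborel]) auto

lemma pair_sigma_finite_polar:
  "pair_sigma_finite (radial_measure n) (surface_measure :: 'a::euclidean_space measure)"
  using sigma_finite_radial_measure finite_measure_surface_measure
  by (auto simp: pair_sigma_finite_def finite_measure_def)

lemma measurable_polar [measurable]:
  "(\<lambda>(r, \<omega>). r *\<^sub>R \<omega>) \<in> borel_measurable (radial_measure n \<Otimes>\<^sub>M (surface_measure :: 'a::euclidean_space measure))"
proof -
  have [measurable]: "(\<lambda>x. x) \<in> measurable (surface_measure :: 'a measure) borel"
    unfolding measurable_cong_sets[OF sets_surface_measure refl] by (rule measurable_restrict_space1) simp
  show ?thesis
    by measurable
qed

lemma nn_integral_surface_measure: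
  fixes f :: "'a::euclidean_space \<Rightarrow> ennreal"
  assumes [measurable]: "f \<in> borel_measurable borel"
  shows "(\<integral>\<^sup>+\<omega>. f \<omega> \<partial>surface_measure) =
    of_nat DIM('a) * (\<integral>\<^sup>+x. f (sgn x) * indicator (ball 0 1) x \<partial>lborel)"
proof -
  have m: "f \<in> borel_measurable (restrict_space borel (sphere 0 1))"
    by (simp add: measurable_restrict_space1)
  have "(\<integral>\<^sup>+\<omega>. f \<omega> \<partial>surface_measure) =
      of_nat DIM('a) * (\<integral>\<^sup>+x. f (sgn x) \<partial>restrict_space lborel (ball 0 1 - {0}))"
    unfolding surface_measure_def
    by (simp add: nn_integral_scale_measure nn_integral_distr[OF sgn_measurable_sphere] m)
  also have "(\<integral>\<^sup>+x. f (sgn x) \<partial>restrict_space lborel (ball 0 1 - {0})) =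
      (\<integral>\<^sup>+x. f (sgn x) * indicator (ball 0 1) x \<partial>lborel)"
    by (subst nn_integral_restrict_space)
      (auto intro!: nn_integral_cong_AE eventually_mono[OF AE_lborel_singleton[of 0]] split: split_indicator)
  finally show ?thesis .
qed

lemma nn_integral_lborel_scale:
  fixes f :: "'a::euclidean_space \<Rightarrow> ennreal"
  assumes [measurable]: "f \<in> borel_measurable borel" and c: "0 < c"
  shows "(\<integral>\<^sup>+x. f x \<partial>lborel) = ennreal (c ^ DIM('a)) * (\<integral>\<^sup>+x. f (c *\<^sub>R x) \<partial>lborel)"
  using c by (subst lborel_affine[of c 0])
    (simp_all add: nn_integral_density nn_integral_distr nn_integral_cmult ennreal_power)

text \<open>The integrand is \<open>n / m ^ (n + 1)\<close>, kept in the shape that the scaling in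
  \<open>nn_integral_polar\<close> produces. Integrating out the auxiliary radius
  \<open>m > norm y\<close> cancels the weight \<open>norm y ^ n\<close> there.\<close>

lemma nn_integral_inverse_power:
  assumes "0 < a" "0 < n"
  shows "(\<integral>\<^sup>+m. ennreal ((if a < m then 1 else 0) * (real n * m ^ (n - 1) / m ^ (2 * n))) \<partial>lborel) = ennreal (1 / a ^ n)"
proof -
  have "(\<integral>\<^sup>+m. ennreal ((if a < m then 1 else 0) * (real n * m ^ (n - 1) / m ^ (2 * n))) \<partial>lborel) =
     (\<integral>\<^sup>+m. ennreal (real n * m ^ (n - 1) / m ^ (2 * n)) * indicator {a..} m \<partial>lborel)"
    by (rule nn_integral_cong_AE, rule eventually_mono[OF AE_lborel_singleton[of a]]) (auto split: split_indicator)
  also have "\<dots> = ennreal (0 - (- (1 / a ^ n)))"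
  proof (rule nn_integral_FTC_atLeast)
    fix x :: real assume x: "a \<le> x"
    then have "x > 0" using assms by simp
    then show "((\<lambda>x. - (1 / x ^ n)) has_real_derivative n * x ^ (n - 1) / x ^ (2 * n)) (at x)"
      by (auto intro!: derivative_eq_intros simp: power2_eq_square power_mult mult_2 power_add)
    show "0 \<le> n * x ^ (n - 1) / x ^ (2 * n)" using \<open>x > 0\<close> by simp
  next
    have "LIM x at_top. (x::real) ^ n :> at_top"
      using assms by (intro filterlim_pow_at_top filterlim_ident)
    then show "((\<lambda>x. - (1 / x ^ n)) \<longlongrightarrow> (0::real)) at_top"
      using tendsto_minus[OF tendsto_inverse_0_at_top] by (simp add: divide_inverse)
  qed simp
  finally show ?thesis by simp
qed

text \<open>Tonelli and scaling suffice, because the surface measure is a cone measure: a sphere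
  integral is N times a ball integral of a function of \<open>sgn x\<close>. Shifting the length
  from the radius to the point and back leaves the weight \<open>norm y ^ N\<close> times the
  integral of \<open>N / r ^ (N + 1)\<close> over \<open>r > norm y\<close>, which is 1.\<close>

lemma nn_integral_polar:
  fixes f :: "'a::euclidean_space \<Rightarrow> ennreal"
  assumes [measurable]: "f \<in> borel_measurable borel"
  shows "(\<integral>\<^sup>+x. f x \<partial>lborel) = (\<integral>\<^sup>+r. \<integral>\<^sup>+\<omega>. f (r *\<^sub>R \<omega>) \<partial>surface_measure \<partial>radial_measure DIM('a))"
proof -
  let ?N = "DIM('a)"
  define w where "w r = ennreal (indicator {0<..} r * r ^ (?N - 1))" for r :: real
  have [measurable]: "w \<in> borel_measurable borel" unfolding w_def by measurable
  define B where "B = (ball 0 1 :: 'a set)"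
  have [measurable]: "B \<in> sets borel" by (simp add: B_def)
  have [measurable]: "Measurable.pred (borel \<Otimes>\<^sub>M borel) (\<lambda>x::real \<times> 'a. snd x \<in> ball 0 1)"
    by (simp add: dist_norm)
  have [measurable]: "(\<lambda>r. \<integral>\<^sup>+\<omega>. f (r *\<^sub>R \<omega>) \<partial>surface_measure) \<in> borel_measurable borel"
    by (subst nn_integral_surface_measure) measurable
  have "(\<integral>\<^sup>+r. \<integral>\<^sup>+\<omega>. f (r *\<^sub>R \<omega>) \<partial>surface_measure \<partial>radial_measure ?N) =
      (\<integral>\<^sup>+r. w r * (of_nat ?N * (\<integral>\<^sup>+x. f (r *\<^sub>R sgn x) * indicator B x \<partial>lborel)) \<partial>lborel)"
    unfolding radial_measure_def
    by (subst nn_integral_density)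
      (auto simp: w_def B_def nn_integral_surface_measure)
  also have "\<dots> = (\<integral>\<^sup>+r. \<integral>\<^sup>+x. of_nat ?N * w r * f (r *\<^sub>R sgn x) * indicator B x \<partial>lborel \<partial>lborel)"
    by (intro nn_integral_cong) (auto simp flip: nn_integral_cmult simp: ac_simps)
  also have "\<dots> = (\<integral>\<^sup>+x. \<integral>\<^sup>+r. of_nat ?N * w r * f (r *\<^sub>R sgn x) * indicator B x \<partial>lborel \<partial>lborel)"
    by (rule lborel_pair.Fubini') measurable
  \<comment> \<open>Substituting \<open>norm x * r\<close> for \<open>r\<close> turns
    \<open>r *\<^sub>R sgn x\<close> into \<open>r *\<^sub>R x\<close>. Of the factor
    \<open>norm x ^ N\<close>, one power comes from \<open>dr\<close> and \<open>N - 1\<close> from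
    the weight \<open>w\<close>.\<close>
  also have "\<dots> = (\<integral>\<^sup>+x. \<integral>\<^sup>+r. of_nat ?N * ennreal (norm x ^ ?N) * w r * f (r *\<^sub>R x) * indicator B x \<partial>lborel \<partial>lborel)"
  proof (rule nn_integral_cong_AE, rule eventually_mono[OF AE_lborel_singleton[of 0]])
    fix x :: 'a assume x: "x \<noteq> 0"
    have w: "w (norm x * r) = ennreal (norm x ^ (?N - 1)) * w r" for r
      using x by (auto simp: w_def zero_less_mult_iff power_mult_distrib simp flip: ennreal_mult split: split_indicator)
    have g: "(norm x * r) *\<^sub>R sgn x = r *\<^sub>R x" for r
      using x by (simp add: sgn_div_norm)
    have p: "ennreal (norm x) * ennreal (norm x ^ (?N - 1)) = ennreal (norm x ^ ?N)"
      by (simp flip: ennreal_mult power_Suc)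
    have "(\<integral>\<^sup>+r. of_nat ?N * w r * f (r *\<^sub>R sgn x) * indicator B x \<partial>lborel) =
        ennreal (norm x) * (\<integral>\<^sup>+r. of_nat ?N * w (norm x * r) * f ((norm x * r) *\<^sub>R sgn x) * indicator B x \<partial>lborel)"
      using x by (subst nn_integral_real_affine[of _ "norm x" 0]) auto
    also have "\<dots> = (\<integral>\<^sup>+r. ennreal (norm x) * (of_nat ?N * w (norm x * r) * f ((norm x * r) *\<^sub>R sgn x) * indicator B x) \<partial>lborel)"
      by (rule nn_integral_cmult[symmetric]) measurable
    also have "\<dots> = (\<integral>\<^sup>+r. of_nat ?N * ennreal (norm x ^ ?N) * w r * f (r *\<^sub>R x) * indicator B x \<partial>lborel)"
      by (intro nn_integral_cong, simp only: w g, simp only: p[symmetric] ac_simps)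
    finally show "(\<integral>\<^sup>+r. of_nat ?N * w r * f (r *\<^sub>R sgn x) * indicator B x \<partial>lborel) = \<dots>" .
  qed
  also have "\<dots> = (\<integral>\<^sup>+r. \<integral>\<^sup>+x. of_nat ?N * ennreal (norm x ^ ?N) * w r * f (r *\<^sub>R x) * indicator B x \<partial>lborel \<partial>lborel)"
    by (rule lborel_pair.Fubini'[symmetric]) measurable
  \<comment> \<open>Here \<open>y = r *\<^sub>R x\<close>. One factor \<open>r ^ N\<close> of the
    denominator is the Jacobian, the other comes from writing \<open>norm x\<close> as
    \<open>norm y / r\<close>; the unit ball becomes \<open>norm y < r\<close>.\<close>
  also have "\<dots> = (\<integral>\<^sup>+r. \<integral>\<^sup>+y. ennreal ((if norm y < r then 1 else 0) * (?N * r ^ (?N - 1) / r ^ (2 * ?N))) * (ennreal (norm y ^ ?N) * f y) \<partial>lborel \<partial>lborel)"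
  proof (rule nn_integral_cong)
    fix r :: real
    show "(\<integral>\<^sup>+x. of_nat ?N * ennreal (norm x ^ ?N) * w r * f (r *\<^sub>R x) * indicator B x \<partial>lborel) =
      (\<integral>\<^sup>+y. ennreal ((if norm y < r then 1 else 0) * (?N * r ^ (?N - 1) / r ^ (2 * ?N))) * (ennreal (norm y ^ ?N) * f y) \<partial>lborel)"
    proof (cases "r > 0")
      case False
      then have "w r = 0" "\<And>y::'a. \<not> norm y < r"
        by (auto simp: w_def dest: le_less_trans[OF norm_ge_zero])
      then show ?thesis by simp
    next
      case True
      have "(\<integral>\<^sup>+y. ennreal ((if norm y < r then 1 else 0) * (?N * r ^ (?N - 1) / r ^ (2 * ?N))) * (ennreal (norm y ^ ?N) * f y) \<partial>lborel)
        = (\<integral>\<^sup>+x. ennreal (r ^ ?N) * (ennreal ((if norm (r *\<^sub>R x) < r then 1 else 0) * (?N * r ^ (?N - 1) / r ^ (2 * ?N))) * (ennreal (norm (r *\<^sub>R x) ^ ?N) * f (r *\<^sub>R x))) \<partial>lborel)"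
        by (subst nn_integral_lborel_scale[OF _ True]) (auto simp: nn_integral_cmult)
      also have "\<dots> = (\<integral>\<^sup>+x. of_nat ?N * ennreal (norm x ^ ?N) * w r * f (r *\<^sub>R x) * indicator B x \<partial>lborel)"
      proof (intro nn_integral_cong)
        fix x :: 'a
        have i: "(if norm (r *\<^sub>R x) < r then 1 else 0) = (indicator B x :: real)"
          using True by (auto simp: B_def split: split_indicator)
        have q: "r ^ (2 * ?N) = r ^ ?N * r ^ ?N"
          by (simp add: mult_2 power_add)
        have "ennreal (r ^ ?N) * (ennreal (?N * r ^ (?N - 1) / r ^ (2 * ?N)) * ennreal (norm (r *\<^sub>R x) ^ ?N)) =
          ennreal (r ^ ?N * ((?N * r ^ (?N - 1) / r ^ (2 * ?N)) * (r * norm x) ^ ?N))"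
          using True by (simp flip: ennreal_mult add: ennreal_mult'')
        also have "r ^ ?N * ((?N * r ^ (?N - 1) / r ^ (2 * ?N)) * (r * norm x) ^ ?N) = ?N * (norm x ^ ?N * r ^ (?N - 1))"
          using True q by (simp add: power_mult_distrib divide_simps)
        also have "ennreal \<dots> = of_nat ?N * ennreal (norm x ^ ?N) * w r"
          using True by (simp add: w_def ennreal_mult ennreal_of_nat_eq_real_of_nat mult.assoc)
        finally have e: "ennreal (r ^ ?N) * (ennreal (?N * r ^ (?N - 1) / r ^ (2 * ?N)) * ennreal (norm (r *\<^sub>R x) ^ ?N)) = of_nat ?N * ennreal (norm x ^ ?N) * w r" .
        show "ennreal (r ^ ?N) * (ennreal ((if norm (r *\<^sub>R x) < r then 1 else 0) * (?N * r ^ (?N - 1) / r ^ (2 * ?N))) * (ennreal (norm (r *\<^sub>R x) ^ ?N) * f (r *\<^sub>R x)))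
          = of_nat ?N * ennreal (norm x ^ ?N) * w r * f (r *\<^sub>R x) * indicator B x"
          unfolding i using arg_cong[OF e, of "\<lambda>t. t * f (r *\<^sub>R x)"]
          by (cases "x \<in> B") (simp_all only: mult.assoc indicator_simps mult_1_left mult_1_right mult_zero_left mult_zero_right ennreal_0 not_False_eq_True)
      qed
      finally show ?thesis by (rule sym)
    qed
  qed
  also have "\<dots> = (\<integral>\<^sup>+y. \<integral>\<^sup>+r. ennreal ((if norm y < r then 1 else 0) * (?N * r ^ (?N - 1) / r ^ (2 * ?N))) * (ennreal (norm y ^ ?N) * f y) \<partial>lborel \<partial>lborel)"
    by (rule lborel_pair.Fubini') measurable
  also have "\<dots> = (\<integral>\<^sup>+y. f y \<partial>lborel)"
  proof (rule nn_integral_cong_AE, rule eventually_mono[OF AE_lborel_singleton[of 0]])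
    fix y :: 'a assume y: "y \<noteq> 0"
    have "ennreal (1 / norm y ^ ?N) * ennreal (norm y ^ ?N) = 1"
      using y by (simp flip: ennreal_mult)
    then show "(\<integral>\<^sup>+r. ennreal ((if norm y < r then 1 else 0) * (?N * r ^ (?N - 1) / r ^ (2 * ?N))) * (ennreal (norm y ^ ?N) * f y) \<partial>lborel) = f y"
      using y by (subst nn_integral_multc, measurable, subst nn_integral_inverse_power) (auto simp flip: mult.assoc)
  qed
  finally show ?thesis ..
qed

text \<open>As a pushforward, the formula transfers integrability too, so Fubini becomes available
  for functions of either sign and in both orders.\<close>

lemma lborel_polar:
  "(lborel :: 'a::euclidean_space measure) =
     distr (radial_measure DIM('a) \<Otimes>\<^sub>M surface_measure) borel (\<lambda>(r, \<omega>). r *\<^sub>R \<omega>)"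
proof (rule measure_eqI)
  interpret pair_sigma_finite "radial_measure DIM('a)" "surface_measure :: 'a measure"
    by (rule pair_sigma_finite_polar)
  fix A :: "'a set" assume "A \<in> sets lborel"
  then have [measurable]: "A \<in> sets borel" by simp
  let ?M = "radial_measure DIM('a) \<Otimes>\<^sub>M (surface_measure :: 'a measure)"
  have "emeasure lborel A = (\<integral>\<^sup>+x. indicator A x \<partial>lborel)"
    by simp
  also have "\<dots> = (\<integral>\<^sup>+r. \<integral>\<^sup>+\<omega>. indicator A (r *\<^sub>R \<omega>) \<partial>surface_measure \<partial>radial_measure DIM('a))"
    by (rule nn_integral_polar) simp
  also have "\<dots> = (\<integral>\<^sup>+z. indicator A ((\<lambda>(r, \<omega>). r *\<^sub>R \<omega>) z) \<partial>?M)"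
    by (subst M2.nn_integral_fst[symmetric]) (auto intro!: measurable_compose[OF measurable_polar])
  also have "\<dots> = (\<integral>\<^sup>+x. indicator A x \<partial>distr ?M borel (\<lambda>(r, \<omega>). r *\<^sub>R \<omega>))"
    by (subst nn_integral_distr) (auto simp: measurable_polar)
  finally show "emeasure lborel A = emeasure (distr ?M borel (\<lambda>(r, \<omega>). r *\<^sub>R \<omega>)) A"
    by simp
qed simp

lemma
  fixes f :: "'a::euclidean_space \<Rightarrow> real"
  assumes f: "integrable lborel f"
  shows integral_polar: "(\<integral>x. f x \<partial>lborel) = (\<integral>r. \<integral>\<omega>. f (r *\<^sub>R \<omega>) \<partial>surface_measure \<partial>radial_measure DIM('a))"
    and integral_polar': "(\<integral>x. f x \<partial>lborel) = (\<integral>\<omega>. \<integral>r. f (r *\<^sub>R \<omega>) \<partial>radial_measure DIM('a) \<partial>surface_measure)"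
proof -
  interpret pair_sigma_finite "radial_measure DIM('a)" "surface_measure :: 'a measure"
    by (rule pair_sigma_finite_polar)
  let ?M = "radial_measure DIM('a) \<Otimes>\<^sub>M (surface_measure :: 'a measure)"
  have [measurable]: "f \<in> borel_measurable borel" using f by auto
  have "integrable (distr ?M borel (\<lambda>(r, \<omega>). r *\<^sub>R \<omega>)) f"
    using f by (simp flip: lborel_polar)
  then have i: "integrable ?M (\<lambda>(r, \<omega>). f (r *\<^sub>R \<omega>))"
    by (subst (asm) integrable_distr_eq) (auto simp: measurable_polar split_beta')
  have "(\<integral>x. f x \<partial>lborel) = (\<integral>(r, \<omega>). f (r *\<^sub>R \<omega>) \<partial>?M)"
    by (subst lborel_polar, subst integral_distr) (auto simp: measurable_polar split_beta')
  with integral_fst[OF i] integral_snd[OF i]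
  show "(\<integral>x. f x \<partial>lborel) = (\<integral>r. \<integral>\<omega>. f (r *\<^sub>R \<omega>) \<partial>surface_measure \<partial>radial_measure DIM('a))"
    and "(\<integral>x. f x \<partial>lborel) = (\<integral>\<omega>. \<integral>r. f (r *\<^sub>R \<omega>) \<partial>radial_measure DIM('a) \<partial>surface_measure)"
    by auto
qed

lemma AE_radial_measure: "AE r in radial_measure n. 0 < r"
  unfolding radial_measure_def by (subst AE_density) (auto split: split_indicator)

lemma integral_scale_measure_of_nat:
  fixes f :: "'a \<Rightarrow> real"
  assumes "f \<in> borel_measurable M"
  shows "(\<integral>x. f x \<partial>scale_measure (of_nat n) M) = n * (\<integral>x. f x \<partial>M)"
proof -
  have "scale_measure (of_nat n) M = density M (\<lambda>_. ennreal (real n))"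
    by (rule measure_eqI) (simp_all add: emeasure_density_const ennreal_of_nat_eq_real_of_nat)
  then show ?thesis
    using assms by (simp add: integral_density)
qed

lemma integral_surface_measure:
  fixes f :: "'a::euclidean_space \<Rightarrow> real"
  assumes [measurable]: "f \<in> borel_measurable borel"
  shows "(\<integral>\<omega>. f \<omega> \<partial>surface_measure) = DIM('a) * (\<integral>x. indicator (ball 0 1) x * f (sgn x) \<partial>lborel)"
proof -
  have m: "f \<in> borel_measurable (restrict_space borel (sphere 0 1))"
    by (simp add: measurable_restrict_space1)
  have f': "(\<lambda>x. f (sgn x)) \<in> borel_measurable borel"
    by measurable
  have "(\<integral>\<omega>. f \<omega> \<partial>surface_measure) =
      DIM('a) * (\<integral>x. f (sgn x) \<partial>restrict_space lborel (ball 0 1 - {0}))"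
    unfolding surface_measure_def
    by (simp add: integral_scale_measure_of_nat integral_distr[OF sgn_measurable_sphere] m)
  also have "(\<integral>x. f (sgn x) \<partial>restrict_space lborel (ball 0 1 - {0})) =
      (\<integral>x. indicator (ball 0 1) x * f (sgn x) \<partial>lborel)"
    by (subst integral_restrict_space)
      (auto intro!: integral_cong_AE eventually_mono[OF AE_lborel_singleton[of 0]] f' borel_measurable_times
        borel_measurable_indicator split: split_indicator)
  finally show ?thesis .
qed

lemma integral_nonneg_polar:
  fixes f :: "'a::euclidean_space \<Rightarrow> real"
  assumes "integrable lborel f" "\<And>r. 0 < r \<Longrightarrow> 0 \<le> (\<integral>\<omega>. f (r *\<^sub>R \<omega>) \<partial>surface_measure)"
  shows "0 \<le> (\<integral>x. f x \<partial>lborel)"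
  unfolding integral_polar[OF assms(1)]
  by (intro integral_nonneg_AE eventually_mono[OF AE_radial_measure] assms(2))

text \<open>In polar coordinates direction and length separate. In particular, a mean-zero factor
  \<open>h\<close> annihilates the integral.\<close>

lemma integral_sgn_mult_norm:
  fixes h :: "'a::euclidean_space \<Rightarrow> real"
  assumes [measurable]: "h \<in> borel_measurable borel" "k \<in> borel_measurable borel"
    and int: "integrable lborel (\<lambda>x. h (sgn x) * k (norm x))"
  shows "(\<integral>x. h (sgn x) * k (norm x) \<partial>lborel) =
    (\<integral>\<omega>. h \<omega> \<partial>surface_measure) * (\<integral>r. k r \<partial>radial_measure DIM('a))"
proof -
  \<comment> \<open>Measurability in \<open>r\<close> is read off from the expression of the sphere
    integral as an integral over the ball.\<close>
  have [measurable]: "(\<lambda>r. \<integral>\<omega>. g (r *\<^sub>R \<omega>) \<partial>surface_measure) \<in> borel_measurable borel"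
    if [measurable]: "g \<in> borel_measurable borel" for g :: "'a \<Rightarrow> real"
  proof (subst integral_surface_measure)
    have [measurable]: "Measurable.pred (borel \<Otimes>\<^sub>M borel) (\<lambda>x::real \<times> 'a. snd x \<in> ball 0 1)"
      by (simp add: dist_norm)
    show "(\<lambda>r. DIM('a) * (\<integral>x. indicator (ball 0 1) x * g (r *\<^sub>R sgn x) \<partial>lborel)) \<in> borel_measurable borel"
      by measurable
  qed measurable
  then have m: "(\<lambda>r. \<integral>\<omega>. h (sgn (r *\<^sub>R \<omega>)) * k (norm (r *\<^sub>R \<omega>)) \<partial>surface_measure) \<in> borel_measurable borel"
    by measurable
  have "(\<integral>\<omega>. h (sgn (r *\<^sub>R \<omega>)) * k (norm (r *\<^sub>R \<omega>)) \<partial>surface_measure) = (\<integral>\<omega>. h \<omega> \<partial>surface_measure) * k r"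
    if "r > 0" for r
  proof -
    have "(\<integral>\<omega>. h (sgn (r *\<^sub>R \<omega>)) * k (norm (r *\<^sub>R \<omega>)) \<partial>surface_measure) = (\<integral>\<omega>. h \<omega> * k r \<partial>surface_measure)"
      using that by (intro Bochner_Integration.integral_cong) (auto simp: sgn_scaleR, auto simp: sgn_div_norm)
    then show ?thesis by simp
  qed
  then have "(\<integral>x. h (sgn x) * k (norm x) \<partial>lborel) =
      (\<integral>r. (\<integral>\<omega>. h \<omega> \<partial>surface_measure) * k r \<partial>radial_measure DIM('a))"
    unfolding integral_polar[OF int]
    by (intro integral_cong_AE eventually_mono[OF AE_radial_measure])
      (simp_all add: measurable_cong_sets[OF sets_radial_measure refl] m del: norm_scaleR)
  then show ?thesis by simp
qed

lemma integral_radial_measure: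
  fixes f :: "real \<Rightarrow> real"
  assumes [measurable]: "f \<in> borel_measurable borel"
  shows "(\<integral>r. f r \<partial>radial_measure n) = (\<integral>r. indicator {0<..} r * r ^ (n - 1) * f r \<partial>lborel)"
  unfolding radial_measure_def by (subst integral_density) (auto split: split_indicator)

text \<open>Here \<open>f'\<close> is the radial derivative \<open>x . \<nabla> f\<close>. On each
  ray \<open>r ^ N * f\<close> has derivative \<open>r ^ (N - 1) * (f' + N * f)\<close>; it vanishes
  at 0 because \<open>f\<close> is bounded and at \<open>c\<close> because of the support, so the
  derivative integrates to zero. This takes the place of the divergence theorem and covers functions
  such as \<open>(v / |x|)^2\<close> that are merely bounded near the origin.\<close>

lemma integral_euler:
  fixes f f' :: "'a::euclidean_space \<Rightarrow> real"
  assumes f [measurable]: "f \<in> borel_measurable borel" "f' \<in> borel_measurable borel"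
    and bd: "\<And>x. \<bar>f x\<bar> \<le> K" "\<And>x. \<bar>f' x\<bar> \<le> K"
    and c: "0 < c" "c < 1" "\<And>x. c \<le> norm x \<Longrightarrow> f x = 0" "\<And>x. c \<le> norm x \<Longrightarrow> f' x = 0"
    and deriv: "\<And>r \<omega>. norm \<omega> = 1 \<Longrightarrow> 0 < r \<Longrightarrow> r < 1 \<Longrightarrow>
      ((\<lambda>r. f (r *\<^sub>R \<omega>)) has_real_derivative f' (r *\<^sub>R \<omega>) / r) (at r)"
  shows "integrable lborel f" "integrable lborel f'"
    "(\<integral>x. f' x \<partial>lborel) = - DIM('a) * (\<integral>x. f x \<partial>lborel)"
proof -
  have i: "integrable lborel g" if "g \<in> borel_measurable borel" "\<And>x. \<bar>g x\<bar> \<le> K" "\<And>x. c \<le> norm x \<Longrightarrow> g x = 0"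
    for g :: "'a \<Rightarrow> real"
    by (rule integrableI_bounded_set[where A="ball 0 c" and B=K])
      (use that c in \<open>auto simp: emeasure_ball not_less\<close>)
  show if1: "integrable lborel f" and if2: "integrable lborel f'"
    using c bd by (auto intro!: i)
  let ?n = "DIM('a)"
  have "(\<integral>r. f' (r *\<^sub>R \<omega>) + ?n * f (r *\<^sub>R \<omega>) \<partial>radial_measure ?n) = 0" if \<omega>: "\<omega> \<in> sphere 0 1" for \<omega> :: 'a
  proof -
    have n: "norm (r *\<^sub>R \<omega>) = \<bar>r\<bar>" for r using \<omega> by simp
    define G where "G r = r ^ ?n * f (r *\<^sub>R \<omega>)" for r
    define g where "g r = r ^ (?n - 1) * (f' (r *\<^sub>R \<omega>) + ?n * f (r *\<^sub>R \<omega>))" for r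
    have z: "f (r *\<^sub>R \<omega>) = 0" "f' (r *\<^sub>R \<omega>) = 0" if "\<not> r \<le> c" "0 < r" for r
      using c(3,4)[of "r *\<^sub>R \<omega>"] that n[of r] by auto
    have G0: "G 0 = 0" unfolding G_def using DIM_positive[where 'a='a] by (simp add: power_0_left)
    have Gc: "G c = 0" using c n[of c] by (simp add: G_def)
    have [measurable]: "g \<in> borel_measurable borel" unfolding g_def by measurable
    have dG: "(G has_real_derivative g r) (at r)" if "0 < r" "r < 1" for r
    proof -
      have *: "r ^ ?n = r ^ (?n - 1) * r" using DIM_positive[where 'a='a] by (cases ?n) auto
      show ?thesis
        unfolding G_def g_def using that \<omega>
        by (auto intro!: derivative_eq_intros deriv simp: field_simps *)
    qed
    have "(g has_integral (G c - G 0)) {0..c}"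
    proof (rule fundamental_theorem_of_calculus_interior)
      show "(G has_vector_derivative g r) (at r)" if "r \<in> {0<..<c}" for r
        using dG[of r] that c by (simp add: has_real_derivative_iff_has_vector_derivative)
      have "(G \<longlongrightarrow> 0) (at 0)"
      proof (rule tendsto_0_le[where K=K])
        show "\<forall>\<^sub>F r in at 0. norm (G r) \<le> norm (r ^ ?n) * K"
          using bd by (auto simp: G_def abs_mult intro!: always_eventually mult_left_mono)
        show "((\<lambda>r::real. r ^ ?n) \<longlongrightarrow> 0) (at 0)"
          by (auto intro!: tendsto_eq_intros)
      qed
      with G0 have "isCont G 0" by (simp add: isCont_def)
      moreover have "isCont G r" if "0 < r" "r < 1" for r
        using dG[OF that] by (rule DERIV_isCont)
      ultimately have "isCont G r" if "r \<in> {0..c}" for r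
        using that c by (cases "r = 0") auto
      then show "continuous_on {0..c} G"
        by (simp add: continuous_at_imp_continuous_on)
    qed (use c in auto)
    then have g0: "(g has_integral 0) {0..c}"
      by (simp add: G0 Gc)
    have "set_integrable lborel {0..c} g"
      unfolding set_integrable_def
    proof (rule integrableI_bounded_set_indicator[where B="K + ?n * K"])
      show "AE r in lborel. r \<in> {0..c} \<longrightarrow> norm (g r) \<le> K + ?n * K"
      proof (intro AE_I2 impI)
        fix r assume r: "r \<in> {0..c}"
        then have "\<bar>r ^ (?n - 1)\<bar> \<le> 1" using c by (simp add: power_le_one)
        moreover have "\<bar>f' (r *\<^sub>R \<omega>) + ?n * f (r *\<^sub>R \<omega>)\<bar> \<le> K + ?n * K"
          using bd(2)[of "r *\<^sub>R \<omega>"] bd(1)[of "r *\<^sub>R \<omega>"]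
          by (intro order_trans[OF abs_triangle_ineq] add_mono) (auto simp: abs_mult)
        ultimately show "norm (g r) \<le> K + ?n * K"
          unfolding g_def by (simp only: real_norm_def abs_mult) (rule order_trans[OF mult_left_le_one_le], auto)
      qed
    qed (use c in auto)
    then have "(LINT r:{0..c}|lborel. g r) = 0"
      using set_borel_integral_eq_integral(2)[of "{0..c}" g] g0 by (simp add: integral_unique)
    moreover have "(LINT r:{0..c}|lborel. g r) = (\<integral>r. f' (r *\<^sub>R \<omega>) + ?n * f (r *\<^sub>R \<omega>) \<partial>radial_measure ?n)"
      unfolding set_lebesgue_integral_def
    proof (subst integral_radial_measure, goal_cases)
      case 2
      show ?case
      proof (rule integral_cong_AE)
        show "AE r in lborel. indicator {0..c} r *\<^sub>R g r = indicator {0<..} r * r ^ (?n - 1) * (f' (r *\<^sub>R \<omega>) + ?n * f (r *\<^sub>R \<omega>))"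
          using AE_lborel_singleton[of 0]
          by eventually_elim (auto simp: g_def z split: split_indicator)
      qed measurable
    qed measurable
    ultimately show ?thesis by simp
  qed
  then have "(\<integral>\<omega>. \<integral>r. f' (r *\<^sub>R \<omega>) + ?n * f (r *\<^sub>R \<omega>) \<partial>radial_measure ?n \<partial>surface_measure) =
      (\<integral>\<omega>. 0 \<partial>(surface_measure :: 'a measure))"
    by (intro Bochner_Integration.integral_cong) simp_all
  then have "(\<integral>x. f' x + ?n * f x \<partial>lborel) = 0"
    by (subst integral_polar') (use if1 if2 in simp_all)
  then show "(\<integral>x. f' x \<partial>lborel) = - ?n * (\<integral>x. f x \<partial>lborel)"
    using if1 if2 by simp
qed

section \<open>Rotations in the plane spanned by a pair of vectors\<close>

text \<open>In \<open>t\<close>, the first component has the second as its derivative, and the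
  second has minus the first. Thus a pair is a position together with its velocity, and a rotation
  moves both along one curve.\<close>

definition rot :: "real \<Rightarrow> 'a::real_vector \<times> 'a \<Rightarrow> 'a \<times> 'a" where
  "rot t z = (cos t *\<^sub>R fst z + sin t *\<^sub>R snd z, cos t *\<^sub>R snd z - sin t *\<^sub>R fst z)"

lemma fst_rot [simp]: "fst (rot t z) = cos t *\<^sub>R fst z + sin t *\<^sub>R snd z"
  and snd_rot [simp]: "snd (rot t z) = cos t *\<^sub>R snd z - sin t *\<^sub>R fst z"
  by (simp_all add: rot_def)

lemma rot_rot: "rot s (rot t z) = rot (s + t) z"
  by (simp add: rot_def algebra_simps cos_add sin_add)

lemma rot_half_pi: "rot (pi / 2) z = (snd z, - fst z)"
  by (simp add: rot_def)

lemma norm_rot [simp]: "norm (rot t z) = norm (z :: 'a::real_inner \<times> 'a)"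
proof -
  have "(c *\<^sub>R a + s *\<^sub>R b) \<bullet> (c *\<^sub>R a + s *\<^sub>R b) + (c *\<^sub>R b - s *\<^sub>R a) \<bullet> (c *\<^sub>R b - s *\<^sub>R a) =
      (c * c + s * s) * (a \<bullet> a + b \<bullet> b)" for a b :: 'a and c s :: real
    by (simp add: inner_simps algebra_simps inner_commute)
  from this[of "cos t" "fst z" "sin t" "snd z"] have "rot t z \<bullet> rot t z = z \<bullet> z"
    by (simp add: inner_prod_def sin_cos_squared_add3)
  then show ?thesis by (simp add: norm_eq_sqrt_inner)
qed

lemma continuous_on_rot [continuous_intros]:
  fixes f :: "'b::t2_space \<Rightarrow> 'a::real_normed_vector \<times> 'a"
  shows "continuous_on S t \<Longrightarrow> continuous_on S f \<Longrightarrow> continuous_on S (\<lambda>x. rot (t x) (f x))"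
  unfolding rot_def by (intro continuous_intros)

lemma borel_measurable_rot [measurable (raw)]:
  fixes f :: "'b \<Rightarrow> 'a::euclidean_space \<times> 'a"
  assumes [measurable]: "t \<in> borel_measurable M" "f \<in> borel_measurable M"
  shows "(\<lambda>x. rot (t x) (f x)) \<in> borel_measurable M"
  using continuous_on_rot[of UNIV fst snd] assms
  by (intro borel_measurable_continuous_Pair[where H="rot"] continuous_on_rot continuous_intros) auto

lemma nn_integral_lborel_translate:
  fixes f :: "'a::euclidean_space \<Rightarrow> ennreal"
  assumes [measurable]: "f \<in> borel_measurable borel"
  shows "(\<integral>\<^sup>+x. f (c + x) \<partial>lborel) = (\<integral>\<^sup>+x. f x \<partial>lborel)"
proof -
  have "(\<integral>\<^sup>+x. f x \<partial>lborel) = (\<integral>\<^sup>+x. f x \<partial>distr lborel borel ((+) c))"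
    by (simp add: lborel_distr_plus)
  then show ?thesis
    by (simp add: nn_integral_distr)
qed

text \<open>For a fixed second component the map translates the first one, so Tonelli reduces the
  claim to translation invariance.\<close>

lemma distr_lborel_shear_fst:
  "distr lborel borel (\<lambda>z. (fst z + a *\<^sub>R snd z, snd z)) = (lborel :: ('a::euclidean_space \<times> 'a) measure)"
proof (rule measure_eqI)
  fix A :: "('a \<times> 'a) set" assume "A \<in> sets (distr lborel borel (\<lambda>z. (fst z + a *\<^sub>R snd z, snd z)))"
  then have A [measurable]: "A \<in> sets borel" by simp
  have [measurable]: "A \<in> sets (borel \<Otimes>\<^sub>M borel)" using A unfolding borel_prod .
  have m [measurable]: "(\<lambda>z::'a \<times> 'a. (fst z + a *\<^sub>R snd z, snd z)) \<in> borel_measurable borel"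
    by (intro borel_measurable_continuous_onI continuous_intros)
  have "emeasure (distr lborel borel (\<lambda>z. (fst z + a *\<^sub>R snd z, snd z))) A
      = (\<integral>\<^sup>+z. indicator A (fst z + a *\<^sub>R snd z, snd z) \<partial>(lborel :: ('a \<times> 'a) measure))"
    by (subst nn_integral_indicator[symmetric], simp, subst nn_integral_distr) auto
  also have "\<dots> = (\<integral>\<^sup>+y. \<integral>\<^sup>+x. indicator A (a *\<^sub>R y + x, y) \<partial>lborel \<partial>lborel)"
    by (subst lborel_prod[symmetric], subst lborel_pair.nn_integral_snd[symmetric])
      (auto simp: add.commute)
  also have "\<dots> = (\<integral>\<^sup>+y. \<integral>\<^sup>+x. indicator A (x, y) \<partial>lborel \<partial>lborel)"
    by (intro nn_integral_cong nn_integral_lborel_translate) measurable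
  also have "\<dots> = emeasure lborel A"
    by (subst lborel_pair.nn_integral_snd, simp, subst lborel_prod) simp
  finally show "emeasure (distr lborel borel (\<lambda>z. (fst z + a *\<^sub>R snd z, snd z))) A = emeasure lborel A" .
qed simp

lemma distr_lborel_shear_snd:
  "distr lborel borel (\<lambda>z. (fst z, snd z + a *\<^sub>R fst z)) = (lborel :: ('a::euclidean_space \<times> 'a) measure)"
proof (rule measure_eqI)
  fix A :: "('a \<times> 'a) set" assume "A \<in> sets (distr lborel borel (\<lambda>z. (fst z, snd z + a *\<^sub>R fst z)))"
  then have A [measurable]: "A \<in> sets borel" by simp
  have [measurable]: "A \<in> sets (borel \<Otimes>\<^sub>M borel)" using A unfolding borel_prod .
  have m [measurable]: "(\<lambda>z::'a \<times> 'a. (fst z, snd z + a *\<^sub>R fst z)) \<in> borel_measurable borel"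
    by (intro borel_measurable_continuous_onI continuous_intros)
  have "emeasure (distr lborel borel (\<lambda>z. (fst z, snd z + a *\<^sub>R fst z))) A
      = (\<integral>\<^sup>+z. indicator A (fst z, snd z + a *\<^sub>R fst z) \<partial>(lborel :: ('a \<times> 'a) measure))"
    by (subst nn_integral_indicator[symmetric], simp, subst nn_integral_distr) auto
  also have "\<dots> = (\<integral>\<^sup>+x. \<integral>\<^sup>+y. indicator A (x, a *\<^sub>R x + y) \<partial>lborel \<partial>lborel)"
    by (subst lborel_prod[symmetric], subst lborel.nn_integral_fst[symmetric])
      (auto simp: add.commute)
  also have "\<dots> = (\<integral>\<^sup>+x. \<integral>\<^sup>+y. indicator A (x, y) \<partial>lborel \<partial>lborel)"
    by (intro nn_integral_cong nn_integral_lborel_translate) measurable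
  also have "\<dots> = emeasure lborel A"
    by (subst lborel.nn_integral_fst, simp, subst lborel_prod) simp
  finally show "emeasure (distr lborel borel (\<lambda>z. (fst z, snd z + a *\<^sub>R fst z))) A = emeasure lborel A" .
qed simp

lemma distr_lborel_comp:
  assumes [measurable]: "f \<in> borel_measurable borel" "g \<in> borel_measurable borel"
    and "distr lborel borel f = lborel" "distr lborel borel g = lborel"
  shows "distr lborel borel (\<lambda>x. g (f x)) = lborel"
proof -
  have "distr lborel borel (g \<circ> f) = distr (distr lborel borel f) borel g"
    by (subst distr_distr) auto
  then show ?thesis using assms by (simp add: comp_def)
qed

text \<open>A rotation is a product of three shears, except for the half turn.\<close>

lemma distr_lborel_rot: "distr lborel borel (rot t) = (lborel :: ('a::euclidean_space \<times> 'a) measure)"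
proof -
  have 1: "distr lborel borel (rot t) = (lborel :: ('a \<times> 'a) measure)" if c: "cos (t / 2) \<noteq> 0" for t
  proof -
    \<comment> \<open>The shear coefficients are \<open>tan (t / 2)\<close>, \<open>- sin t\<close>,
      \<open>tan (t / 2)\<close>; the half-angle identities below are what makes the product a
      rotation.\<close>
    define \<tau> where "\<tau> = tan (t / 2)"
    define f where "f z = (fst z + \<tau> *\<^sub>R snd z, snd z)" for z :: "'a \<times> 'a"
    define g where "g z = (fst z, snd z + (- sin t) *\<^sub>R fst z)" for z :: "'a \<times> 'a"
    have [measurable]: "f \<in> borel_measurable borel" "g \<in> borel_measurable borel"
      unfolding f_def g_def by (intro borel_measurable_continuous_onI continuous_intros)+
    have df: "distr lborel borel f = lborel" unfolding f_def by (rule distr_lborel_shear_fst)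
    have dg: "distr lborel borel g = lborel" unfolding g_def by (rule distr_lborel_shear_snd)
    have "sin t = 2 * sin (t / 2) * cos (t / 2)" "cos t = 2 * (cos (t / 2))\<^sup>2 - 1" "cos t = 1 - 2 * (sin (t / 2))\<^sup>2"
      using sin_double[of "t / 2"] cos_double_cos[of "t / 2"] cos_double_sin[of "t / 2"] by auto
    then have t: "sin t * \<tau> = 1 - cos t" "\<tau> * (1 + cos t) = sin t"
      using c by (auto simp: \<tau>_def tan_def power2_eq_square)
    have "f (g (f z)) = rot t z" for z
    proof -
      have "snd (g (f z)) = snd (rot t z)"
        using t(1) by (simp add: f_def g_def algebra_simps flip: scaleR_add_left)
      moreover have "fst z + \<tau> *\<^sub>R snd z + \<tau> *\<^sub>R snd (rot t z) = fst (rot t z)"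
      proof -
        have "fst z + \<tau> *\<^sub>R snd z + \<tau> *\<^sub>R snd (rot t z) = (1 - sin t * \<tau>) *\<^sub>R fst z + (\<tau> * (1 + cos t)) *\<^sub>R snd z"
          by (simp add: algebra_simps)
        then show ?thesis unfolding t by simp
      qed
      ultimately show ?thesis
        by (simp add: f_def g_def prod_eq_iff)
    qed
    then have eq: "rot t = (\<lambda>z. f (g (f z)))" by auto
    show ?thesis
      unfolding eq
      by (rule distr_lborel_comp[where f="\<lambda>z. g (f z)" and g=f],
          measurable, rule distr_lborel_comp[where f=f and g=g]) (simp_all add: df dg)
  qed
  show ?thesis
  proof (cases "cos (t / 2) = 0")
    \<comment> \<open>The tangent is undefined here, so the rotation is taken as two rotations by
      \<open>t / 2\<close>. Their half angle is admissible: \<open>cos (t / 4) = 0\<close> would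
      give \<open>cos (t / 2) = -1\<close>.\<close>
    case True
    have "cos (t / 2) = 2 * (cos (t / 2 / 2))\<^sup>2 - 1"
      using cos_double_cos[of "t / 2 / 2"] by simp
    with True have "cos (t / 2 / 2) \<noteq> 0" by auto
    then have "distr lborel borel (\<lambda>z. rot (t / 2) (rot (t / 2) z)) = (lborel :: ('a \<times> 'a) measure)"
      by (intro distr_lborel_comp[where f="rot (t / 2)" and g="rot (t / 2)"] 1) simp_all
    moreover have "(\<lambda>z::'a \<times> 'a. rot (t / 2) (rot (t / 2) z)) = rot t"
      by (simp add: rot_rot)
    ultimately show ?thesis by simp
  qed (rule 1)
qed

lemma integral_ball_rot:
  fixes g :: "'a::euclidean_space \<times> 'a \<Rightarrow> real"
  assumes [measurable]: "g \<in> borel_measurable borel"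
  shows "(\<integral>z. indicator (ball 0 1) z * g (rot t z) \<partial>lborel) = (\<integral>z. indicator (ball 0 1) z * g z \<partial>lborel)"
proof -
  have "(\<integral>z. indicator (ball 0 1) z * g z \<partial>lborel) = (\<integral>z. indicator (ball 0 1) z * g z \<partial>distr lborel borel (rot t))"
    by (simp add: distr_lborel_rot)
  also have "\<dots> = (\<integral>z. indicator (ball 0 1) (rot t z) * g (rot t z) \<partial>lborel)"
    by (rule integral_distr) (auto intro!: borel_measurable_times borel_measurable_indicator)
  also have "\<dots> = (\<integral>z. indicator (ball 0 1) z * g (rot t z) \<partial>lborel)"
    by (simp add: indicator_def)
  finally show ?thesis ..
qed

text \<open>Each rotation preserves the ball integral, so Fubini evaluates the time average. An
  inequality that holds along almost every orbit thereby becomes one between ball integrals.\<close>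

lemma
  fixes g :: "'a::euclidean_space \<times> 'a \<Rightarrow> real"
  assumes [measurable]: "g \<in> borel_measurable borel" and bd: "\<And>z. norm z < 1 \<Longrightarrow> \<bar>g z\<bar> \<le> K" and T: "0 \<le> T"
  shows integrable_rot_average: "integrable lborel (\<lambda>z. indicator (ball 0 1) z * (LINT t:{0..T}|lborel. g (rot t z)))"
    and integral_rot_average: "(\<integral>z. indicator (ball 0 1) z * (LINT t:{0..T}|lborel. g (rot t z)) \<partial>lborel)
      = T * (\<integral>z. indicator (ball 0 1) z * g z \<partial>lborel)"
proof -
  define B where "B = (ball 0 1 :: ('a \<times> 'a) set)"
  have [measurable]: "B \<in> sets borel" by (simp add: B_def)
  have int: "integrable (lborel \<Otimes>\<^sub>M lborel) (\<lambda>(t, z). indicator {0..T} t * indicator B z * g (rot t z))"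
  proof (rule integrableI_bounded_set[where A="{0..T} \<times> B" and B=K])
    show "{0..T} \<times> B \<in> sets (lborel \<Otimes>\<^sub>M lborel)" by simp
    have "emeasure lborel B < \<infinity>" by (simp add: B_def emeasure_ball)
    then show "emeasure (lborel \<Otimes>\<^sub>M lborel) ({0..T} \<times> B) < \<infinity>"
      using T by (simp add: lborel.emeasure_pair_measure_Times ennreal_mult_less_top)
    have K: "\<bar>g (rot t z)\<bar> \<le> K" if "norm z < 1" for t z
      using bd[of "rot t z"] that by simp
    show "AE x in lborel \<Otimes>\<^sub>M lborel. x \<in> {0..T} \<times> B \<longrightarrow>
        norm (case x of (t, z) \<Rightarrow> indicator {0..T} t * indicator B z * g (rot t z)) \<le> K"
      by (intro AE_I2) (auto simp: B_def intro!: K)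
    show "AE x in lborel \<Otimes>\<^sub>M lborel. x \<notin> {0..T} \<times> B \<longrightarrow>
        (case x of (t, z) \<Rightarrow> indicator {0..T} t * indicator B z * g (rot t z)) = 0"
      by (intro AE_I2) (auto simp: indicator_def)
  qed measurable
  have eq: "indicator (ball 0 1) z * (LINT t:{0..T}|lborel. g (rot t z)) =
     (\<integral>t. indicator {0..T} t * indicator B z * g (rot t z) \<partial>lborel)" for z
    unfolding set_lebesgue_integral_def B_def by (simp flip: integral_mult_right_zero add: ac_simps)
  show "integrable lborel (\<lambda>z. indicator (ball 0 1) z * (LINT t:{0..T}|lborel. g (rot t z)))"
    unfolding eq by (rule lborel_pair.integrable_snd[OF int])
  have "(\<integral>z. indicator (ball 0 1) z * (LINT t:{0..T}|lborel. g (rot t z)) \<partial>lborel) =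
      (\<integral>t. \<integral>z. indicator {0..T} t * indicator B z * g (rot t z) \<partial>lborel \<partial>lborel)"
    unfolding eq by (rule lborel_pair.Fubini_integral[OF int])
  also have "\<dots> = (\<integral>t. indicator {0..T} t * (\<integral>z. indicator B z * g z \<partial>lborel) \<partial>lborel)"
    unfolding B_def by (simp add: integral_ball_rot mult.assoc)
  finally show "(\<integral>z. indicator (ball 0 1) z * (LINT t:{0..T}|lborel. g (rot t z)) \<partial>lborel)
      = T * (\<integral>z. indicator (ball 0 1) z * g z \<partial>lborel)"
    using T by (simp add: B_def)
qed

section \<open>Wirtinger's inequality and orthogonal invariance\<close>

text \<open>The constant is the inverse square of \<open>pi / T\<close>, the least frequency of a
  function with antiperiod \<open>T\<close>. In place of Fourier series, antiperiodicity provides a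
  zero \<open>t0\<close>, and the cotangent \<open>s\<close> centred there solves the Riccati
  equation \<open>s' = - k * (1 + s\<^sup>2)\<close>, which completes the square up to an exact
  derivative.\<close>

lemma wirtinger_antiperiodic:
  fixes a a' :: "real \<Rightarrow> real"
  assumes T: "0 < T" and d: "\<And>t. (a has_real_derivative a' t) (at t)"
    and c: "continuous_on UNIV a'" and anti: "\<And>t. a (t + T) = - a t"
  shows "(LINT t:{0..T}|lborel. (a t)\<^sup>2) \<le> (T / pi)\<^sup>2 * (LINT t:{0..T}|lborel. (a' t)\<^sup>2)"
proof -
  have ca: "continuous_on S a" for S
    using d by (auto intro!: DERIV_isCont continuous_at_imp_continuous_on)
  have ca': "continuous_on S a'" for S
    using c by (rule continuous_on_subset) simp
  obtain t0 where t0: "0 \<le> t0" "t0 \<le> T" "a t0 = 0"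
  proof (cases "a 0 \<le> 0")
    case True
    then show ?thesis
      using IVT'[of a 0 0 T] anti[of 0] T ca that by auto
  next
    case False
    then show ?thesis
      using IVT2'[of a T 0 0] anti[of 0] T ca that by auto
  qed
  define k where "k = pi / T"
  have k: "k > 0" using T by (simp add: k_def)
  define s where "s t = cot (k * (t - t0))" for t
  \<comment> \<open>\<open>(a')\<^sup>2 - k\<^sup>2 * a\<^sup>2 = (a' - k * a * s)\<^sup>2 + k * S'\<close>, and \<open>S\<close> is periodic; it is continuous because
    \<open>a\<close> vanishes at the poles of the cotangent.\<close>
  define S where "S t = (a t)\<^sup>2 * s t" for t
  define S' where "S' t = 2 * a t * a' t * s t - k * (a t)\<^sup>2 * (1 + (s t)\<^sup>2)" for t
  \<comment> \<open>Both \<open>t\<close> and \<open>t0\<close> lie in \<open>[0, T]\<close>, and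
    the zeros of the sine are spaced by \<open>T\<close>, so at most three points are poles.
    Antiperiodicity carries the zero of \<open>a\<close> from \<open>t0\<close> to each of
    them.\<close>
  have zero: "t \<in> {t0 - T, t0, t0 + T} \<and> a t = 0" if t: "0 \<le> t" "t \<le> T" "sin (k * (t - t0)) = 0" for t
  proof -
    from t(3) obtain i :: int where "k * (t - t0) = of_int i * pi"
      by (auto simp: sin_zero_iff_int2)
    then have i: "t - t0 = of_int i * T"
    proof -
      have "pi * (t - t0) = pi * (of_int i * T)"
        using \<open>k * (t - t0) = of_int i * pi\<close> T by (simp add: k_def field_simps)
      then show ?thesis by simp
    qed
    then have "\<bar>of_int i * T\<bar> \<le> T"
      using t t0 by (auto simp: abs_le_iff)
    then have "\<bar>of_int i :: real\<bar> \<le> 1"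
      using T by (simp add: abs_mult)
    then have "i \<in> {-1, 0, 1}" by auto
    then show ?thesis
      using i t0 anti[of t0] anti[of "t0 - T"] by (auto simp: algebra_simps)
  qed
  have dS: "(S has_real_derivative S' t) (at t)" if "sin (k * (t - t0)) \<noteq> 0" for t
  proof -
    have e: "inverse ((sin (k * (t - t0)))\<^sup>2) = 1 + (s t)\<^sup>2"
      using that sin_cos_squared_add[of "k * (t - t0)"]
      by (simp add: s_def cot_def field_simps)
    have "((\<lambda>t. cot (k * (t - t0))) has_real_derivative - inverse ((sin (k * (t - t0)))\<^sup>2) * k) (at t)"
      by (rule DERIV_chain2[where g="\<lambda>t. k * (t - t0)" and x=t and s=UNIV, OF DERIV_cot[OF that]]) (auto intro!: derivative_eq_intros)
    then have "(s has_real_derivative - (1 + (s t)\<^sup>2) * k) (at t)"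
      unfolding e s_def[symmetric] .
    then show ?thesis
      unfolding S_def S'_def
      by (auto intro!: derivative_eq_intros d simp: algebra_simps power2_eq_square)
  qed
  have cS: "isCont S t" if t: "0 \<le> t" "t \<le> T" for t
  proof (cases "sin (k * (t - t0)) = 0")
    case False
    then show ?thesis by (rule DERIV_isCont[OF dS])
  next
    case True
    with t have at: "a t = 0" using zero by blast
    have cos: "cos (k * (t - t0)) \<noteq> 0"
      using True sin_cos_squared_add[of "k * (t - t0)"] by auto
    have "((\<lambda>t. sin (k * (t - t0))) has_real_derivative k * cos (k * (t - t0))) (at t)"
      by (auto intro!: derivative_eq_intros)
    then have 1: "((\<lambda>x. sin (k * (x - t0)) / (x - t)) \<longlongrightarrow> k * cos (k * (t - t0))) (at t)"
      using True by (simp add: has_field_derivative_iff)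
    have 2: "((\<lambda>x. a x / (x - t)) \<longlongrightarrow> a' t) (at t)"
      using d[of t] at by (simp add: has_field_derivative_iff)
    have 3: "(a \<longlongrightarrow> 0) (at t)"
      using DERIV_isCont[OF d[of t]] at by (simp add: isCont_def)
    have 4: "((\<lambda>x. cos (k * (x - t0))) \<longlongrightarrow> cos (k * (t - t0))) (at t)"
      by (intro tendsto_intros)
    \<comment> \<open>Near a pole, \<open>S\<close> is expressed by difference quotients: the sine
      has a simple zero, so \<open>a / sin\<close> has a finite limit, and the remaining factor
      \<open>a\<close> tends to 0.\<close>
    have "((\<lambda>x. a x * cos (k * (x - t0)) * ((a x / (x - t)) / (sin (k * (x - t0)) / (x - t)))) \<longlongrightarrow>
        0 * cos (k * (t - t0)) * (a' t / (k * cos (k * (t - t0))))) (at t)"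
      using k cos by (intro tendsto_mult tendsto_divide 1 2 3 4) auto
    moreover have "\<forall>\<^sub>F x in at t. a x * cos (k * (x - t0)) * ((a x / (x - t)) / (sin (k * (x - t0)) / (x - t))) = S x"
      unfolding eventually_at_filter
      by (rule always_eventually) (simp add: S_def s_def cot_def power2_eq_square)
    ultimately have "(S \<longlongrightarrow> 0) (at t)"
      by (simp add: tendsto_cong)
    then show ?thesis
      using at by (simp add: isCont_def S_def)
  qed
  have "(S' has_integral (S T - S 0)) {0..T}"
  proof (rule fundamental_theorem_of_calculus_interior_strong[where S="{t0 - T, t0, t0 + T}"])
    show "continuous_on {0..T} S"
      using cS by (auto intro!: continuous_at_imp_continuous_on)
    show "(S has_vector_derivative S' x) (at x)" if "x \<in> {0<..<T} - {t0 - T, t0, t0 + T}" for x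
      using that zero[of x] dS[of x] by (auto simp: has_real_derivative_iff_has_vector_derivative)
  qed (use T in auto)
  moreover have "S T = S 0"
  \<comment> \<open>The square removes the sign of the antiperiod, and over \<open>T\<close> the
    argument of the cotangent grows by its period \<open>pi\<close>.\<close>
  proof -
    have "k * (T - t0) = pi - k * t0" using T by (simp add: k_def field_simps)
    then show ?thesis
      using anti[of 0] by (simp add: S_def s_def cot_def sin_diff cos_diff)
  qed
  ultimately have int0: "((\<lambda>t. k * S' t) has_integral 0) {0..T}"
    using has_integral_mult_right[of S' 0 "{0..T}" k] by simp
  have i: "(f has_integral (LINT t:{0..T}|lborel. f t)) {0..T}" if "continuous_on {0..T} f" for f :: "real \<Rightarrow> real"
    using borel_integrable_atLeastAtMost'[OF that]
    by (auto simp: set_borel_integral_eq_integral intro!: integrable_integral)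
  have "((\<lambda>t. (a' t)\<^sup>2 - k\<^sup>2 * (a t)\<^sup>2) has_integral
      ((LINT t:{0..T}|lborel. (a' t)\<^sup>2) - k\<^sup>2 * (LINT t:{0..T}|lborel. (a t)\<^sup>2))) {0..T}"
    by (intro has_integral_diff has_integral_mult_right i continuous_intros ca ca')
  moreover have "k * S' t \<le> (a' t)\<^sup>2 - k\<^sup>2 * (a t)\<^sup>2" for t
  proof -
    have "0 \<le> (a' t - k * a t * s t)\<^sup>2" by simp
    then show ?thesis by (simp add: S'_def algebra_simps power2_eq_square)
  qed
  ultimately have "0 \<le> (LINT t:{0..T}|lborel. (a' t)\<^sup>2) - k\<^sup>2 * (LINT t:{0..T}|lborel. (a t)\<^sup>2)"
    by (intro has_integral_le[OF int0]) auto
  then show ?thesis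
    using T by (simp add: k_def field_simps)
qed

lemma integrable_ball:
  fixes g :: "'a::euclidean_space \<Rightarrow> real"
  assumes [measurable]: "g \<in> borel_measurable borel" and bd: "\<And>z. norm z < R \<Longrightarrow> \<bar>g z\<bar> \<le> K"
  shows "integrable lborel (\<lambda>z. indicator (ball 0 R) z * g z)"
  using integrableI_bounded_set_indicator[of "ball 0 R" lborel g K] bd
  by (cases "0 \<le> R") (auto simp: emeasure_ball ball_empty intro!: AE_I2)

text \<open>Wirtinger holds on the orbits of \<open>rot\<close>, and invariance turns both time
  averages into \<open>T\<close> times ball integrals. The derivative is required on almost every
  orbit only, because the homogeneous extension may fail to be differentiable at the origin.\<close>

lemma integral_ball_antiperiodic_le:
  fixes P P' :: "'a::euclidean_space \<times> 'a \<Rightarrow> real"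
  assumes [measurable]: "P \<in> borel_measurable borel" "P' \<in> borel_measurable borel"
    and bd: "\<And>z. norm z < 1 \<Longrightarrow> \<bar>P z\<bar> \<le> K" "\<And>z. norm z < 1 \<Longrightarrow> \<bar>P' z\<bar> \<le> K"
    and T: "0 < T" and anti: "\<And>z. P (rot T z) = - P z"
    and d: "AE z in lborel. (\<forall>t. ((\<lambda>t. P (rot t z)) has_real_derivative P' (rot t z)) (at t)) \<and>
      continuous_on UNIV (\<lambda>t. P' (rot t z))"
  shows "(\<integral>z. indicator (ball 0 1) z * (P z)\<^sup>2 \<partial>lborel) \<le> (T / pi)\<^sup>2 * (\<integral>z. indicator (ball 0 1) z * (P' z)\<^sup>2 \<partial>lborel)"
proof -
  have sq: "\<bar>(P z)\<^sup>2\<bar> \<le> K\<^sup>2" "\<bar>(P' z)\<^sup>2\<bar> \<le> K\<^sup>2" if "norm z < 1" for z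
    using power_mono[OF bd(1)[OF that], of 2] power_mono[OF bd(2)[OF that], of 2] by auto
  have "T * (\<integral>z. indicator (ball 0 1) z * (P z)\<^sup>2 \<partial>lborel) =
      (\<integral>z. indicator (ball 0 1) z * (LINT t:{0..T}|lborel. (P (rot t z))\<^sup>2) \<partial>lborel)"
    using T sq by (subst integral_rot_average[where K="K\<^sup>2"]) auto
  also have "\<dots> \<le> (\<integral>z. indicator (ball 0 1) z * ((T / pi)\<^sup>2 * (LINT t:{0..T}|lborel. (P' (rot t z))\<^sup>2)) \<partial>lborel)"
  proof (rule integral_mono_AE)
    show "integrable lborel (\<lambda>z. indicator (ball 0 1) z * (LINT t:{0..T}|lborel. (P (rot t z))\<^sup>2))"
      using T sq by (intro integrable_rot_average[where K="K\<^sup>2"]) auto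
    have "integrable lborel (\<lambda>z. indicator (ball 0 1) z * (LINT t:{0..T}|lborel. (P' (rot t z))\<^sup>2))"
      using T sq by (intro integrable_rot_average[where K="K\<^sup>2"]) auto
    from integrable_mult_right[OF this, of "(T / pi)\<^sup>2"]
    show "integrable lborel (\<lambda>z. indicator (ball 0 1) z * ((T / pi)\<^sup>2 * (LINT t:{0..T}|lborel. (P' (rot t z))\<^sup>2)))"
      by (simp only: ac_simps)
    show "AE z in lborel. indicator (ball 0 1) z * (LINT t:{0..T}|lborel. (P (rot t z))\<^sup>2)
        \<le> indicator (ball 0 1) z * ((T / pi)\<^sup>2 * (LINT t:{0..T}|lborel. (P' (rot t z))\<^sup>2))"
      using d
    proof eventually_elim
      case (elim z)
      then show ?case
        by (intro mult_left_mono wirtinger_antiperiodic T)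
          (auto simp: anti add.commute[of _ T] simp flip: rot_rot)
    qed
  qed
  also have "\<dots> = (T / pi)\<^sup>2 * (\<integral>z. indicator (ball 0 1) z * (LINT t:{0..T}|lborel. (P' (rot t z))\<^sup>2) \<partial>lborel)"
    by (simp only: mult.left_commute[of "indicator _ _"] integral_mult_right_zero)
  also have "\<dots> = T * ((T / pi)\<^sup>2 * (\<integral>z. indicator (ball 0 1) z * (P' z)\<^sup>2 \<partial>lborel))"
    using T sq by (subst integral_rot_average[where K="K\<^sup>2"]) auto
  finally show ?thesis
    using T by simp
qed

section \<open>Invariance of Lebesgue measure under orthogonal maps\<close>

lemma borel_measurable_orthogonal:
  "orthogonal_transformation f \<Longrightarrow> (f :: 'a::euclidean_space \<Rightarrow> 'a) \<in> borel_measurable borel"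
  by (intro borel_measurable_continuous_onI linear_continuous_on)
    (simp add: orthogonal_transformation_linear linear_conv_bounded_linear[symmetric])

text \<open>The uniqueness argument for Haar measure: both measures are translation invariant and agree on
  the unit ball, so Fubini's theorem identifies them.\<close>

lemma distr_lborel_orthogonal:
  fixes f :: "'a::euclidean_space \<Rightarrow> 'a"
  assumes f: "orthogonal_transformation f"
  shows "distr lborel borel f = lborel"
proof (rule measure_eqI)
  have [measurable]: "f \<in> borel_measurable borel"
    using f by (rule borel_measurable_orthogonal)
  define g where "g = inv f"
  have fg: "f (g x) = x" for x
    using orthogonal_transformation_surj[OF f] by (simp add: g_def surj_f_inv_f)
  have lin: "linear f" using f by (rule orthogonal_transformation_linear)
  fix B assume "B \<in> sets (distr lborel borel f)"
  then have [measurable]: "B \<in> sets borel" by simp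
  define C where "C = (ball 0 1 :: 'a set)"
  have [measurable]: "C \<in> sets borel" by (simp add: C_def)
  define V where "V = emeasure lborel C"
  have V: "V \<noteq> 0" "V \<noteq> top"
  proof -
    have "unit_ball_vol (real DIM('a)) \<noteq> 0"
      by (metis less_irrefl of_nat_0_le_iff unit_ball_vol_pos)
    then show "V \<noteq> 0" "V \<noteq> top"
      by (auto simp: V_def C_def emeasure_ball intro!: borel_measurable_indicator)
  qed
  have "V * emeasure (distr lborel borel f) B = (\<integral>\<^sup>+x. indicator C x * (\<integral>\<^sup>+y. indicator B (f y) \<partial>lborel) \<partial>lborel)"
    by (subst nn_integral_multc)
      (simp_all add: V_def nn_integral_distr[symmetric, of f lborel borel "indicator B"])
  also have "\<dots> = (\<integral>\<^sup>+x. indicator C x * (\<integral>\<^sup>+y. indicator B (x + f y) \<partial>lborel) \<partial>lborel)"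
  proof -
    have "(\<integral>\<^sup>+y. indicator B (x + f y) \<partial>lborel) = (\<integral>\<^sup>+y. indicator B (f y) \<partial>lborel)" for x
    proof -
      have "f (g x + y) = x + f y" for y by (simp add: linear_add[OF lin] fg)
      then show ?thesis
        using nn_integral_lborel_translate[of "\<lambda>y. indicator B (f y)" "g x"] by simp
    qed
    then show ?thesis by simp
  qed
  also have "\<dots> = (\<integral>\<^sup>+x. \<integral>\<^sup>+y. indicator C x * indicator B (x + f y) \<partial>lborel \<partial>lborel)"
    by (intro nn_integral_cong nn_integral_cmult[symmetric]) measurable
  also have "\<dots> = (\<integral>\<^sup>+y. \<integral>\<^sup>+x. indicator C x * indicator B (x + f y) \<partial>lborel \<partial>lborel)"
    by (rule lborel_pair.Fubini') measurable
  also have "\<dots> = (\<integral>\<^sup>+y. \<integral>\<^sup>+x. indicator C (x - f y) * indicator B x \<partial>lborel \<partial>lborel)"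
  proof (rule nn_integral_cong)
    fix y
    show "(\<integral>\<^sup>+x. indicator C x * indicator B (x + f y) \<partial>lborel) = (\<integral>\<^sup>+x. indicator C (x - f y) * indicator B x \<partial>lborel)"
      using nn_integral_lborel_translate[of "\<lambda>x. indicator C (x - f y) * indicator B x" "f y"]
      by (simp add: add.commute)
  qed
  also have "\<dots> = (\<integral>\<^sup>+x. \<integral>\<^sup>+y. indicator C (x - f y) * indicator B x \<partial>lborel \<partial>lborel)"
    by (rule lborel_pair.Fubini') measurable
  also have "\<dots> = (\<integral>\<^sup>+x. V * indicator B x \<partial>lborel)"
  proof (rule nn_integral_cong)
    fix x
    \<comment> \<open>Since \<open>f\<close> is an isometry, the points \<open>y\<close> with
      \<open>x - f y\<close> in \<open>C\<close> form the unit ball about \<open>g x\<close>, whose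
      measure is again \<open>V\<close>.\<close>
    have "x - f y = f (g x - y)" for y by (simp add: linear_diff[OF lin] fg)
    then have e: "indicator C (x - f y) = (indicator (ball (g x) 1) y :: ennreal)" for y
      by (simp add: C_def indicator_def dist_norm orthogonal_transformation_norm[OF f])
    show "(\<integral>\<^sup>+y. indicator C (x - f y) * indicator B x \<partial>lborel) = V * indicator B x"
      unfolding e by (subst nn_integral_multc) (auto simp: V_def C_def emeasure_ball intro!: borel_measurable_indicator)
  qed
  also have "\<dots> = V * emeasure lborel B"
    by (simp add: nn_integral_cmult)
  finally show "emeasure (distr lborel borel f) B = emeasure lborel B"
    using V by (simp add: ennreal_mult_cancel_left)
qed simp

text \<open>By orthogonal invariance the integral \<open>J a\<close> depends on
  \<open>norm a\<close> only. Replacing \<open>a\<close> by each of the N axis vectors of the same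
  length and adding up produces \<open>(norm y)\<^sup>2\<close> by Pythagoras.\<close>

lemma integral_ball_inner_square:
  fixes a :: "real^'n"
  shows "CARD('n) * (\<integral>y. indicator (ball 0 R) y * (a \<bullet> y)\<^sup>2 \<partial>lborel) =
    (norm a)\<^sup>2 * (\<integral>y. indicator (ball 0 R) y * (norm (y :: real^'n))\<^sup>2 \<partial>lborel)"
proof -
  define J where "J a = (\<integral>y. indicator (ball 0 R) y * (a \<bullet> y)\<^sup>2 \<partial>lborel)" for a :: "real^'n"
  have Jeq: "J a = J b" if "norm a = norm b" for a b
  proof -
    obtain f where f: "orthogonal_transformation f" "f a = b"
      using orthogonal_transformation_exists[OF \<open>norm a = norm b\<close>] by auto
    have [measurable]: "f \<in> borel_measurable borel"
      using f(1) by (rule borel_measurable_orthogonal)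
    have "J b = (\<integral>y. indicator (ball 0 R) y * (b \<bullet> y)\<^sup>2 \<partial>distr lborel borel f)"
      by (simp add: J_def distr_lborel_orthogonal f)
    also have "\<dots> = (\<integral>y. indicator (ball 0 R) (f y) * (b \<bullet> f y)\<^sup>2 \<partial>lborel)"
      by (rule integral_distr) (auto intro!: borel_measurable_times borel_measurable_indicator)
    also have "\<dots> = J a"
      using f orthogonal_transformation_norm[OF f(1)]
      by (auto simp: J_def orthogonal_transformation_def indicator_def)
    finally show ?thesis ..
  qed
  have Ji: "integrable lborel (\<lambda>y. indicator (ball 0 R) y * (a \<bullet> y)\<^sup>2)" for a :: "real^'n"
  proof (rule integrable_ball)
    show "\<bar>(a \<bullet> y)\<^sup>2\<bar> \<le> (norm a * R)\<^sup>2" if "norm y < R" for y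
    proof -
      have "\<bar>a \<bullet> y\<bar> \<le> norm a * R"
        using Cauchy_Schwarz_ineq2[of a y] mult_left_mono[of "norm y" R "norm a"] that by auto
      then show ?thesis by (metis abs_ge_zero abs_power2 power2_abs power_mono)
    qed
  qed measurable
  have sc: "J (c *\<^sub>R a) = c\<^sup>2 * J a" for c a
    unfolding J_def by (subst integral_mult_right_zero[symmetric]) (simp add: power_mult_distrib ac_simps)
  have "CARD('n) * J a = (\<Sum>i\<in>UNIV. J (norm a *\<^sub>R axis (i::'n) 1))"
    by (subst Jeq[where b=a]) auto
  also have "\<dots> = (norm a)\<^sup>2 * (\<Sum>i\<in>UNIV. J (axis (i::'n) 1))"
    by (simp add: sc sum_distrib_left)
  also have "(\<Sum>i\<in>UNIV. J (axis (i::'n) 1)) = (\<integral>y. (\<Sum>i\<in>UNIV. indicator (ball 0 R) y * ((axis i 1 :: real^'n) \<bullet> y)\<^sup>2) \<partial>lborel)"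
    unfolding J_def by (subst Bochner_Integration.integral_sum) (auto intro: Ji)
  also have "\<dots> = (\<integral>y. indicator (ball 0 R) y * (norm (y :: real^'n))\<^sup>2 \<partial>lborel)"
  proof (rule Bochner_Integration.integral_cong[OF refl])
    fix y :: "real^'n"
    have "(\<Sum>i\<in>UNIV. ((axis i 1 :: real^'n) \<bullet> y)\<^sup>2) = (norm y)\<^sup>2"
      unfolding power2_norm_eq_inner inner_vec_def[of y y] by (simp add: inner_axis' power2_eq_square)
    then show "(\<Sum>i\<in>UNIV. indicator (ball 0 R) y * ((axis i 1 :: real^'n) \<bullet> y)\<^sup>2) = indicator (ball 0 R) y * (norm y)\<^sup>2"
      by (simp flip: sum_distrib_left)
  qed
  finally show ?thesis by (simp add: J_def)
qed

section \<open>Unnormalised expectations over the unit ball\<close>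

definition ball_integral :: "('a::euclidean_space \<Rightarrow> real) \<Rightarrow> real" where
  "ball_integral g = (\<integral>z. indicator (ball 0 1) z * g z \<partial>lborel)"

text \<open>Integrability is not stable under products, whereas boundedness on the ball is. With
  this notion the side conditions of all quadratic expansions follow from one set of closure
  rules.\<close>

definition ball_bounded :: "('a::euclidean_space \<Rightarrow> real) \<Rightarrow> bool" where
  "ball_bounded g \<longleftrightarrow> g \<in> borel_measurable borel \<and> (\<exists>K. \<forall>z. norm z < 1 \<longrightarrow> \<bar>g z\<bar> \<le> K)"

lemma borel_measurable_fst_prod [measurable]: "(fst :: 'a::euclidean_space \<times> 'b::euclidean_space \<Rightarrow> 'a) \<in> borel_measurable borel"
  and borel_measurable_snd_prod [measurable]: "(snd :: 'a::euclidean_space \<times> 'b::euclidean_space \<Rightarrow> 'b) \<in> borel_measurable borel"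
  by (auto intro!: borel_measurable_continuous_onI continuous_intros)

named_theorems ball_bounded_intros

lemma ball_boundedI:
  "g \<in> borel_measurable borel \<Longrightarrow> (\<And>z. norm z < 1 \<Longrightarrow> \<bar>g z\<bar> \<le> K) \<Longrightarrow> ball_bounded g"
  by (auto simp: ball_bounded_def)

lemma ball_bounded_measurable: "ball_bounded g \<Longrightarrow> g \<in> borel_measurable borel"
  by (simp add: ball_bounded_def)

lemma ball_bounded_integrable: "ball_bounded g \<Longrightarrow> integrable lborel (\<lambda>z. indicator (ball 0 1) z * g z)"
  by (auto simp: ball_bounded_def intro: integrable_ball)

lemma ball_bounded_add [ball_bounded_intros]:
  assumes "ball_bounded f" "ball_bounded g"
  shows "ball_bounded (\<lambda>z. f z + g z)"
proof -
  obtain K L where "\<And>z. norm z < 1 \<Longrightarrow> \<bar>f z\<bar> \<le> K" "\<And>z. norm z < 1 \<Longrightarrow> \<bar>g z\<bar> \<le> L"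
    using assms by (auto simp: ball_bounded_def)
  then have "\<bar>f z + g z\<bar> \<le> K + L" if "norm z < 1" for z
    using that by (intro order_trans[OF abs_triangle_ineq] add_mono)
  then show ?thesis
    using assms by (intro ball_boundedI) (auto simp: ball_bounded_def)
qed

lemma ball_bounded_mult [ball_bounded_intros]:
  assumes "ball_bounded f" "ball_bounded g"
  shows "ball_bounded (\<lambda>z. f z * g z)"
proof -
  obtain K L where "\<And>z. norm z < 1 \<Longrightarrow> \<bar>f z\<bar> \<le> K" "\<And>z. norm z < 1 \<Longrightarrow> \<bar>g z\<bar> \<le> L"
    using assms by (auto simp: ball_bounded_def)
  then have "\<bar>f z * g z\<bar> \<le> K * L" if "norm z < 1" for z
    using that unfolding abs_mult by (intro mult_mono) (auto intro: order_trans[OF abs_ge_zero])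
  then show ?thesis
    using assms by (intro ball_boundedI) (auto simp: ball_bounded_def)
qed

lemma ball_bounded_const [ball_bounded_intros]: "ball_bounded (\<lambda>z. c)"
  by (rule ball_boundedI[where K="\<bar>c\<bar>"]) auto

lemma ball_bounded_diff [ball_bounded_intros]:
  "ball_bounded f \<Longrightarrow> ball_bounded g \<Longrightarrow> ball_bounded (\<lambda>z. f z - g z)"
  using ball_bounded_add[OF _ ball_bounded_mult[OF ball_bounded_const[of "-1"]], of f g] by simp

lemma ball_bounded_power2 [ball_bounded_intros]: "ball_bounded f \<Longrightarrow> ball_bounded (\<lambda>z. (f z)\<^sup>2)"
  unfolding power2_eq_square by (rule ball_bounded_mult)

lemma ball_integral_add:
  "ball_bounded f \<Longrightarrow> ball_bounded g \<Longrightarrow> ball_integral (\<lambda>z. f z + g z) = ball_integral f + ball_integral g"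
  using ball_bounded_integrable[of f] ball_bounded_integrable[of g]
  by (simp add: ball_integral_def distrib_left)

lemma ball_integral_cmult: "ball_integral (\<lambda>z. c * f z) = c * ball_integral f"
  unfolding ball_integral_def by (subst integral_mult_right_zero[symmetric]) (simp add: ac_simps)

lemma ball_integral_diff:
  "ball_bounded f \<Longrightarrow> ball_bounded g \<Longrightarrow> ball_integral (\<lambda>z. f z - g z) = ball_integral f - ball_integral g"
  using ball_bounded_integrable[of f] ball_bounded_integrable[of g]
  by (simp add: ball_integral_def right_diff_distrib)

lemma ball_integral_mono:
  assumes "ball_bounded f" "ball_bounded g" "\<And>z. norm z < 1 \<Longrightarrow> f z \<le> g z"
  shows "ball_integral f \<le> ball_integral g"
  unfolding ball_integral_def
  by (rule integral_mono) (use assms in \<open>auto intro!: ball_bounded_integrable split: split_indicator\<close>)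

lemma ball_integral_nonneg: "(\<And>z. 0 \<le> f z) \<Longrightarrow> 0 \<le> ball_integral f"
  unfolding ball_integral_def by (rule Bochner_Integration.integral_nonneg) simp

lemma ball_integral_rot:
  fixes g :: "'a::euclidean_space \<times> 'a \<Rightarrow> real"
  shows "ball_bounded g \<Longrightarrow> ball_integral (\<lambda>z. g (rot t z)) = ball_integral g"
  unfolding ball_integral_def by (rule integral_ball_rot) (rule ball_bounded_measurable)

text \<open>For \<open>norm x >= 1\<close> both sides are false, since \<open>sqrt\<close> of a
  nonpositive real is nonpositive. Hence the slices of the ball are described by one formula for all
  \<open>x\<close>.\<close>

lemma norm_Pair_less_1: "norm (x, y) < 1 \<longleftrightarrow> norm y < sqrt (1 - (norm x)\<^sup>2)"
proof -
  have "norm (x, y) < 1 \<longleftrightarrow> (norm y)\<^sup>2 < 1 - (norm x)\<^sup>2"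
    by (auto simp: norm_Pair)
  also have "\<dots> \<longleftrightarrow> norm y < sqrt (1 - (norm x)\<^sup>2)"
  proof
    assume l: "norm y < sqrt (1 - (norm x)\<^sup>2)"
    then have "0 < sqrt (1 - (norm x)\<^sup>2)" by (rule le_less_trans[OF norm_ge_zero])
    then have p: "0 < 1 - (norm x)\<^sup>2" by simp
    have "(norm y)\<^sup>2 < (sqrt (1 - (norm x)\<^sup>2))\<^sup>2"
      using l by (intro power_strict_mono) auto
    then show "(norm y)\<^sup>2 < 1 - (norm x)\<^sup>2" using p by simp
  qed (rule real_less_rsqrt)
  finally show ?thesis .
qed

lemma ball_integral_Fubini:
  fixes g :: "'a::euclidean_space \<times> 'a \<Rightarrow> real"
  assumes "ball_bounded g"
  shows "ball_integral g = (\<integral>x. \<integral>y. indicator (ball 0 (sqrt (1 - (norm x)\<^sup>2))) y * g (x, y) \<partial>lborel \<partial>lborel)"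
proof -
  have i: "integrable (lborel \<Otimes>\<^sub>M lborel) (\<lambda>z::'a \<times> 'a. indicator (ball 0 1) z * g z)"
    using ball_bounded_integrable[OF assms] by (simp add: lborel_prod)
  have "ball_integral g = (\<integral>x. \<integral>y. indicator (ball 0 1) (x, y) * g (x, y) \<partial>lborel \<partial>lborel)"
    unfolding ball_integral_def using lborel_pair.integral_fst'[OF i] by (simp add: lborel_prod)
  then show ?thesis
    by (simp add: indicator_def norm_Pair_less_1)
qed

text \<open>The slice of the ball over \<open>x\<close> is a centred ball whose radius depends on
  \<open>norm x\<close> only. It does not see the direction of \<open>x\<close>, so the angular
  integral factors out.\<close>

lemma ball_integral_sgn:
  fixes h :: "'a::euclidean_space \<Rightarrow> real" and g :: "'a \<Rightarrow> real"
  assumes [measurable]: "h \<in> borel_measurable borel" "e \<in> borel_measurable borel" "g \<in> borel_measurable borel"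
    and bd: "ball_bounded (\<lambda>z::'a \<times> 'a. h (sgn (fst z)) * (e (norm (fst z)) * g (snd z)))"
  shows "ball_integral (\<lambda>z. h (sgn (fst z)) * (e (norm (fst z)) * g (snd z))) =
    (\<integral>\<omega>. h \<omega> \<partial>surface_measure) *
    (\<integral>s. e s * (\<integral>y. indicator (ball 0 (sqrt (1 - s\<^sup>2))) y * g y \<partial>lborel) \<partial>radial_measure DIM('a))"
proof -
  define k where "k s = e s * (\<integral>y. indicator (ball 0 (sqrt (1 - s\<^sup>2))) y * g y \<partial>lborel)" for s
  have k: "k s = e s * (\<integral>y. (if norm y < sqrt (1 - s\<^sup>2) then g y else 0) \<partial>lborel)" for s
    unfolding k_def by (intro arg_cong[where f="\<lambda>t. e s * t"] Bochner_Integration.integral_cong) (auto split: split_indicator)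
  have [measurable]: "k \<in> borel_measurable borel"
    unfolding k by measurable
  have eq: "(\<integral>y. indicator (ball 0 (sqrt (1 - (norm x)\<^sup>2))) y * (h (sgn x) * (e (norm x) * g y)) \<partial>lborel) = h (sgn x) * k (norm x)"
    for x :: 'a
    unfolding k_def by (simp add: ac_simps flip: integral_mult_right_zero)
  have "ball_integral (\<lambda>z. h (sgn (fst z)) * (e (norm (fst z)) * g (snd z))) = (\<integral>x. h (sgn x) * k (norm x) \<partial>lborel)"
    by (subst ball_integral_Fubini[OF bd]) (simp add: eq)
  also have "\<dots> = (\<integral>\<omega>. h \<omega> \<partial>surface_measure) * (\<integral>s. k s \<partial>radial_measure DIM('a))"
  proof (rule integral_sgn_mult_norm)
    have "integrable (lborel \<Otimes>\<^sub>M lborel) (\<lambda>z::'a \<times> 'a. indicator (ball 0 1) z * (h (sgn (fst z)) * (e (norm (fst z)) * g (snd z))))"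
      using ball_bounded_integrable[OF bd] by (simp add: lborel_prod)
    from lborel_pair.integrable_fst'[OF this]
    show "integrable lborel (\<lambda>x. h (sgn x) * k (norm x))"
      unfolding eq[symmetric] by (simp add: indicator_def norm_Pair_less_1)
  qed measurable
  finally show ?thesis by (simp add: k_def)
qed

lemma measure_surface_measure_sphere_pos: "0 < (\<integral>\<omega>. (1::real) \<partial>(surface_measure :: 'a::euclidean_space measure))"
proof -
  interpret finite_measure "surface_measure :: 'a measure"
    by (rule finite_measure_surface_measure)
  have "emeasure surface_measure (sphere (0::'a) 1) \<noteq> 0"
    using less_imp_neq[OF unit_ball_vol_pos[of "real DIM('a)"]] DIM_positive[where 'a='a]
    by (auto simp: emeasure_surface_measure_sphere)
  then show ?thesis
    by (simp add: emeasure_eq_measure zero_less_measure_iff)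
qed

text \<open>If some rotation sends the first component to 0, the two vectors are linearly dependent.
  For a fixed \<open>x\<close> different from 0, the dependent \<open>y\<close> lie on a line, which
  is a null set in dimension at least 2.\<close>

lemma AE_fst_rot_nonzero:
  assumes "2 \<le> CARD('n::finite)"
  shows "AE z in lborel. \<forall>t. fst (rot t (z :: (real^'n) \<times> (real^'n))) \<noteq> 0"
proof -
  \<comment> \<open>Strict inequality in Cauchy-Schwarz expresses linear independence by a
    polynomial condition, so measurability in the pair is immediate.\<close>
  let ?Q = "\<lambda>x y :: real^'n. (x \<bullet> y)\<^sup>2 \<noteq> (x \<bullet> x) * (y \<bullet> y)"
  have "AE x in lborel. AE y in lborel. ?Q x y"
    using AE_lborel_singleton[of 0]
  proof eventually_elim
    case (elim x)
    have sub: "{y. (x \<bullet> y)\<^sup>2 = (x \<bullet> x) * (y \<bullet> y)} \<subseteq> span {x}"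
    proof safe
      fix y assume e: "(x \<bullet> y)\<^sup>2 = (x \<bullet> x) * (y \<bullet> y)"
      have "((x \<bullet> x) *\<^sub>R y - (x \<bullet> y) *\<^sub>R x) \<bullet> ((x \<bullet> x) *\<^sub>R y - (x \<bullet> y) *\<^sub>R x) = (x \<bullet> x) * ((x \<bullet> x) * (y \<bullet> y) - (x \<bullet> y)\<^sup>2)"
        by (simp add: inner_simps inner_commute algebra_simps power2_eq_square)
      then have "(x \<bullet> x) *\<^sub>R y = (x \<bullet> y) *\<^sub>R x"
        using e by simp
      then have "y = ((x \<bullet> y) / (x \<bullet> x)) *\<^sub>R x"
      proof -
        have "y = (1 / (x \<bullet> x)) *\<^sub>R ((x \<bullet> x) *\<^sub>R y)" using elim by simp
        also have "\<dots> = ((x \<bullet> y) / (x \<bullet> x)) *\<^sub>R x"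
          unfolding \<open>(x \<bullet> x) *\<^sub>R y = (x \<bullet> y) *\<^sub>R x\<close> by simp
        finally show ?thesis .
      qed
      then show "y \<in> span {x}" by (metis span_base span_mul singletonI)
    qed
    have "dim (span {x}) < DIM(real^'n)"
      using assms elim by simp
    then have "negligible (span {x})"
      by (rule negligible_lowdim)
    then have "negligible {y. (x \<bullet> y)\<^sup>2 = (x \<bullet> x) * (y \<bullet> y)}"
      using sub by (rule negligible_subset)
    then have "{y. (x \<bullet> y)\<^sup>2 = (x \<bullet> x) * (y \<bullet> y)} \<in> null_sets lebesgue"
      by (simp add: negligible_iff_null_sets)
    moreover have "{y. (x \<bullet> y)\<^sup>2 = (x \<bullet> x) * (y \<bullet> y)} \<in> sets borel"
      by measurable
    ultimately have "{y. (x \<bullet> y)\<^sup>2 = (x \<bullet> x) * (y \<bullet> y)} \<in> null_sets lborel"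
      by (auto simp: null_sets_def)
    then show ?case
      by (rule AE_I'[where N="{y. (x \<bullet> y)\<^sup>2 = (x \<bullet> x) * (y \<bullet> y)}"]) auto
  qed
  then have "AE z in lborel \<Otimes>\<^sub>M lborel. ?Q (fst z) (snd z)"
  proof (intro lborel_pair.AE_pair_measure)
    show "{z \<in> space (lborel \<Otimes>\<^sub>M lborel). ?Q (fst z) (snd z)} \<in> sets (lborel \<Otimes>\<^sub>M lborel)"
      by measurable
  qed simp
  then have "AE z in lborel. ?Q (fst z) (snd z)"
    unfolding lborel_prod .
  then show ?thesis
  proof eventually_elim
    case (elim z)
    show ?case
    proof (intro allI notI)
      fix t assume "fst (rot t z) = 0"
      then have e: "cos t *\<^sub>R fst z = - (sin t *\<^sub>R snd z)"
        by (simp add: eq_neg_iff_add_eq_0)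
      let ?x = "fst z" and ?y = "snd z"
      have 1: "cos t * (?x \<bullet> w) = - (sin t * (?y \<bullet> w))" for w
        using arg_cong[OF e, of "\<lambda>v. v \<bullet> w"] by simp
      define X Y Z where "X = ?x \<bullet> ?x" and "Y = ?y \<bullet> ?y" and "Z = ?x \<bullet> ?y"
      \<comment> \<open>Pairing the relation with both vectors shows that \<open>cos t\<close> and
        \<open>sin t\<close> each annihilate the Gram determinant, while they cannot vanish
        together.\<close>
      have a1: "cos t * X = - (sin t * Z)" and a2: "cos t * Z = - (sin t * Y)"
        using 1[of ?x] 1[of ?y] by (simp_all add: X_def Y_def Z_def inner_commute)
      have "cos t * (Z\<^sup>2 - X * Y) = Z * (cos t * Z) - Y * (cos t * X)"
        by (simp add: algebra_simps power2_eq_square)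
      also have "\<dots> = 0" unfolding a1 a2 by simp
      finally have "cos t * (Z\<^sup>2 - X * Y) = 0" .
      moreover have "sin t * (Z\<^sup>2 - X * Y) = 0"
      proof -
        have "sin t * (Z\<^sup>2 - X * Y) = Z * (sin t * Z) - X * (sin t * Y)"
          by (simp add: algebra_simps power2_eq_square)
        also have "sin t * Z = - (cos t * X)" using a1 by simp
        also have "sin t * Y = - (cos t * Z)" using a2 by simp
        finally show ?thesis by simp
      qed
      moreover have "cos t \<noteq> 0 \<or> sin t \<noteq> 0"
        by (metis sin_zero_abs_cos_one abs_zero zero_neq_one)
      ultimately show False using elim by (auto simp: X_def Y_def Z_def)
    qed
  qed
qed

section \<open>The Poincare inequality on the sphere\<close>

lemma ball_bounded_fst_norm: "ball_bounded (\<lambda>z::'a::euclidean_space \<times> 'a. (norm (fst z))\<^sup>2)"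
  and ball_bounded_snd_norm: "ball_bounded (\<lambda>z::'a::euclidean_space \<times> 'a. (norm (snd z))\<^sup>2)"
proof -
  have sq: "\<bar>(norm w)\<^sup>2\<bar> \<le> 1" if "norm w < 1" for w :: 'a
    using that by (simp add: power_le_one)
  have "norm (fst z) < 1" "norm (snd z) < 1" if "norm z < 1" for z :: "'a \<times> 'a"
    using that norm_fst_le[of "fst z" "snd z"] norm_snd_le[of "snd z" "fst z"] by auto
  then show "ball_bounded (\<lambda>z::'a \<times> 'a. (norm (fst z))\<^sup>2)" "ball_bounded (\<lambda>z::'a \<times> 'a. (norm (snd z))\<^sup>2)"
    by (intro ball_boundedI[where K=1] sq; simp)+
qed

lemma ball_integral_norm_pos: "0 < ball_integral (\<lambda>z::'a::euclidean_space. (norm z)\<^sup>2)"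
proof -
  have "ball_integral (\<lambda>z::'a. (norm z)\<^sup>2) \<noteq> 0"
  proof
    have i: "integrable lborel (\<lambda>z::'a. indicator (ball 0 1) z * (norm z)\<^sup>2)"
      by (intro ball_bounded_integrable ball_boundedI[where K=1]) (simp_all add: power_le_one)
    assume "ball_integral (\<lambda>z::'a. (norm z)\<^sup>2) = 0"
    then have "AE z in lborel. indicator (ball 0 1) z * (norm (z :: 'a))\<^sup>2 = 0"
      using integral_nonneg_eq_0_iff_AE[OF i] by (simp add: ball_integral_def)
    then have "AE z in lborel. z \<notin> (ball 0 1 :: 'a set)"
      using AE_lborel_singleton[of 0] by eventually_elim (auto split: split_indicator_asm)
    moreover have "(AE z in lborel. z \<notin> (ball 0 1 :: 'a set)) \<longleftrightarrow> emeasure lborel (ball 0 1 :: 'a set) = 0"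
      by (rule AE_iff_measurable) auto
    ultimately have "emeasure lborel (ball 0 1 :: 'a set) = 0"
      by blast
    then show False
      using less_imp_neq[OF unit_ball_vol_pos[of "real DIM('a)"]] by (auto simp: emeasure_ball)
  qed
  moreover have "0 \<le> ball_integral (\<lambda>z::'a. (norm z)\<^sup>2)"
    by (rule ball_integral_nonneg) simp
  ultimately show ?thesis by simp
qed

text \<open>The quarter turn exchanges the components up to sign, and positivity follows from
  \<open>(norm z)\<^sup>2\<close> being the sum of the two squares. These moments are the constants
  that cancel in \<open>sphere_poincare\<close>.\<close>

lemma ball_integral_norm_fst:
  "ball_integral (\<lambda>z::'a::euclidean_space \<times> 'a. (norm (fst z))\<^sup>2) = ball_integral (\<lambda>z::'a \<times> 'a. (norm (snd z))\<^sup>2)"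
  "0 < ball_integral (\<lambda>z::'a::euclidean_space \<times> 'a. (norm (fst z))\<^sup>2)"
proof -
  show eq: "ball_integral (\<lambda>z::'a \<times> 'a. (norm (fst z))\<^sup>2) = ball_integral (\<lambda>z::'a \<times> 'a. (norm (snd z))\<^sup>2)"
    using ball_integral_rot[OF ball_bounded_fst_norm, of "pi / 2", symmetric] by simp
  have "ball_integral (\<lambda>z::'a \<times> 'a. (norm z)\<^sup>2) =
      ball_integral (\<lambda>z::'a \<times> 'a. (norm (fst z))\<^sup>2 + (norm (snd z))\<^sup>2)"
    by (simp add: norm_prod_def)
  also have "\<dots> = 2 * ball_integral (\<lambda>z::'a \<times> 'a. (norm (fst z))\<^sup>2)"
    by (simp add: ball_integral_add ball_bounded_fst_norm ball_bounded_snd_norm eq)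
  finally show "0 < ball_integral (\<lambda>z::'a \<times> 'a. (norm (fst z))\<^sup>2)"
    using ball_integral_norm_pos[where 'a="'a \<times> 'a"] by linarith
qed

lemma distr_lborel_minus: "distr lborel borel (\<lambda>x. - x) = (lborel :: 'a::euclidean_space measure)"
proof -
  have "linear (\<lambda>x::'a. - x)"
    by (rule bounded_linear.linear[OF bounded_linear_minus[OF bounded_linear_ident]])
  then have "orthogonal_transformation (\<lambda>x::'a. - x)"
    by (simp add: orthogonal_transformation_def)
  then show ?thesis
    by (rule distr_lborel_orthogonal)
qed

lemma integral_lborel_uminus:
  fixes g :: "'a::euclidean_space \<Rightarrow> real"
  assumes g: "g \<in> borel_measurable borel"
  shows "(\<integral>x. g (- x) \<partial>lborel) = (\<integral>x. g x \<partial>lborel)"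
proof -
  have "(\<integral>x. g x \<partial>distr lborel borel (\<lambda>x. - x)) = (\<integral>x. g (- x) \<partial>lborel)"
    by (rule integral_distr[OF _ g]) simp
  then show ?thesis
    unfolding distr_lborel_minus by (rule sym)
qed

lemma integrable_surface_measure:
  fixes f :: "'a::euclidean_space \<Rightarrow> real"
  assumes f: "continuous_on UNIV f"
  shows "integrable surface_measure f"
proof -
  interpret finite_measure "surface_measure :: 'a measure"
    by (rule finite_measure_surface_measure)
  have "compact (f ` sphere 0 1)"
    by (rule compact_continuous_image[OF continuous_on_subset[OF f subset_UNIV]]) simp
  then have "bounded (f ` sphere 0 1)"
    by (rule compact_imp_bounded)
  then obtain K where K: "\<forall>y\<in>f ` sphere 0 1. norm y \<le> K"
    unfolding bounded_iff by blast
  show ?thesis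
  proof (rule integrable_const_bound[where B=K])
    show "AE \<omega> in surface_measure. norm (f \<omega>) \<le> K"
      using K by (intro AE_I2) auto
    show "f \<in> borel_measurable surface_measure"
      unfolding measurable_cong_sets[OF sets_surface_measure refl]
      using f by (intro measurable_restrict_space1 borel_measurable_continuous_onI)
  qed
qed

text \<open>With \<open>v\<close> given on the whole space, no calculus on the sphere is required:
  the squared tangential gradient at a unit vector \<open>\<omega>\<close> is \<open>(norm (D
  \<omega>))\<^sup>2 - (\<omega> \<bullet> D \<omega>)\<^sup>2\<close>.\<close>

locale C1_function =
  fixes v :: "real^'n \<Rightarrow> real" and D :: "real^'n \<Rightarrow> real^'n"
  assumes deriv: "\<And>x. (v has_derivative (\<lambda>h. D x \<bullet> h)) (at x)"
    and cont_D: "continuous_on UNIV D"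
begin

text \<open>\<open>F\<close> is the 1-homogeneous extension of \<open>v\<close> restricted to the sphere, and \<open>A (sgn x)\<close> its gradient.\<close>

definition F :: "real^'n \<Rightarrow> real" where
  "F x = norm x * v (sgn x)"

definition A :: "real^'n \<Rightarrow> real^'n" where
  "A \<omega> = v \<omega> *\<^sub>R \<omega> + (D \<omega> - (\<omega> \<bullet> D \<omega>) *\<^sub>R \<omega>)"

lemma cont_v: "continuous_on S v"
  by (intro continuous_at_imp_continuous_on ballI has_derivative_continuous[OF deriv])

lemma cont_D': "continuous_on S D"
  using cont_D by (rule continuous_on_subset) simp

lemma cont_A: "continuous_on S A"
  unfolding A_def by (intro continuous_intros cont_v cont_D')

lemma measurable_v [measurable]: "v \<in> borel_measurable borel"
  and measurable_D [measurable]: "D \<in> borel_measurable borel"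
  and measurable_A [measurable]: "A \<in> borel_measurable borel"
  by (auto intro!: borel_measurable_continuous_onI cont_v cont_D cont_A)

lemma measurable_F [measurable]: "F \<in> borel_measurable borel"
  unfolding F_def by measurable

lemma bounds: obtains K where "\<And>x. \<bar>v (sgn x)\<bar> \<le> K" "\<And>x. norm (A (sgn x)) \<le> K"
proof -
  \<comment> \<open>The closed ball is taken in place of the sphere because
    \<open>sgn 0 = 0\<close>.\<close>
  have "bounded (v ` cball 0 1)" "bounded (A ` cball 0 1)"
    by (intro compact_imp_bounded compact_continuous_image cont_v cont_A compact_cball)+
  then obtain K L where "\<forall>y\<in>v ` cball 0 1. norm y \<le> K" "\<forall>y\<in>A ` cball 0 1. norm y \<le> L"
    unfolding bounded_iff by blast
  then have "\<And>x. x \<in> cball 0 1 \<Longrightarrow> \<bar>v x\<bar> \<le> K" "\<And>x. x \<in> cball 0 1 \<Longrightarrow> norm (A x) \<le> L"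
    by auto
  moreover have "sgn x \<in> cball 0 1" for x :: "real^'n"
    by (simp add: norm_sgn)
  ultimately have "\<And>x. \<bar>v (sgn x)\<bar> \<le> max K L" "\<And>x. norm (A (sgn x)) \<le> max K L"
    by (simp_all add: le_max_iff_disj)
  then show ?thesis by (rule that)
qed

text \<open>The derivative of \<open>sgn\<close> is the projection orthogonal to
  \<open>sgn x\<close>, divided by \<open>norm x\<close>. The factor \<open>norm x\<close> in
  \<open>F\<close> cancels this divisor, so the gradient depends on the direction alone.\<close>

lemma has_derivative_F:
  assumes x: "x \<noteq> 0"
  shows "(F has_derivative (\<lambda>h. A (sgn x) \<bullet> h)) (at x)"
proof -
  have n: "(norm has_derivative (\<lambda>h. sgn x \<bullet> h)) (at x)"
    using has_derivative_norm[OF x] by (simp add: inner_commute)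
  have "((\<lambda>x. inverse (norm x) *\<^sub>R x) has_derivative
      (\<lambda>h. inverse (norm x) *\<^sub>R h - (inverse (norm x) * (sgn x \<bullet> h) * inverse (norm x)) *\<^sub>R x)) (at x)"
    using x by (auto intro!: derivative_eq_intros n)
  then have s: "(sgn has_derivative
      (\<lambda>h. inverse (norm x) *\<^sub>R h - (inverse (norm x) * (sgn x \<bullet> h) * inverse (norm x)) *\<^sub>R x)) (at x)"
    by (simp add: sgn_div_norm[abs_def] divide_inverse)
  have "((\<lambda>x. v (sgn x)) has_derivative
      (\<lambda>h. D (sgn x) \<bullet> (inverse (norm x) *\<^sub>R h - (inverse (norm x) * (sgn x \<bullet> h) * inverse (norm x)) *\<^sub>R x))) (at x)"
    by (rule has_derivative_compose[OF s deriv])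
  from has_derivative_mult[OF n this]
  have "(F has_derivative (\<lambda>h. norm x * (D (sgn x) \<bullet> (inverse (norm x) *\<^sub>R h - (inverse (norm x) * (sgn x \<bullet> h) * inverse (norm x)) *\<^sub>R x))
      + (sgn x \<bullet> h) * v (sgn x))) (at x)"
    by (simp add: F_def[abs_def])
  moreover have "norm x * (D (sgn x) \<bullet> (inverse (norm x) *\<^sub>R h - (inverse (norm x) * (sgn x \<bullet> h) * inverse (norm x)) *\<^sub>R x))
      + (sgn x \<bullet> h) * v (sgn x) = A (sgn x) \<bullet> h" for h
  proof -
    have "inverse (norm x) *\<^sub>R x = sgn x"
      by (simp add: sgn_div_norm)
    then have e: "(inverse (norm x) * (sgn x \<bullet> h) * inverse (norm x)) *\<^sub>R x = (inverse (norm x) * (sgn x \<bullet> h)) *\<^sub>R sgn x"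
      by (metis scaleR_scaleR)
    have c: "norm x * (inverse (norm x) * t) = t" for t
      using x by simp
    show ?thesis
      unfolding A_def e by (simp add: c inner_simps algebra_simps inner_commute)
  qed
  ultimately show ?thesis by simp
qed

lemma F_along:
  assumes "(c has_vector_derivative c') (at t)" "c t \<noteq> 0"
  shows "((\<lambda>t. F (c t)) has_real_derivative A (sgn (c t)) \<bullet> c') (at t)"
  using has_derivative_compose[OF assms(1)[unfolded has_vector_derivative_def] has_derivative_F[OF assms(2)]]
  by (simp add: has_field_derivative_def mult.commute[of _ "_ \<bullet> _"])

text \<open>The radial part \<open>v \<omega> *\<^sub>R \<omega>\<close> and the tangential gradient
  are orthogonal. The extra \<open>(v \<omega>)\<^sup>2\<close> is what later lowers the constant
  from N to \<open>N - 1\<close>.\<close>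

lemma norm_A:
  assumes "norm \<omega> = 1"
  shows "(norm (A \<omega>))\<^sup>2 = (v \<omega>)\<^sup>2 + ((norm (D \<omega>))\<^sup>2 - (\<omega> \<bullet> D \<omega>)\<^sup>2)"
proof -
  have "\<omega> \<bullet> \<omega> = 1" using assms by (simp flip: power2_norm_eq_inner)
  then show ?thesis
    unfolding power2_norm_eq_inner A_def
    by (simp add: inner_simps algebra_simps inner_commute power2_eq_square)
qed

lemma ball_bounded_F:
  fixes c :: "(real^'n) \<times> (real^'n) \<Rightarrow> real^'n"
  assumes [measurable]: "c \<in> borel_measurable borel" and "\<And>z. norm (c z) \<le> norm z"
  shows "ball_bounded (\<lambda>z. F (c z))"
proof -
  obtain K where K: "\<And>x. \<bar>v (sgn x)\<bar> \<le> K" "\<And>x. norm (A (sgn x)) \<le> K"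
    by (rule bounds) blast
  have "\<bar>F (c z)\<bar> \<le> 1 * K" if "norm z < 1" for z
    unfolding F_def abs_mult using that assms(2)[of z] K(1) by (intro mult_mono) auto
  then show ?thesis by (intro ball_boundedI) auto
qed

lemma ball_bounded_A:
  fixes c d :: "(real^'n) \<times> (real^'n) \<Rightarrow> real^'n"
  assumes [measurable]: "c \<in> borel_measurable borel" "d \<in> borel_measurable borel" and "\<And>z. norm (d z) \<le> norm z"
  shows "ball_bounded (\<lambda>z. A (sgn (c z)) \<bullet> d z)"
proof -
  obtain K where K: "\<And>x. \<bar>v (sgn x)\<bar> \<le> K" "\<And>x. norm (A (sgn x)) \<le> K"
    by (rule bounds) blast
  have "\<bar>A (sgn (c z)) \<bullet> d z\<bar> \<le> K * 1" if "norm z < 1" for z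
    using that assms(3)[of z] K(2) by (intro order_trans[OF Cauchy_Schwarz_ineq2] mult_mono) (auto intro: order_trans[OF norm_ge_zero])
  then show ?thesis by (intro ball_boundedI) auto
qed

text \<open>Wirtinger is applied to \<open>F x - F (- x)\<close>, which changes sign under a half turn, and to
  \<open>(F x + F (- x)) - (F y + F (- y))\<close>, which changes sign under a quarter turn.\<close>

lemma ball_integral_F_square:
  assumes N: "2 \<le> CARD('n)" and mean: "(\<integral>\<omega>. v \<omega> \<partial>surface_measure) = 0"
  shows "ball_integral (\<lambda>z::(real^'n) \<times> (real^'n). (F (fst z))\<^sup>2) \<le> ball_integral (\<lambda>z. (A (sgn (fst z)) \<bullet> snd z)\<^sup>2)"
proof -
  \<comment> \<open>The \<open>f\<close> and \<open>g\<close> are the values of \<open>F\<close> at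
    the two components and at their antipodes. Along a rotation their derivatives are, up to sign,
    the corresponding \<open>p\<close> and \<open>q\<close>.\<close>
  define f1 f2 g1 g2 p1 p2 q1 q2 :: "(real^'n) \<times> (real^'n) \<Rightarrow> real"
    where "f1 z = F (fst z)" and "f2 z = F (- fst z)" and "g1 z = F (snd z)" and "g2 z = F (- snd z)"
      and "p1 z = A (sgn (fst z)) \<bullet> snd z" and "p2 z = A (sgn (- fst z)) \<bullet> snd z"
      and "q1 z = A (sgn (snd z)) \<bullet> fst z" and "q2 z = A (sgn (- snd z)) \<bullet> fst z" for z
  note defs = f1_def f2_def g1_def g2_def p1_def p2_def q1_def q2_def
  have nfs: "norm (fst z) \<le> norm z" "norm (snd z) \<le> norm z" for z :: "(real^'n) \<times> (real^'n)"
    using norm_fst_le[of "fst z" "snd z"] norm_snd_le[of "snd z" "fst z"] by auto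
  have bd: "ball_bounded f1" "ball_bounded f2" "ball_bounded g1" "ball_bounded g2"
    "ball_bounded p1" "ball_bounded p2" "ball_bounded q1" "ball_bounded q2"
    unfolding defs by (auto intro!: ball_bounded_F ball_bounded_A norm_fst_le norm_snd_le)
  note bds = bd ball_bounded_intros
  let ?E = "ball_integral"
  have rotpi: "f1 (rot pi z) = f2 z" "p1 (rot pi z) = - p2 z" for z
    by (simp_all add: defs)
  have rot2: "f1 (rot (pi/2) z) = g1 z" "f2 (rot (pi/2) z) = g2 z" "p1 (rot (pi/2) z) = - q1 z" "p2 (rot (pi/2) z) = - q2 z" for z
    by (simp_all add: defs)
  have f2: "?E (\<lambda>z. (f2 z)\<^sup>2) = ?E (\<lambda>z. (f1 z)\<^sup>2)"
    using ball_integral_rot[OF ball_bounded_power2[OF bd(1)], of pi] by (simp add: rotpi)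
  have p2: "?E (\<lambda>z. (p2 z)\<^sup>2) = ?E (\<lambda>z. (p1 z)\<^sup>2)"
    using ball_integral_rot[OF ball_bounded_power2[OF bd(5)], of pi] by (simp add: rotpi)
  have g: "?E (\<lambda>z. (g1 z + g2 z)\<^sup>2) = ?E (\<lambda>z. (f1 z + f2 z)\<^sup>2)"
    using ball_integral_rot[of "\<lambda>z. (f1 z + f2 z)\<^sup>2" "pi/2"] by (simp add: rot2 bds)
  have q: "?E (\<lambda>z. (q1 z - q2 z)\<^sup>2) = ?E (\<lambda>z. (p1 z - p2 z)\<^sup>2)"
    using ball_integral_rot[of "\<lambda>z. (p1 z - p2 z)\<^sup>2" "pi/2"] by (simp add: rot2 bds power2_commute)
  have "AE z in lborel. \<forall>t. fst (rot t (z :: (real^'n) \<times> (real^'n))) \<noteq> 0"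
    using N by (rule AE_fst_rot_nonzero)
  then have path: "AE z in lborel. (\<forall>t.
      ((\<lambda>t. f1 (rot t z)) has_real_derivative p1 (rot t z)) (at t) \<and>
      ((\<lambda>t. f2 (rot t z)) has_real_derivative - p2 (rot t z)) (at t) \<and>
      ((\<lambda>t. g1 (rot t z)) has_real_derivative - q1 (rot t z)) (at t) \<and>
      ((\<lambda>t. g2 (rot t z)) has_real_derivative q2 (rot t z)) (at t)) \<and>
      continuous_on UNIV (\<lambda>t. p1 (rot t z)) \<and> continuous_on UNIV (\<lambda>t. p2 (rot t z)) \<and>
      continuous_on UNIV (\<lambda>t. q1 (rot t z)) \<and> continuous_on UNIV (\<lambda>t. q2 (rot t z))"
  proof eventually_elim
    case (elim z)
    \<comment> \<open>The second component is the first one a quarter turn later, so a single null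
      set takes care of both.\<close>
    have nz: "fst (rot t z) \<noteq> 0" "snd (rot t z) \<noteq> 0" for t
      using elim[rule_format, of t] elim[rule_format, of "pi/2 + t"]
      by (simp_all flip: rot_rot add: rot_half_pi del: fst_rot snd_rot)
    have d1: "((\<lambda>t. fst (rot t z)) has_vector_derivative snd (rot t z)) (at t)" for t
      by (auto intro!: derivative_eq_intros simp: has_vector_derivative_def algebra_simps)
    have d2: "((\<lambda>t. snd (rot t z)) has_vector_derivative - fst (rot t z)) (at t)" for t
      by (auto intro!: derivative_eq_intros simp: has_vector_derivative_def algebra_simps)
    have d3: "((\<lambda>t. - fst (rot t z)) has_vector_derivative - snd (rot t z)) (at t)" for t
      by (rule has_vector_derivative_minus[OF d1])
    have d4: "((\<lambda>t. - snd (rot t z)) has_vector_derivative fst (rot t z)) (at t)" for t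
      using has_vector_derivative_minus[OF d2] by (simp add: add.commute)
    have cr: "continuous_on UNIV (\<lambda>t. fst (rot t z))" "continuous_on UNIV (\<lambda>t. snd (rot t z))"
      by (intro continuous_intros)+
    have cA: "continuous_on UNIV (\<lambda>t. A (sgn (c t)))" if "continuous_on UNIV c" "\<And>t. c t \<noteq> 0" for c :: "real \<Rightarrow> real^'n"
      using that by (intro continuous_on_compose2[OF cont_A[of UNIV]] continuous_intros) auto
    show ?case
      using F_along[OF d1 nz(1)] F_along[OF d2 nz(2)] F_along[OF d3] F_along[OF d4] nz
      by (auto simp: defs simp del: fst_rot snd_rot intro!: continuous_intros cA cr)
  qed
  obtain K1 where K1: "\<And>z. norm z < 1 \<Longrightarrow> \<bar>f1 z - f2 z\<bar> \<le> K1"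
    using ball_bounded_diff[OF bd(1,2)] by (auto simp: ball_bounded_def)
  obtain K2 where K2: "\<And>z. norm z < 1 \<Longrightarrow> \<bar>p1 z + p2 z\<bar> \<le> K2"
    using ball_bounded_add[OF bd(5,6)] by (auto simp: ball_bounded_def)
  have W1: "?E (\<lambda>z. (f1 z - f2 z)\<^sup>2) \<le> (pi / pi)\<^sup>2 * ?E (\<lambda>z. (p1 z + p2 z)\<^sup>2)"
    unfolding ball_integral_def
  proof (rule integral_ball_antiperiodic_le[where K="max K1 K2"])
    show "AE z in lborel. (\<forall>t. ((\<lambda>t. f1 (rot t z) - f2 (rot t z)) has_real_derivative p1 (rot t z) + p2 (rot t z)) (at t)) \<and>
        continuous_on UNIV (\<lambda>t. p1 (rot t z) + p2 (rot t z))"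
      using path by eventually_elim (auto intro!: derivative_eq_intros continuous_intros)
    show "f1 (rot pi z) - f2 (rot pi z) = - (f1 z - f2 z)" for z
      by (simp add: defs)
  qed (use K1 K2 in \<open>auto simp: le_max_iff_disj intro!: ball_bounded_measurable bds\<close>)
  obtain K3 where K3: "\<And>z. norm z < 1 \<Longrightarrow> \<bar>(f1 z + f2 z) - (g1 z + g2 z)\<bar> \<le> K3"
    using ball_bounded_diff[OF ball_bounded_add[OF bd(1,2)] ball_bounded_add[OF bd(3,4)]] by (auto simp: ball_bounded_def)
  obtain K4 where K4: "\<And>z. norm z < 1 \<Longrightarrow> \<bar>(p1 z - p2 z) + (q1 z - q2 z)\<bar> \<le> K4"
    using ball_bounded_add[OF ball_bounded_diff[OF bd(5,6)] ball_bounded_diff[OF bd(7,8)]] by (auto simp: ball_bounded_def)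
  have W2: "?E (\<lambda>z. ((f1 z + f2 z) - (g1 z + g2 z))\<^sup>2) \<le> (pi / 2 / pi)\<^sup>2 * ?E (\<lambda>z. ((p1 z - p2 z) + (q1 z - q2 z))\<^sup>2)"
    unfolding ball_integral_def
  proof (rule integral_ball_antiperiodic_le[where K="max K3 K4"])
    show "AE z in lborel. (\<forall>t. ((\<lambda>t. (f1 (rot t z) + f2 (rot t z)) - (g1 (rot t z) + g2 (rot t z)))
          has_real_derivative (p1 (rot t z) - p2 (rot t z)) + (q1 (rot t z) - q2 (rot t z))) (at t)) \<and>
        continuous_on UNIV (\<lambda>t. (p1 (rot t z) - p2 (rot t z)) + (q1 (rot t z) - q2 (rot t z)))"
      using path by eventually_elim (auto intro!: derivative_eq_intros continuous_intros)
    show "(f1 (rot (pi/2) z) + f2 (rot (pi/2) z)) - (g1 (rot (pi/2) z) + g2 (rot (pi/2) z)) = - ((f1 z + f2 z) - (g1 z + g2 z))" for z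
      by (simp add: defs)
  qed (use K3 K4 in \<open>auto simp: le_max_iff_disj intro!: ball_bounded_measurable bds\<close>)
  \<comment> \<open>Here the mean-zero hypothesis enters: for fixed \<open>x\<close>, the vector
    \<open>y\<close> ranges over a centred ball, on which \<open>F y\<close> and
    \<open>F (- y)\<close> integrate to 0.\<close>
  have cross: "?E (\<lambda>z. (f1 z + f2 z) * (g1 z + g2 z)) = 0"
  proof -
    have mF: "(\<integral>y. indicator (ball 0 R) y * F y \<partial>lborel) = 0" for R
    proof -
      have "(\<integral>y. indicator (ball 0 R) y * F y \<partial>lborel) = (\<integral>y. v (sgn y) * (of_bool (norm y < R) * norm y) \<partial>lborel)"
        by (simp add: F_def indicator_def ac_simps)
      also have "\<dots> = (\<integral>\<omega>. v \<omega> \<partial>surface_measure) * (\<integral>s. of_bool (s < R) * s \<partial>radial_measure DIM(real^'n))"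
      proof (rule integral_sgn_mult_norm)
        obtain K where K: "\<And>x. \<bar>v (sgn x)\<bar> \<le> K" "\<And>x. norm (A (sgn x)) \<le> K"
          by (rule bounds) blast
        have "integrable lborel (\<lambda>y. indicator (ball 0 R) y * F y)"
        proof (rule integrable_ball)
          show "\<bar>F y\<bar> \<le> R * K" if "norm y < R" for y
            unfolding F_def abs_mult using that K(1)[of y] abs_ge_zero[of "v (sgn y)"] norm_ge_zero[of y]
            by (intro mult_mono) (simp_all del: norm_ge_zero abs_ge_zero)
        qed measurable
        then show "integrable lborel (\<lambda>y. v (sgn y) * (of_bool (norm y < R) * norm y))"
          by (simp add: F_def indicator_def ac_simps)
      qed measurable
      finally show ?thesis by (simp add: mean)
    qed
    have mF': "(\<integral>y. indicator (ball 0 R) y * F (- y) \<partial>lborel) = 0" for R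
    proof -
      have "(\<lambda>y. indicator (ball 0 R) y * F y) \<in> borel_measurable borel"
        by (intro borel_measurable_times borel_measurable_indicator) auto
      from integral_lborel_uminus[OF this] show ?thesis
        using mF[of R] by (simp add: indicator_def)
    qed
    have z: "(\<integral>y. indicator (ball 0 R) y * (a * (F y + F (- y))) \<partial>lborel) = 0" for R a
    proof -
      obtain K where K: "\<And>x. \<bar>v (sgn x)\<bar> \<le> K" "\<And>x. norm (A (sgn x)) \<le> K"
        by (rule bounds) blast
      have b: "\<bar>F y\<bar> \<le> R * K" if "norm y < R" for y
        unfolding F_def abs_mult using that K(1)[of y] abs_ge_zero[of "v (sgn y)"] norm_ge_zero[of y]
        by (intro mult_mono) (simp_all del: norm_ge_zero abs_ge_zero)
      have i1: "integrable lborel (\<lambda>y. indicator (ball 0 R) y * F y)" "integrable lborel (\<lambda>y. indicator (ball 0 R) y * F (- y))"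
        using b b[of "- _"] by (auto intro!: integrable_ball[where K="R * K"])
      have "(\<integral>y. indicator (ball 0 R) y * (a * (F y + F (- y))) \<partial>lborel) =
          (\<integral>y. a * (indicator (ball 0 R) y * F y + indicator (ball 0 R) y * F (- y)) \<partial>lborel)"
        by (simp add: algebra_simps)
      also have "\<dots> = 0"
        using i1 by (simp add: mF mF')
      finally show ?thesis .
    qed
    show ?thesis
      by (subst ball_integral_Fubini) (simp_all add: bds defs z, simp_all add: bds flip: defs)
  qed
  define a b P Q where "a = ?E (\<lambda>z. (f1 z)\<^sup>2)" and "b = ?E (\<lambda>z. f1 z * f2 z)"
    and "P = ?E (\<lambda>z. (p1 z)\<^sup>2)" and "Q = ?E (\<lambda>z. p1 z * p2 z)"
  have sum_sq: "?E (\<lambda>z. (f z + g z)\<^sup>2) = ?E (\<lambda>z. (f z)\<^sup>2) + 2 * ?E (\<lambda>z. f z * g z) + ?E (\<lambda>z. (g z)\<^sup>2)"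
    and diff_sq: "?E (\<lambda>z. (f z - g z)\<^sup>2) = ?E (\<lambda>z. (f z)\<^sup>2) - 2 * ?E (\<lambda>z. f z * g z) + ?E (\<lambda>z. (g z)\<^sup>2)"
    if "ball_bounded f" "ball_bounded g" for f g :: "(real^'n) \<times> (real^'n) \<Rightarrow> real"
  proof -
    have fg: "ball_bounded (\<lambda>z. 2 * (f z * g z))" "ball_bounded (\<lambda>z. (f z)\<^sup>2)" "ball_bounded (\<lambda>z. (g z)\<^sup>2)"
      using that by (auto intro!: ball_bounded_intros)
    have "(\<lambda>z. (f z + g z)\<^sup>2) = (\<lambda>z. (f z)\<^sup>2 + 2 * (f z * g z) + (g z)\<^sup>2)"
      and "(\<lambda>z. (f z - g z)\<^sup>2) = (\<lambda>z. (f z)\<^sup>2 - 2 * (f z * g z) + (g z)\<^sup>2)"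
      by (auto simp: power2_eq_square algebra_simps)
    then show "?E (\<lambda>z. (f z + g z)\<^sup>2) = ?E (\<lambda>z. (f z)\<^sup>2) + 2 * ?E (\<lambda>z. f z * g z) + ?E (\<lambda>z. (g z)\<^sup>2)"
      "?E (\<lambda>z. (f z - g z)\<^sup>2) = ?E (\<lambda>z. (f z)\<^sup>2) - 2 * ?E (\<lambda>z. f z * g z) + ?E (\<lambda>z. (g z)\<^sup>2)"
      using fg by (simp_all add: ball_integral_add ball_integral_diff ball_bounded_add ball_bounded_diff ball_integral_cmult)
  qed
  have f: "?E (\<lambda>z. (f1 z + f2 z)\<^sup>2) = 2 * a + 2 * b"
    by (simp add: sum_sq bd f2 a_def b_def)
  have p: "?E (\<lambda>z. (p1 z - p2 z)\<^sup>2) = 2 * P - 2 * Q"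
    by (simp add: diff_sq bd p2 P_def Q_def)
  have 1: "2 * a - 2 * b \<le> 2 * P + 2 * Q"
    using W1 by (simp add: diff_sq sum_sq bd f2 p2 a_def b_def P_def Q_def)
  \<comment> \<open>No correlation of the derivatives is available, so the square is split crudely.
    The factor 1/4 from the quarter turn more than compensates: the resulting bound for the even
    part is twice as strong as the one needed.\<close>
  have "?E (\<lambda>z. ((p1 z - p2 z) + (q1 z - q2 z))\<^sup>2) \<le> ?E (\<lambda>z. 2 * (p1 z - p2 z)\<^sup>2 + 2 * (q1 z - q2 z)\<^sup>2)"
  proof (rule ball_integral_mono)
    fix z
    have "0 \<le> ((p1 z - p2 z) - (q1 z - q2 z))\<^sup>2" by simp
    then show "((p1 z - p2 z) + (q1 z - q2 z))\<^sup>2 \<le> 2 * (p1 z - p2 z)\<^sup>2 + 2 * (q1 z - q2 z)\<^sup>2"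
      by (simp add: power2_eq_square algebra_simps)
  qed (intro bds)+
  also have "\<dots> = 4 * (2 * P - 2 * Q)"
    by (subst ball_integral_add) (simp_all add: bds ball_integral_cmult p q)
  finally have "?E (\<lambda>z. ((f1 z + f2 z) - (g1 z + g2 z))\<^sup>2) \<le> 2 * P - 2 * Q"
    using W2 by (simp add: power_divide)
  then have 2: "4 * a + 4 * b \<le> 2 * P - 2 * Q"
    by (subst (asm) diff_sq) (simp_all add: bds cross f g)
  have "0 \<le> ?E (\<lambda>z. (f1 z + f2 z)\<^sup>2)"
    by (rule ball_integral_nonneg) simp
  then have 3: "0 \<le> 2 * a + 2 * b" by (simp add: f)
  \<comment> \<open>Adding 1 and 2 yields \<open>6 * a + 2 * b \<le> 4 * P\<close>, and 3 bounds
    \<open>2 * a + 2 * b\<close> from below by 0.\<close>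
  have "a \<le> P" using 1 2 3 by linarith
  then show ?thesis by (simp add: a_def P_def defs)
qed

text \<open>Averaging \<open>(A \<bullet> y)\<^sup>2\<close> over centred balls in \<open>y\<close>
  gives \<open>(norm A)\<^sup>2 * (norm y)\<^sup>2 / N\<close>. Both sides of
  \<open>ball_integral_F_square\<close> then factor into a sphere integral and a moment; the moments
  \<open>m1\<close> and \<open>m2\<close> agree and cancel. This leaves the factor N, of which one
  unit is absorbed by the \<open>v\<^sup>2\<close> contained in
  \<open>(norm A)\<^sup>2\<close>.\<close>

theorem sphere_poincare:
  assumes N: "2 \<le> CARD('n)" and mean: "(\<integral>\<omega>. v \<omega> \<partial>surface_measure) = 0"
  shows "(real CARD('n) - 1) * (\<integral>\<omega>. (v \<omega>)\<^sup>2 \<partial>surface_measure) \<le>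
    (\<integral>\<omega>. (norm (D \<omega>))\<^sup>2 - (\<omega> \<bullet> D \<omega>)\<^sup>2 \<partial>surface_measure)"
proof -
  let ?n = "DIM(real^'n)" and ?I = "\<lambda>s g. \<integral>y. indicator (ball 0 (sqrt (1 - s\<^sup>2))) y * g (y :: real^'n) \<partial>lborel"
  define m1 where "m1 = (\<integral>s. s\<^sup>2 * ?I s (\<lambda>_. 1) \<partial>radial_measure ?n)"
  define m2 where "m2 = (\<integral>s. 1 * ?I s (\<lambda>y. (norm y)\<^sup>2) \<partial>radial_measure ?n)"
  define S0 where "S0 = (\<integral>\<omega>. (1::real) \<partial>(surface_measure :: (real^'n) measure))"
  have S0: "0 < S0"
    unfolding S0_def by (rule measure_surface_measure_sphere_pos)
  have nfs: "norm (fst z) \<le> norm z" "norm (snd z) \<le> norm z" for z :: "(real^'n) \<times> (real^'n)"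
    using norm_fst_le[of "fst z" "snd z"] norm_snd_le[of "snd z" "fst z"] by auto
  have bF: "ball_bounded (\<lambda>z::(real^'n) \<times> (real^'n). (F (fst z))\<^sup>2)"
    by (rule ball_bounded_power2, rule ball_bounded_F) (simp_all add: nfs)
  have bA: "ball_bounded (\<lambda>z. (A (sgn (fst z)) \<bullet> snd z)\<^sup>2)"
    by (rule ball_bounded_power2, rule ball_bounded_A) (simp_all add: nfs)
  obtain K where K: "\<And>x. \<bar>v (sgn x)\<bar> \<le> K" "\<And>x. norm (A (sgn x)) \<le> K"
    by (rule bounds) blast
  have bA': "ball_bounded (\<lambda>z::(real^'n) \<times> (real^'n). (norm (A (sgn (fst z))))\<^sup>2 / CARD('n))"
    by (rule ball_boundedI[where K="K\<^sup>2 / CARD('n)"]) (auto intro!: divide_right_mono power_mono K)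
  have "ball_integral (\<lambda>z::(real^'n) \<times> (real^'n). (v (sgn (fst z)))\<^sup>2 * ((norm (fst z))\<^sup>2 * 1)) = (\<integral>\<omega>. (v \<omega>)\<^sup>2 \<partial>surface_measure) * m1"
    unfolding m1_def using bF
    by (intro ball_integral_sgn[where h="\<lambda>\<omega>. (v \<omega>)\<^sup>2" and e="\<lambda>s. s\<^sup>2" and g="\<lambda>_. 1"])
      (auto simp: F_def power_mult_distrib mult.commute)
  then have e1: "ball_integral (\<lambda>z::(real^'n) \<times> (real^'n). (F (fst z))\<^sup>2) = (\<integral>\<omega>. (v \<omega>)\<^sup>2 \<partial>surface_measure) * m1"
    by (simp add: F_def power_mult_distrib mult.commute)
  have "ball_integral (\<lambda>z::(real^'n) \<times> (real^'n). 1 * ((norm (fst z))\<^sup>2 * 1)) = S0 * m1"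
    unfolding m1_def S0_def using ball_bounded_fst_norm[where 'a="real^'n"]
    by (intro ball_integral_sgn[where h="\<lambda>\<omega>. 1" and e="\<lambda>s. s\<^sup>2" and g="\<lambda>_. 1"]) auto
  then have e2: "ball_integral (\<lambda>z::(real^'n) \<times> (real^'n). (norm (fst z))\<^sup>2) = S0 * m1"
    by simp
  have "ball_integral (\<lambda>z::(real^'n) \<times> (real^'n). 1 * (1 * (norm (snd z))\<^sup>2)) = S0 * m2"
    unfolding m2_def S0_def using ball_bounded_snd_norm[where 'a="real^'n"]
    by (intro ball_integral_sgn[where h="\<lambda>\<omega>. 1" and e="\<lambda>s. 1" and g="\<lambda>y. (norm y)\<^sup>2"]) auto
  then have e3: "ball_integral (\<lambda>z::(real^'n) \<times> (real^'n). (norm (snd z))\<^sup>2) = S0 * m2"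
    by simp
  have in2: "(\<integral>y. indicator (ball 0 R) y * (a \<bullet> y)\<^sup>2 \<partial>lborel) = (\<integral>y. indicator (ball 0 R) y * ((norm a)\<^sup>2 / CARD('n) * (norm (y :: real^'n))\<^sup>2) \<partial>lborel)"
    for a :: "real^'n" and R
  proof -
    have "(\<integral>y. indicator (ball 0 R) y * ((norm a)\<^sup>2 / CARD('n) * (norm (y :: real^'n))\<^sup>2) \<partial>lborel) =
        (norm a)\<^sup>2 / CARD('n) * (\<integral>y. indicator (ball 0 R) y * (norm (y :: real^'n))\<^sup>2 \<partial>lborel)"
      by (subst integral_mult_right_zero[symmetric]) (simp add: ac_simps)
    then show ?thesis
      using integral_ball_inner_square[of R a] by (simp add: field_simps)
  qed
  have "ball_integral (\<lambda>z. (A (sgn (fst z)) \<bullet> snd z)\<^sup>2) = ball_integral (\<lambda>z::(real^'n) \<times> (real^'n). (norm (A (sgn (fst z))))\<^sup>2 / CARD('n) * (norm (snd z))\<^sup>2)"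
    using ball_integral_Fubini[OF bA] ball_integral_Fubini[OF ball_bounded_mult[OF bA' ball_bounded_snd_norm]]
    by (simp only: in2 fst_conv snd_conv)
  also have "\<dots> = ball_integral (\<lambda>z::(real^'n) \<times> (real^'n). (norm (A (sgn (fst z))))\<^sup>2 / CARD('n) * (1 * (norm (snd z))\<^sup>2))"
    by simp
  also have "\<dots> = (\<integral>\<omega>. (norm (A \<omega>))\<^sup>2 / CARD('n) \<partial>surface_measure) * m2"
    unfolding m2_def using ball_bounded_mult[OF bA' ball_bounded_snd_norm]
    by (intro ball_integral_sgn[where h="\<lambda>\<omega>. (norm (A \<omega>))\<^sup>2 / CARD('n)" and e="\<lambda>s. 1" and g="\<lambda>y. (norm y)\<^sup>2"]) auto
  finally have e4: "ball_integral (\<lambda>z. (A (sgn (fst z)) \<bullet> snd z)\<^sup>2) = (\<integral>\<omega>. (norm (A \<omega>))\<^sup>2 \<partial>surface_measure) / CARD('n) * m2"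
    by simp
  have m: "m1 = m2" "0 < m1"
    using ball_integral_norm_fst[where 'a="real^'n"] S0 by (auto simp: e2 e3 zero_less_mult_iff)
  have "(\<integral>\<omega>. (v \<omega>)\<^sup>2 \<partial>surface_measure) * m1 \<le> (\<integral>\<omega>. (norm (A \<omega>))\<^sup>2 \<partial>surface_measure) / CARD('n) * m1"
    using ball_integral_F_square[OF N mean] unfolding e1 e4 m(1) .
  then have "CARD('n) * (\<integral>\<omega>. (v \<omega>)\<^sup>2 \<partial>surface_measure) \<le> (\<integral>\<omega>. (norm (A \<omega>))\<^sup>2 \<partial>surface_measure)"
    using m(2) by (simp add: field_simps)
  also have "\<dots> = (\<integral>\<omega>. (v \<omega>)\<^sup>2 + ((norm (D \<omega>))\<^sup>2 - (\<omega> \<bullet> D \<omega>)\<^sup>2) \<partial>surface_measure)"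
    by (intro Bochner_Integration.integral_cong refl norm_A) simp
  also have "\<dots> = (\<integral>\<omega>. (v \<omega>)\<^sup>2 \<partial>surface_measure) + (\<integral>\<omega>. (norm (D \<omega>))\<^sup>2 - (\<omega> \<bullet> D \<omega>)\<^sup>2 \<partial>surface_measure)"
  proof (rule Bochner_Integration.integral_add)
    show "integrable surface_measure (\<lambda>\<omega>. (v \<omega>)\<^sup>2)"
      by (intro integrable_surface_measure continuous_intros cont_v)
    show "integrable surface_measure (\<lambda>\<omega>. (norm (D \<omega>))\<^sup>2 - (\<omega> \<bullet> D \<omega>)\<^sup>2)"
      by (intro integrable_surface_measure continuous_intros cont_D')
  qed
  finally show ?thesis by (simp add: algebra_simps)
qed

end

section \<open>Hardy inequalities for compactly supported functions\<close>

text \<open>The bound \<open>L * norm x\<close> encodes \<open>v 0 = 0\<close> together with a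
  bounded gradient. It keeps \<open>v x / norm x\<close> bounded, so the Hardy integrand is
  integrable even in dimension 2, where \<open>1 / |x|^2\<close> is not.\<close>

locale compactly_supported_C1 = C1_function v D
  for v :: "real^'n \<Rightarrow> real" and D :: "real^'n \<Rightarrow> real^'n" +
  fixes c L :: real
  assumes N: "2 \<le> CARD('n)"
    and c: "0 < c" "c < 1"
    and v0: "\<And>x. c \<le> norm x \<Longrightarrow> v x = 0"
    and D0: "\<And>x. c \<le> norm x \<Longrightarrow> D x = 0"
    and L: "\<And>x. norm (D x) \<le> L" "\<And>x. \<bar>v x\<bar> \<le> L * norm x"
    and mean: "\<And>r. 0 < r \<Longrightarrow> r < 1 \<Longrightarrow> (\<integral>\<omega>. v (r *\<^sub>R \<omega>) \<partial>surface_measure) = 0"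
begin

definition Dr :: "real^'n \<Rightarrow> real" where
  "Dr x = sgn x \<bullet> D x"

definition W :: "real^'n \<Rightarrow> real" where
  "W x = (v x / norm x)\<^sup>2"

lemma measurable_Dr [measurable]: "Dr \<in> borel_measurable borel"
  unfolding Dr_def by measurable

lemma measurable_W [measurable]: "W \<in> borel_measurable borel"
  unfolding W_def by measurable

lemma L_nonneg: "0 \<le> L"
  using L(1)[of 0] by (rule order_trans[OF norm_ge_zero])

lemma integrableI:
  assumes "f \<in> borel_measurable borel" "\<And>x. norm x < c \<Longrightarrow> \<bar>f x\<bar> \<le> K" "\<And>x. c \<le> norm x \<Longrightarrow> f x = 0"
  shows "integrable lborel (f :: real^'n \<Rightarrow> real)"
  by (rule integrableI_bounded_set[where A="ball 0 c" and B=K])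
    (use assms c in \<open>auto simp: emeasure_ball not_less\<close>)

lemma quotient_bound: "\<bar>v x / norm x\<bar> \<le> L"
  using L(2)[of x] L_nonneg by (cases "x = 0") (auto simp: abs_div pos_divide_le_eq)

lemma Dr_bound: "\<bar>Dr x\<bar> \<le> L"
proof -
  have "\<bar>Dr x\<bar> \<le> 1 * L"
    unfolding Dr_def using L(1)[of x] by (intro order_trans[OF Cauchy_Schwarz_ineq2] mult_mono) (auto simp: norm_sgn)
  then show ?thesis by simp
qed

lemma Dr0: "c \<le> norm x \<Longrightarrow> Dr x = 0"
  by (simp add: Dr_def D0)

lemma sq_le: "\<bar>a\<bar> \<le> L \<Longrightarrow> a\<^sup>2 \<le> L\<^sup>2"
  using power_mono[of "\<bar>a\<bar>" L 2] by simp

lemma prod_le: "\<bar>a\<bar> \<le> L \<Longrightarrow> \<bar>b\<bar> \<le> L \<Longrightarrow> \<bar>a * b\<bar> \<le> L\<^sup>2"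
  unfolding abs_mult power2_eq_square by (intro mult_mono L_nonneg) auto

lemma integrable_W: "integrable lborel W"
  by (rule integrableI[where K="L\<^sup>2"]) (auto simp: W_def v0 intro!: sq_le quotient_bound)

lemma integrable_Dr: "integrable lborel (\<lambda>x. (Dr x)\<^sup>2)"
  by (rule integrableI[where K="L\<^sup>2"]) (auto simp: Dr0 intro!: sq_le Dr_bound)

lemma integrable_D: "integrable lborel (\<lambda>x. (norm (D x))\<^sup>2)"
  by (rule integrableI[where K="L\<^sup>2"]) (auto simp: D0 intro!: sq_le L)

text \<open>On the sphere of radius \<open>r\<close> the Poincare inequality is applied to
  \<open>x \<mapsto> v (r *\<^sub>R x)\<close>. The gradient of this function carries a factor
  \<open>r\<close>, and division by \<open>r\<^sup>2\<close> gives the Hardy weight.\<close>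

lemma angular:
  "(real CARD('n) - 1) * (\<integral>x. W x \<partial>lborel) \<le> (\<integral>x. (norm (D x))\<^sup>2 \<partial>lborel) - (\<integral>x. (Dr x)\<^sup>2 \<partial>lborel)"
proof -
  have "0 \<le> (\<integral>x. ((norm (D x))\<^sup>2 - (Dr x)\<^sup>2) - (real CARD('n) - 1) * W x \<partial>lborel)"
  proof (rule integral_nonneg_polar)
    show "integrable lborel (\<lambda>x. ((norm (D x))\<^sup>2 - (Dr x)\<^sup>2) - (real CARD('n) - 1) * W x)"
      using integrable_W integrable_D integrable_Dr by simp
    fix r :: real assume r: "0 < r"
    define w where "w x = v (r *\<^sub>R x)" for x
    define E where "E x = r *\<^sub>R D (r *\<^sub>R x)" for x
    interpret w: C1_function w E
    proof
      show "(w has_derivative (\<lambda>h. E x \<bullet> h)) (at x)" for x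
      proof -
        have "((\<lambda>x. r *\<^sub>R x) has_derivative (\<lambda>h. r *\<^sub>R h)) (at x)"
          by (auto intro!: derivative_eq_intros)
        from has_derivative_compose[OF this deriv] show ?thesis
          by (simp add: w_def[abs_def] E_def)
      qed
      show "continuous_on UNIV E"
        unfolding E_def by (intro continuous_intros continuous_on_compose2[OF cont_D]) auto
    qed
    have "(\<integral>\<omega>. w \<omega> \<partial>surface_measure) = 0"
    proof (cases "r < 1")
      case True
      then show ?thesis using mean[OF r] by (simp add: w_def)
    next
      case False
      then have "(\<integral>\<omega>. w \<omega> \<partial>surface_measure) = (\<integral>\<omega>. 0 \<partial>(surface_measure :: (real^'n) measure))"
        using c by (intro Bochner_Integration.integral_cong) (auto simp: w_def intro!: v0)
      then show ?thesis by simp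
    qed
    from w.sphere_poincare[OF N this]
    have sp: "(real CARD('n) - 1) * (\<integral>\<omega>. (w \<omega>)\<^sup>2 \<partial>surface_measure) \<le>
      (\<integral>\<omega>. (norm (E \<omega>))\<^sup>2 - (\<omega> \<bullet> E \<omega>)\<^sup>2 \<partial>surface_measure)" .
    have i1: "integrable surface_measure (\<lambda>\<omega>. (w \<omega>)\<^sup>2)"
      by (intro integrable_surface_measure continuous_intros w.cont_v)
    have i2: "integrable surface_measure (\<lambda>\<omega>. (norm (E \<omega>))\<^sup>2 - (\<omega> \<bullet> E \<omega>)\<^sup>2)"
      by (intro integrable_surface_measure continuous_intros w.cont_D')
    have "(\<integral>\<omega>. ((norm (D (r *\<^sub>R \<omega>)))\<^sup>2 - (Dr (r *\<^sub>R \<omega>))\<^sup>2) - (real CARD('n) - 1) * W (r *\<^sub>R \<omega>) \<partial>surface_measure) =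
      (\<integral>\<omega>. (((norm (E \<omega>))\<^sup>2 - (\<omega> \<bullet> E \<omega>)\<^sup>2) - (real CARD('n) - 1) * (w \<omega>)\<^sup>2) / r\<^sup>2 \<partial>surface_measure)"
    proof (rule Bochner_Integration.integral_cong[OF refl])
      fix \<omega> :: "real^'n" assume "\<omega> \<in> space surface_measure"
      then have \<omega>: "norm \<omega> = 1" by simp
      have s: "sgn (r *\<^sub>R \<omega>) = \<omega>"
        using r \<omega> by (simp add: sgn_div_norm)
      show "((norm (D (r *\<^sub>R \<omega>)))\<^sup>2 - (Dr (r *\<^sub>R \<omega>))\<^sup>2) - (real CARD('n) - 1) * W (r *\<^sub>R \<omega>) =
        (((norm (E \<omega>))\<^sup>2 - (\<omega> \<bullet> E \<omega>)\<^sup>2) - (real CARD('n) - 1) * (w \<omega>)\<^sup>2) / r\<^sup>2"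
        unfolding Dr_def s W_def E_def w_def
        using r \<omega> by (simp add: power_mult_distrib power_divide diff_divide_distrib)
    qed
    also have "\<dots> = ((\<integral>\<omega>. (norm (E \<omega>))\<^sup>2 - (\<omega> \<bullet> E \<omega>)\<^sup>2 \<partial>surface_measure) - (real CARD('n) - 1) * (\<integral>\<omega>. (w \<omega>)\<^sup>2 \<partial>surface_measure)) / r\<^sup>2"
      using i1 i2 by simp
    also have "0 \<le> \<dots>"
      using sp by simp
    finally show "0 \<le> (\<integral>\<omega>. ((norm (D (r *\<^sub>R \<omega>)))\<^sup>2 - (Dr (r *\<^sub>R \<omega>))\<^sup>2) - (real CARD('n) - 1) * W (r *\<^sub>R \<omega>) \<partial>surface_measure)" .
  qed
  also have "\<dots> = (\<integral>x. (norm (D x))\<^sup>2 \<partial>lborel) - (\<integral>x. (Dr x)\<^sup>2 \<partial>lborel) - (real CARD('n) - 1) * (\<integral>x. W x \<partial>lborel)"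
    using integrable_W integrable_D integrable_Dr by simp
  finally show ?thesis by simp
qed

lemma v_along:
  assumes "norm \<omega> = 1" "0 < r"
  shows "((\<lambda>r. v (r *\<^sub>R \<omega>)) has_real_derivative Dr (r *\<^sub>R \<omega>)) (at r)"
proof -
  have "((\<lambda>r. r *\<^sub>R \<omega>) has_derivative (\<lambda>h. h *\<^sub>R \<omega>)) (at r)"
    by (auto intro!: derivative_eq_intros)
  from has_derivative_compose[OF this deriv] show ?thesis
    by (rule has_derivative_imp_has_field_derivative)
      (use assms in \<open>simp add: Dr_def sgn_div_norm inner_commute\<close>)
qed

text \<open>Euler's identity for \<open>W\<close>, whose radial derivative is
  \<open>2 * p - 2 * W\<close>, evaluates the cross term of the square: the integral of
  \<open>p\<close> is \<open>- (N - 2) / 2\<close> times that of \<open>W\<close>. An identity is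
  kept instead of an inequality because the square decides the case of equality.\<close>

lemma radial:
  "(\<integral>x. (Dr x)\<^sup>2 \<partial>lborel) = ((real CARD('n) - 2) / 2)\<^sup>2 * (\<integral>x. W x \<partial>lborel) +
    (\<integral>x. (Dr x + (real CARD('n) - 2) / 2 * (v x / norm x))\<^sup>2 \<partial>lborel)"
proof -
  define k where "k = (real CARD('n) - 2) / 2"
  define p where "p x = v x / norm x * Dr x" for x
  define f' where "f' x = 2 * p x - 2 * W x" for x
  have [measurable]: "p \<in> borel_measurable borel"
    unfolding p_def by measurable
  have bp: "\<bar>p x\<bar> \<le> L\<^sup>2" for x
    unfolding p_def by (rule prod_le[OF quotient_bound Dr_bound])
  have bW: "\<bar>W x\<bar> \<le> L\<^sup>2" for x
    by (auto simp: W_def intro!: sq_le quotient_bound)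
  have ip: "integrable lborel p"
    by (rule integrableI[where K="L\<^sup>2"], measurable, rule bp, simp add: p_def v0)
  have "(\<integral>x. f' x \<partial>lborel) = - DIM(real^'n) * (\<integral>x. W x \<partial>lborel)"
  proof (rule integral_euler(3))
    show "\<bar>W x\<bar> \<le> 4 * L\<^sup>2" "\<bar>f' x\<bar> \<le> 4 * L\<^sup>2" for x
      using bW[of x] bp[of x] unfolding f'_def by linarith+
    show "c \<le> norm x \<Longrightarrow> W x = 0" "c \<le> norm x \<Longrightarrow> f' x = 0" for x
      by (simp_all add: W_def f'_def p_def v0)
    fix r :: real and \<omega> :: "real^'n" assume a: "norm \<omega> = 1" "0 < r" "r < 1"
    have "((\<lambda>r. (v (r *\<^sub>R \<omega>) / r)\<^sup>2) has_real_derivative f' (r *\<^sub>R \<omega>) / r) (at r)"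
      using a by (auto intro!: derivative_eq_intros v_along simp: f'_def p_def W_def field_simps power2_eq_square)
    moreover have "\<forall>\<^sub>F r in nhds r. (v (r *\<^sub>R \<omega>) / r)\<^sup>2 = W (r *\<^sub>R \<omega>)"
      using a by (simp add: W_def power_divide)
    ultimately show "((\<lambda>r. W (r *\<^sub>R \<omega>)) has_real_derivative f' (r *\<^sub>R \<omega>) / r) (at r)"
      by (subst DERIV_cong_ev[OF refl _ refl, symmetric])
  qed (use c in \<open>auto simp: f'_def[abs_def]\<close>)
  then have e: "(\<integral>x. p x \<partial>lborel) = - k * (\<integral>x. W x \<partial>lborel)"
    using ip integrable_W by (simp add: f'_def k_def field_simps)
  have "(\<integral>x. (Dr x + k * (v x / norm x))\<^sup>2 \<partial>lborel) =
      (\<integral>x. (Dr x)\<^sup>2 + 2 * k * p x + k\<^sup>2 * W x \<partial>lborel)"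
    by (simp add: W_def p_def power2_eq_square algebra_simps)
  also have "\<dots> = (\<integral>x. (Dr x)\<^sup>2 \<partial>lborel) + 2 * k * (\<integral>x. p x \<partial>lborel) + k\<^sup>2 * (\<integral>x. W x \<partial>lborel)"
    using ip integrable_W integrable_Dr by simp
  finally show ?thesis
    unfolding e k_def[symmetric] by (simp add: power2_eq_square algebra_simps)
qed

lemma hardy_remainder:
  "(real CARD('n))\<^sup>2 / 4 * (\<integral>x. W x \<partial>lborel) + (\<integral>x. (Dr x + (real CARD('n) - 2) / 2 * (v x / norm x))\<^sup>2 \<partial>lborel)
    \<le> (\<integral>x. (norm (D x))\<^sup>2 \<partial>lborel)"
proof -
  have "(real CARD('n))\<^sup>2 / 4 * (\<integral>x. W x \<partial>lborel) =
      ((real CARD('n) - 2) / 2)\<^sup>2 * (\<integral>x. W x \<partial>lborel) + (real CARD('n) - 1) * (\<integral>x. W x \<partial>lborel)"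
    by (simp add: power2_eq_square field_simps)
  then show ?thesis
    using angular radial by linarith
qed

lemma hardy: "(real CARD('n))\<^sup>2 / 4 * (\<integral>x. W x \<partial>lborel) \<le> (\<integral>x. (norm (D x))\<^sup>2 \<partial>lborel)"
proof -
  have "0 \<le> (\<integral>x. (Dr x + (real CARD('n) - 2) / 2 * (v x / norm x))\<^sup>2 \<partial>lborel)"
    by (rule Bochner_Integration.integral_nonneg) simp
  with hardy_remainder show ?thesis by linarith
qed

text \<open>A vanishing remainder makes \<open>norm x powr ((N - 2) / 2) * v x\<close> constant along rays,
  which contradicts the compact support.\<close>

lemma hardy_strict:
  assumes eq: "(real CARD('n))\<^sup>2 / 4 * (\<integral>x. W x \<partial>lborel) = (\<integral>x. (norm (D x))\<^sup>2 \<partial>lborel)"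
  shows "v x = 0"
proof -
  define k where "k = (real CARD('n) - 2) / 2"
  define q where "q x = Dr x + k * (v x / norm x)" for x
  have [measurable]: "q \<in> borel_measurable borel"
    unfolding q_def by measurable
  have bq: "\<bar>q x\<bar> \<le> L + \<bar>k\<bar> * L" for x
    unfolding q_def abs_mult[of k]
    by (rule order_trans[OF abs_triangle_ineq add_mono[OF Dr_bound]])
      (simp only: abs_mult[of k] mult_left_mono[OF quotient_bound abs_ge_zero])
  have iq: "integrable lborel (\<lambda>x. (q x)\<^sup>2)"
  proof (rule integrableI)
    show "\<bar>(q x)\<^sup>2\<bar> \<le> (L + \<bar>k\<bar> * L)\<^sup>2" for x
      using power_mono[OF bq[of x], of 2] by simp
  qed (auto simp: q_def Dr0 v0)
  have "(\<integral>x. (q x)\<^sup>2 \<partial>lborel) \<le> 0"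
    using hardy_remainder eq by (simp add: q_def k_def)
  moreover have "0 \<le> (\<integral>x. (q x)\<^sup>2 \<partial>lborel)"
    by (rule Bochner_Integration.integral_nonneg) simp
  ultimately have "AE x in lborel. q x = 0"
    using integral_nonneg_eq_0_iff_AE[OF iq] by simp
  \<comment> \<open>Away from the origin \<open>q\<close> is continuous, so the set where it does
    not vanish is open; an open null set is empty. This upgrades \<open>q = 0\<close> from almost
    everywhere to every nonzero point.\<close>
  moreover have "open {x. x \<noteq> 0 \<and> q x \<noteq> 0}"
  proof -
    have "continuous_on (- {0}) q"
      unfolding q_def Dr_def by (intro continuous_intros cont_v cont_D') auto
    then have "open (- {0} \<inter> q -` (- {0}))"
      by (rule continuous_open_preimage) auto
    moreover have "- {0} \<inter> q -` (- {0}) = {x. x \<noteq> 0 \<and> q x \<noteq> 0}" by auto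
    ultimately show ?thesis by simp
  qed
  ultimately have q0: "q y = 0" if "y \<noteq> 0" for y
  proof -
    have "{x. x \<noteq> 0 \<and> q x \<noteq> 0} = {}"
    proof (rule ccontr)
      assume ne: "{x. x \<noteq> 0 \<and> q x \<noteq> 0} \<noteq> {}"
      have "AE x in lborel. x \<notin> {x. x \<noteq> 0 \<and> q x \<noteq> 0}"
        using \<open>AE x in lborel. q x = 0\<close> by eventually_elim auto
      then have "{x. x \<noteq> 0 \<and> q x \<noteq> 0} \<in> null_sets lborel"
        using \<open>open {x. x \<noteq> 0 \<and> q x \<noteq> 0}\<close> by (subst AE_iff_null_sets) auto
      then have "negligible {x. x \<noteq> 0 \<and> q x \<noteq> 0}"
        by (simp add: negligible_iff_null_sets null_sets_completionI)
      then show False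
        using open_not_negligible[OF \<open>open {x. x \<noteq> 0 \<and> q x \<noteq> 0}\<close> ne] by simp
    qed
    then show ?thesis using that by auto
  qed
  have v_zero: "v 0 = 0" using L(2)[of 0] by simp
  show ?thesis
  proof (cases "x = 0 \<or> c \<le> norm x")
    case True
    then show ?thesis using v_zero v0 by auto
  next
    case False
    define \<omega> where "\<omega> = sgn x"
    have \<omega>: "norm \<omega> = 1" using False by (simp add: \<omega>_def norm_sgn)
    define g where "g r = r powr k * v (r *\<^sub>R \<omega>)" for r
    have dg: "(g has_real_derivative 0) (at r)" if r: "0 < r" for r
    proof -
      have "q (r *\<^sub>R \<omega>) = 0" using r \<omega> by (intro q0) auto
      then have Dr: "Dr (r *\<^sub>R \<omega>) = - (k * (v (r *\<^sub>R \<omega>) / r))"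
        using r \<omega> by (simp add: q_def)
      have "((\<lambda>r. r powr k * v (r *\<^sub>R \<omega>)) has_real_derivative
          (k * r powr (k - 1)) * v (r *\<^sub>R \<omega>) + Dr (r *\<^sub>R \<omega>) * r powr k) (at r)"
        by (rule DERIV_mult[OF has_real_derivative_powr[OF r] v_along[OF \<omega> r]])
      moreover have "(k * r powr (k - 1)) * v (r *\<^sub>R \<omega>) + Dr (r *\<^sub>R \<omega>) * r powr k = 0"
        unfolding Dr using r by (simp add: powr_diff field_simps)
      ultimately show ?thesis by (simp add: g_def[abs_def])
    qed
    have "g (norm x) = g c"
    proof (rule DERIV_isconst2[of "norm x" c g, symmetric])
      show "norm x < c" using False by simp
      show "continuous_on {norm x..c} g"
      proof (intro continuous_at_imp_continuous_on ballI)
        fix y assume "y \<in> {norm x..c}"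
        then have "0 < y" using False by (auto intro: less_le_trans[of 0 "norm x"])
        then show "isCont g y" by (rule DERIV_isCont[OF dg])
      qed
      show "DERIV g r :> 0" if "norm x < r" "r < c" for r
        using that by (intro dg) (auto intro: le_less_trans[OF norm_ge_zero])
    qed (use False in auto)
    also have "g c = 0"
      using v0[of "c *\<^sub>R \<omega>"] c \<omega> by (simp add: g_def)
    finally have "v (norm x *\<^sub>R \<omega>) = 0"
      using False by (simp add: g_def)
    then show ?thesis
      using False by (simp add: \<omega>_def sgn_div_norm)
  qed
qed

section \<open>The logarithmic weight in dimension two\<close>

definition ell :: "real^'n \<Rightarrow> real" where
  "ell x = ln (exp 1 / norm x)"

lemma ell_ge_1: "x \<noteq> 0 \<Longrightarrow> norm x < 1 \<Longrightarrow> 1 \<le> ell x"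
  by (simp add: ell_def ln_div)

definition Wl :: "real^'n \<Rightarrow> real" where
  "Wl x = (v x / (norm x * ell x))\<^sup>2"

lemma measurable_ell [measurable]: "ell \<in> borel_measurable borel"
  unfolding ell_def by measurable

lemma measurable_Wl [measurable]: "Wl \<in> borel_measurable borel"
  unfolding Wl_def by measurable

lemma log_quotient_bound:
  assumes "norm x < c"
  shows "\<bar>v x / (norm x * ell x)\<bar> \<le> \<bar>v x / norm x\<bar>" "\<bar>(v x / norm x)\<^sup>2 / ell x\<bar> \<le> (v x / norm x)\<^sup>2"
proof -
  have *: "\<bar>a / ell x\<bar> \<le> \<bar>a\<bar>" if "x \<noteq> 0" for a
    using ell_ge_1[of x] that assms c by (simp add: abs_div divide_le_eq mult_le_cancel_left1)
  show "\<bar>v x / (norm x * ell x)\<bar> \<le> \<bar>v x / norm x\<bar>"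
    using *[of "v x / norm x"] by (cases "x = 0") (auto simp: field_simps)
  show "\<bar>(v x / norm x)\<^sup>2 / ell x\<bar> \<le> (v x / norm x)\<^sup>2"
    using *[of "(v x / norm x)\<^sup>2"] by (cases "x = 0") auto
qed

lemma Wl_le: "norm x < c \<Longrightarrow> Wl x \<le> W x"
  unfolding Wl_def W_def using log_quotient_bound(1)[of x] by (simp only: abs_le_square_iff)

lemma integrable_Wl: "integrable lborel Wl"
proof (rule integrableI[where K="L\<^sup>2"])
  show "\<bar>Wl x\<bar> \<le> L\<^sup>2" if "norm x < c" for x
    using Wl_le[OF that] sq_le[OF quotient_bound[of x]] by (simp add: W_def Wl_def)
qed (auto simp: Wl_def v0)

text \<open>Since \<open>r\<close> times the derivative of \<open>1 / ell\<close> is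
  \<open>1 / ell\<^sup>2\<close>, the radial derivative of \<open>f\<close> is
  \<open>2 * p - 2 * f + Wl\<close>. In dimension 2 Euler's identity cancels the terms in
  \<open>f\<close> and leaves twice the integral of \<open>p\<close> equal to minus that of
  \<open>Wl\<close>. Expanding the square of \<open>Dr + v / (2 * norm x * ell)\<close> then
  produces 1/4.\<close>

lemma radial_log:
  assumes N2: "CARD('n) = 2"
  shows "1 / 4 * (\<integral>x. Wl x \<partial>lborel) \<le> (\<integral>x. (Dr x)\<^sup>2 \<partial>lborel)"
proof -
  define f where "f x = (v x / norm x)\<^sup>2 / ell x" for x
  define p where "p x = v x / (norm x * ell x) * Dr x" for x
  define f' where "f' x = 2 * p x - 2 * f x + Wl x" for x
  have [measurable]: "f \<in> borel_measurable borel" "p \<in> borel_measurable borel"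
    unfolding f_def p_def by measurable
  have z: "f x = 0" "p x = 0" "Wl x = 0" if "c \<le> norm x" for x
    using that by (simp_all add: f_def p_def Wl_def v0)
  have b: "\<bar>f x\<bar> \<le> L\<^sup>2" "\<bar>p x\<bar> \<le> L\<^sup>2" "\<bar>Wl x\<bar> \<le> L\<^sup>2" for x
  proof -
    have "\<bar>f x\<bar> \<le> L\<^sup>2 \<and> \<bar>p x\<bar> \<le> L\<^sup>2 \<and> \<bar>Wl x\<bar> \<le> L\<^sup>2"
    proof (cases "norm x < c")
      case False
      then show ?thesis by (simp add: z)
    next
      case True
      have l: "\<bar>v x / (norm x * ell x)\<bar> \<le> L"
        using log_quotient_bound(1)[OF True] quotient_bound by (rule order_trans)
      have "\<bar>f x\<bar> \<le> L\<^sup>2"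
        unfolding f_def using log_quotient_bound(2)[OF True] sq_le[OF quotient_bound] by (rule order_trans)
      moreover have "\<bar>p x\<bar> \<le> L\<^sup>2"
        unfolding p_def using l Dr_bound by (rule prod_le)
      moreover have "\<bar>Wl x\<bar> \<le> L\<^sup>2"
        unfolding Wl_def using sq_le[OF l] by simp
      ultimately show ?thesis by blast
    qed
    then show "\<bar>f x\<bar> \<le> L\<^sup>2" "\<bar>p x\<bar> \<le> L\<^sup>2" "\<bar>Wl x\<bar> \<le> L\<^sup>2" by auto
  qed
  have ip: "integrable lborel p" and i_f: "integrable lborel f"
    using b z by (auto intro!: integrableI)
  have "(\<integral>x. f' x \<partial>lborel) = - DIM(real^'n) * (\<integral>x. f x \<partial>lborel)"
  proof (rule integral_euler(3))
    show "\<bar>f x\<bar> \<le> 5 * L\<^sup>2" "\<bar>f' x\<bar> \<le> 5 * L\<^sup>2" for x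
      using b[of x] unfolding f'_def by linarith+
    show "c \<le> norm x \<Longrightarrow> f x = 0" "c \<le> norm x \<Longrightarrow> f' x = 0" for x
      by (simp_all add: f'_def z)
    fix r :: real and \<omega> :: "real^'n" assume a: "norm \<omega> = 1" "0 < r" "r < 1"
    have l: "1 - ln r \<noteq> 0" using a ln_less_zero[of r] by linarith
    have n: "ell (r *\<^sub>R \<omega>) = 1 - ln r" if "0 < r" for r
      using that a by (simp add: ell_def ln_div)
    have d1: "((\<lambda>r. (v (r *\<^sub>R \<omega>) / r)\<^sup>2) has_real_derivative
        2 * (v (r *\<^sub>R \<omega>) / r) * ((Dr (r *\<^sub>R \<omega>) * r - v (r *\<^sub>R \<omega>)) / (r * r))) (at r)"
      using a by (auto intro!: derivative_eq_intros v_along simp: ac_simps)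
    have d2: "((\<lambda>r. 1 / (1 - ln r)) has_real_derivative (1 / (1 - ln r))\<^sup>2 / r) (at r)"
      using a l by (auto intro!: derivative_eq_intros simp: power2_eq_square divide_simps)
    have alg: "2 * (V / r) * ((d * r - V) / (r * r)) * (1 / m) + (1 / m)\<^sup>2 / r * (V / r)\<^sup>2 =
        (2 * (V / (r * m) * d) - 2 * ((V / r)\<^sup>2 / m) + (V / (r * m))\<^sup>2) / r" if "m \<noteq> 0" for V d m
      using that a by (simp add: divide_simps power2_eq_square) (simp add: algebra_simps)
    have "((\<lambda>r. (v (r *\<^sub>R \<omega>) / r)\<^sup>2 / (1 - ln r)) has_real_derivative f' (r *\<^sub>R \<omega>) / r) (at r)"
      using DERIV_mult[OF d1 d2] alg[OF l, of "v (r *\<^sub>R \<omega>)" "Dr (r *\<^sub>R \<omega>)"] a n[of r]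
      by (simp add: f'_def p_def f_def Wl_def)
    moreover have "\<forall>\<^sub>F r in nhds r. (v (r *\<^sub>R \<omega>) / r)\<^sup>2 / (1 - ln r) = f (r *\<^sub>R \<omega>)"
      using eventually_nhds_in_open[of "{0<..}" r] a by (auto simp: f_def n elim!: eventually_mono)
    ultimately show "((\<lambda>r. f (r *\<^sub>R \<omega>)) has_real_derivative f' (r *\<^sub>R \<omega>) / r) (at r)"
      by (subst DERIV_cong_ev[OF refl _ refl, symmetric]) auto
  qed (use c in \<open>auto simp: f'_def[abs_def]\<close>)
  then have e: "2 * (\<integral>x. p x \<partial>lborel) = - (\<integral>x. Wl x \<partial>lborel)"
    using ip i_f integrable_Wl N2 by (simp add: f'_def)
  have "0 \<le> (\<integral>x. (Dr x + 1 / 2 * (v x / (norm x * ell x)))\<^sup>2 \<partial>lborel)"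
    by (rule Bochner_Integration.integral_nonneg) simp
  also have "\<dots> = (\<integral>x. (Dr x)\<^sup>2 + p x + 1 / 4 * Wl x \<partial>lborel)"
    by (simp add: p_def Wl_def power2_eq_square algebra_simps)
  also have "\<dots> = (\<integral>x. (Dr x)\<^sup>2 \<partial>lborel) + (\<integral>x. p x \<partial>lborel) + 1 / 4 * (\<integral>x. Wl x \<partial>lborel)"
    using ip integrable_Dr integrable_Wl by simp
  finally show ?thesis using e by linarith
qed

lemma hardy_log:
  assumes N2: "CARD('n) = 2"
  shows "5 / 4 * (\<integral>x. Wl x \<partial>lborel) \<le> (\<integral>x. (norm (D x))\<^sup>2 \<partial>lborel)"
proof -
  have "(\<integral>x. Wl x \<partial>lborel) \<le> (\<integral>x. W x \<partial>lborel)"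
  proof (rule integral_mono[OF integrable_Wl integrable_W])
    show "Wl x \<le> W x" for x
      using Wl_le[of x] by (cases "norm x < c") (auto simp: Wl_def W_def v0)
  qed
  then show ?thesis
    using angular radial_log[OF N2] N2 by simp
qed

end

section \<open>Smooth test functions\<close>

lemma has_derivative_grad:
  fixes u :: "real^'n \<Rightarrow> real"
  assumes "u differentiable (at x)"
  shows "(u has_derivative (\<lambda>h. grad u x \<bullet> h)) (at x)"
proof -
  have d: "(u has_derivative frechet_derivative u (at x)) (at x)"
    using assms by (simp add: frechet_derivative_works[symmetric])
  then have lin: "linear (frechet_derivative u (at x))"
    by (rule has_derivative_linear)
  have "frechet_derivative u (at x) h = grad u x \<bullet> h" for h
  proof -
    have "frechet_derivative u (at x) h = frechet_derivative u (at x) (\<Sum>i\<in>UNIV. h $ i *\<^sub>R axis i 1)"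
      using basis_expansion[of h] by (simp add: scalar_mult_eq_scaleR)
    also have "\<dots> = (\<Sum>i\<in>UNIV. h $ i * frechet_derivative u (at x) (axis i 1))"
      by (simp add: linear_sum[OF lin] linear_scale[OF lin])
    also have "\<dots> = grad u x \<bullet> h"
      by (simp add: grad_def inner_vec_def mult.commute)
    finally show ?thesis .
  qed
  then show ?thesis using d by (metis (no_types, lifting) ext)
qed

lemma grad_eqI:
  fixes u :: "real^'n \<Rightarrow> real"
  assumes "(u has_derivative (\<lambda>h. g \<bullet> h)) (at x)"
  shows "grad u x = g"
proof -
  have "(u has_derivative (\<lambda>h. grad u x \<bullet> h)) (at x)"
    using assms by (intro has_derivative_grad) (rule differentiableI)
  then have "(\<lambda>h. grad u x \<bullet> h) = (\<lambda>h. g \<bullet> h)"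
    using assms by (rule has_derivative_unique)
  then have "grad u x \<bullet> (grad u x - g) = g \<bullet> (grad u x - g)"
    by metis
  then have "(grad u x - g) \<bullet> (grad u x - g) = 0"
    by (simp add: inner_diff_left)
  then show ?thesis by simp
qed

lemma C1_function_smooth:
  fixes u :: "real^'n \<Rightarrow> real"
  assumes "smooth u"
  shows "C1_function u (grad u)"
proof
  have "C_k (Suc 0) u" using assms by (simp add: smooth_def)
  then have d: "\<And>x. u differentiable (at x)" and c: "\<And>w. continuous_on UNIV (\<lambda>x. frechet_derivative u (at x) w)"
    by simp_all
  show "(u has_derivative (\<lambda>h. grad u x \<bullet> h)) (at x)" for x
    by (rule has_derivative_grad[OF d])
  show "continuous_on UNIV (grad u)"
    unfolding grad_def[abs_def] by (intro continuous_on_vec_lambda c)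
qed

lemma compactly_supported_C1_mean_zero:
  fixes u :: "real^'n \<Rightarrow> real"
  assumes N: "2 \<le> CARD('n)" and u: "u \<in> mean_zero_test_functions"
  obtains c L where "compactly_supported_C1 u (grad u) c L"
proof -
  define K where "K = closure {x. u x \<noteq> 0}"
  have sm: "smooth u" and K: "compact K" "K \<subseteq> ball 0 1"
    and mean: "\<And>r. 0 \<le> r \<Longrightarrow> r < 1 \<Longrightarrow> (\<integral>\<omega>. u (r *\<^sub>R \<omega>) \<partial>surface_measure) = 0"
    using u by (auto simp: mean_zero_test_functions_def test_functions_def K_def)
  interpret C1_function u "grad u"
    using sm by (rule C1_function_smooth)
  \<comment> \<open>For nonempty support, \<open>c\<close> is the midpoint between the largest norm
    on the support and 1, which leaves strict room on both sides.\<close>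
  obtain c where c: "0 < c" "c < 1" "\<And>x. x \<in> K \<Longrightarrow> norm x < c"
  proof (cases "K = {}")
    case True
    then show ?thesis using that[of "1/2"] by simp
  next
    case False
    then obtain x where x: "x \<in> K" "\<And>y. y \<in> K \<Longrightarrow> norm y \<le> norm x"
      using continuous_attains_sup[OF K(1) False, of norm] by (auto intro: continuous_intros)
    have n: "norm x < 1" using x K by auto
    show ?thesis
    proof (rule that)
      show "0 < (1 + norm x) / 2" by (simp add: add_pos_nonneg)
      show "(1 + norm x) / 2 < 1" using n by simp
      show "norm y < (1 + norm x) / 2" if "y \<in> K" for y
        using x(2)[OF that] n by simp
    qed
  qed
  have u0: "u x = 0" if "x \<notin> K" for x
    using that closure_subset[of "{x. u x \<noteq> 0}"] by (auto simp: K_def)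
  have g0: "grad u x = 0" if x: "x \<notin> K" for x
  proof -
    have "((\<lambda>x. 0) has_derivative (\<lambda>h. 0 \<bullet> h)) (at x)" by simp
    then have "(u has_derivative (\<lambda>h. 0 \<bullet> h)) (at x)"
      by (rule has_derivative_transform_within_open[of _ _ x UNIV "- K"])
        (use K x u0 in \<open>auto intro: compact_imp_closed\<close>)
    then show ?thesis by (rule grad_eqI)
  qed
  have "bounded (grad u ` cball 0 1)"
    by (intro compact_imp_bounded compact_continuous_image cont_D' compact_cball)
  then obtain L where L: "\<forall>y\<in>grad u ` cball 0 1. norm y \<le> L"
    unfolding bounded_iff by blast
  then have L0: "0 \<le> L" using norm_ge_zero[of "grad u 0"] by (intro order_trans[OF norm_ge_zero[of "grad u 0"]]) auto
  have gL: "norm (grad u x) \<le> L" for x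
  proof (cases "x \<in> K")
    case True
    then show ?thesis using L K by auto
  next
    case False
    then show ?thesis using g0 L0 by simp
  qed
  \<comment> \<open>At radius 0 the mean condition says that \<open>u 0\<close> times the area of
    the sphere is 0.\<close>
  have "(\<integral>\<omega>. u 0 \<partial>(surface_measure :: (real^'n) measure)) = 0"
    using mean[of 0] by simp
  then have "u 0 = 0"
    using measure_surface_measure_sphere_pos[where 'a="real^'n"] by simp
  have uL: "\<bar>u x\<bar> \<le> L * norm x" for x
  proof -
    have "norm (u x - u 0) \<le> L * norm (x - 0)"
    proof (rule differentiable_bound[where S=UNIV and f'="\<lambda>x h. grad u x \<bullet> h"])
      show "onorm (\<lambda>h. grad u y \<bullet> h) \<le> L" for y
        by (rule onorm_bound[OF L0])
          (metis Cauchy_Schwarz_ineq2 gL mult_right_mono norm_ge_zero order_trans real_norm_def)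
    qed (auto intro: deriv)
    then show ?thesis using \<open>u 0 = 0\<close> by simp
  qed
  have "compactly_supported_C1 u (grad u) c L"
  proof
    show "u x = 0" "grad u x = 0" if "c \<le> norm x" for x
      using that c(3)[of x] u0 g0 by auto
  qed (use N c gL uL mean in auto)
  then show ?thesis by (rule that)
qed

text \<open>A coinductive form of infinite differentiability: \<open>h\<close> lies in some family
  closed under differentiation. Smoothness is then shown by exhibiting such a family, without
  formulas for higher derivatives.\<close>

definition smooth_real :: "(real \<Rightarrow> real) \<Rightarrow> bool" where
  "smooth_real h \<longleftrightarrow> (\<exists>S. h \<in> S \<and> (\<forall>f\<in>S. \<exists>f'\<in>S. \<forall>x. (f has_real_derivative f' x) (at x)))"

lemma smooth_real_deriv:
  assumes "smooth_real h"
  shows "\<exists>h'. smooth_real h' \<and> (\<forall>x. (h has_real_derivative h' x) (at x))"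
proof -
  obtain S where S: "h \<in> S" "\<forall>f\<in>S. \<exists>f'\<in>S. \<forall>x. (f has_real_derivative f' x) (at x)"
    using assms unfolding smooth_real_def by blast
  then obtain h' where h': "h' \<in> S" "\<forall>x. (h has_real_derivative h' x) (at x)"
    by blast
  then have "smooth_real h'"
    using S(2) unfolding smooth_real_def by blast
  then show ?thesis using h'(2) by blast
qed

text \<open>These generators suffice to build the test functions, and directional derivatives stay
  in the class. Membership therefore gives every \<open>C_k\<close> by induction on
  \<open>k\<close>.\<close>

inductive_set smooth_closure :: "('a::euclidean_space \<Rightarrow> real) set" where
  const: "(\<lambda>x. a) \<in> smooth_closure"
| inner: "(\<lambda>x. x \<bullet> w) \<in> smooth_closure"
| inner_self: "(\<lambda>x. x \<bullet> x) \<in> smooth_closure"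
| add: "f \<in> smooth_closure \<Longrightarrow> g \<in> smooth_closure \<Longrightarrow> (\<lambda>x. f x + g x) \<in> smooth_closure"
| mult: "f \<in> smooth_closure \<Longrightarrow> g \<in> smooth_closure \<Longrightarrow> (\<lambda>x. f x * g x) \<in> smooth_closure"
| compose: "smooth_real h \<Longrightarrow> f \<in> smooth_closure \<Longrightarrow> (\<lambda>x. h (f x)) \<in> smooth_closure"

definition directional_derivs :: "('a::euclidean_space \<Rightarrow> real) \<Rightarrow> ('a \<Rightarrow> 'a \<Rightarrow> real) \<Rightarrow> bool" where
  "directional_derivs f D \<longleftrightarrow> (\<forall>x. (f has_derivative D x) (at x)) \<and> (\<forall>w. (\<lambda>x. D x w) \<in> smooth_closure)"

lemma smooth_closure_has_derivative:
  fixes f :: "'a::euclidean_space \<Rightarrow> real"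
  shows "f \<in> smooth_closure \<Longrightarrow> \<exists>D. directional_derivs f D"
proof (induction rule: smooth_closure.induct)
  case (const a)
  have "directional_derivs (\<lambda>x::'a. a) (\<lambda>x h. 0)"
    by (simp add: directional_derivs_def smooth_closure.const)
  then show ?case by (intro exI)
next
  case (inner w)
  have "((\<lambda>x. x \<bullet> w) has_derivative (\<lambda>h. h \<bullet> w)) (at x)" for x :: 'a
    by (rule bounded_linear_imp_has_derivative[OF bounded_linear_inner_left])
  then have "directional_derivs (\<lambda>x. x \<bullet> w) (\<lambda>x h. h \<bullet> w)"
    by (simp add: directional_derivs_def smooth_closure.const)
  then show ?case by (intro exI)
next
  case inner_self
  have "directional_derivs (\<lambda>x::'a. x \<bullet> x) (\<lambda>x h. x \<bullet> h + h \<bullet> x :: real)"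
    unfolding directional_derivs_def
  proof (intro conjI allI)
    show "((\<lambda>x. x \<bullet> x) has_derivative (\<lambda>h. x \<bullet> h + h \<bullet> x)) (at x)" for x :: 'a
      by (rule has_derivative_inner[OF has_derivative_ident has_derivative_ident])
    show "(\<lambda>x. x \<bullet> w + w \<bullet> x) \<in> smooth_closure" for w :: 'a
      unfolding inner_commute[of w] by (intro smooth_closure.add smooth_closure.inner)
  qed
  then show ?case by (intro exI)
next
  case (add f g)
  from add.IH(1) obtain D where D: "directional_derivs f D" ..
  from add.IH(2) obtain E where E: "directional_derivs g E" ..
  have "directional_derivs (\<lambda>x. f x + g x) (\<lambda>x h. D x h + E x h)"
    using D E by (simp add: directional_derivs_def has_derivative_add smooth_closure.add)
  then show ?case by (intro exI)
next
  case (mult f g)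
  from mult.IH(1) obtain D where D: "directional_derivs f D" ..
  from mult.IH(2) obtain E where E: "directional_derivs g E" ..
  have "directional_derivs (\<lambda>x. f x * g x) (\<lambda>x h. f x * E x h + D x h * g x)"
    using D E mult.hyps
    by (simp add: directional_derivs_def has_derivative_mult smooth_closure.add smooth_closure.mult)
  then show ?case by (intro exI)
next
  case (compose h f)
  from compose.IH obtain D where D: "directional_derivs f D" ..
  obtain h' where h': "smooth_real h'" "\<forall>x. (h has_real_derivative h' x) (at x)"
    using smooth_real_deriv[OF compose.hyps(1)] by blast
  have "((\<lambda>x. h (f x)) has_derivative (\<lambda>w. h' (f x) * D x w)) (at x)" for x
    using has_derivative_compose[of f "D x" x UNIV h, OF _ h'(2)[rule_format, unfolded has_field_derivative_def]] D
    by (simp add: directional_derivs_def)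
  then have "directional_derivs (\<lambda>x. h (f x)) (\<lambda>x w. h' (f x) * D x w)"
    using D compose.hyps(2) h'(1)
    by (simp add: directional_derivs_def smooth_closure.mult smooth_closure.compose)
  then show ?case by (intro exI)
qed

lemma smooth_closure_C_k: "f \<in> smooth_closure \<Longrightarrow> C_k k f"
proof (induction k arbitrary: f)
  case 0
  then obtain D where "directional_derivs f D"
    using smooth_closure_has_derivative by blast
  then have "\<forall>x. (f has_derivative D x) (at x)"
    by (simp add: directional_derivs_def)
  then show ?case
    by (auto intro!: continuous_at_imp_continuous_on has_derivative_continuous)
next
  case (Suc k)
  then obtain D where "directional_derivs f D"
    using smooth_closure_has_derivative by blast
  then have D: "\<forall>x. (f has_derivative D x) (at x)" "\<forall>w. (\<lambda>x. D x w) \<in> smooth_closure"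
    by (simp_all add: directional_derivs_def)
  then have "frechet_derivative f (at x) = D x" for x
    by (simp add: frechet_derivative_at[symmetric])
  then show ?case
    using D Suc.IH by (auto simp: differentiable_def)
qed

lemma smooth_closure_smooth: "f \<in> smooth_closure \<Longrightarrow> smooth f"
  by (simp add: smooth_def smooth_closure_C_k)

section \<open>A flat cutoff function and its derivatives\<close>

text \<open>The polynomial factor makes this family of cutoffs closed under derivatives.\<close>

definition flat :: "real poly \<Rightarrow> real \<Rightarrow> real" where
  "flat p t = (if t \<le> 0 then 0 else poly p (1 / t) * exp (- (1 / t)))"

text \<open>With \<open>y = 1 / t\<close>, the derivative in \<open>t\<close> is
  \<open>- y^2\<close> times the one in \<open>y\<close>, and \<open>p(y) exp(-y)\<close> has
  \<open>y\<close>-derivative \<open>(p' - p) exp(-y)\<close>. The polynomial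
  \<open>[:0, 0, 1:]\<close> is \<open>y^2\<close>.\<close>

definition flat_deriv :: "real poly \<Rightarrow> real poly" where
  "flat_deriv p = [:0, 0, 1:] * (p - pderiv p)"

lemma poly_exp_tendsto_0: "((\<lambda>y. poly q y * exp (- y)) \<longlongrightarrow> (0::real)) at_top"
proof -
  have "((\<lambda>y. \<Sum>i\<le>degree q. coeff q i * (y ^ i / exp y)) \<longlongrightarrow> (\<Sum>i\<le>degree q. coeff q i * 0)) at_top"
    by (intro tendsto_intros tendsto_power_div_exp_0)
  then show ?thesis
    by (simp add: poly_altdef sum_distrib_right exp_minus divide_inverse mult.assoc)
qed

lemma flat_has_derivative: "(flat p has_real_derivative flat (flat_deriv p) t) (at t)"
proof (cases "t = 0")
  case False
  show ?thesis
  proof (cases "t < 0")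
    case True
    have "((\<lambda>t. 0) has_real_derivative 0) (at t)" by simp
    then have "(flat p has_real_derivative 0) (at t)"
      by (rule has_field_derivative_transform_within_open[where S="{..<0}"]) (use True in \<open>auto simp: flat_def\<close>)
    then show ?thesis using True by (simp add: flat_def)
  next
    case nt: False
    with False have t: "0 < t" by simp
    have "((\<lambda>t. poly p (1 / t) * exp (- (1 / t))) has_real_derivative
        (poly (pderiv p) (1 / t) * (- 1 / (t * t))) * exp (- (1 / t)) + (exp (- (1 / t)) * (1 / (t * t))) * poly p (1 / t)) (at t)"
    proof (rule DERIV_mult)
      have "((\<lambda>t. 1 / t) has_real_derivative - 1 / (t * t)) (at t)"
        using t by (auto intro!: derivative_eq_intros)
      from DERIV_chain2[OF poly_DERIV this]
      show "((\<lambda>t. poly p (1 / t)) has_real_derivative poly (pderiv p) (1 / t) * (- 1 / (t * t))) (at t)" .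
      show "((\<lambda>t. exp (- (1 / t))) has_real_derivative exp (- (1 / t)) * (1 / (t * t))) (at t)"
        using t by (auto intro!: derivative_eq_intros)
    qed
    moreover have "(poly (pderiv p) (1 / t) * (- 1 / (t * t))) * exp (- (1 / t)) + (exp (- (1 / t)) * (1 / (t * t))) * poly p (1 / t)
        = flat (flat_deriv p) t"
      using t by (simp add: flat_def flat_deriv_def field_simps)
    ultimately have "((\<lambda>t. poly p (1 / t) * exp (- (1 / t))) has_real_derivative flat (flat_deriv p) t) (at t)"
      by simp
    then show ?thesis
      by (rule has_field_derivative_transform_within_open[where S="{0<..}"]) (use t in \<open>auto simp: flat_def\<close>)
  qed
next
  case True
  have r: "((\<lambda>h. flat p h / h) \<longlongrightarrow> 0) (at_right 0)"
  proof -
    \<comment> \<open>The difference quotient at 0 multiplies by \<open>1 / h\<close>, which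
      replaces \<open>p\<close> by \<open>pCons 0 p\<close> and so stays within the family.\<close>
    have "((\<lambda>y. poly (pCons 0 p) y * exp (- y)) \<longlongrightarrow> 0) at_top"
      by (rule poly_exp_tendsto_0)
    then have "((\<lambda>h. poly (pCons 0 p) (inverse h) * exp (- inverse h)) \<longlongrightarrow> 0) (at_right 0)"
      by (rule filterlim_compose) (rule filterlim_inverse_at_top_right)
    then show ?thesis
      by (rule Lim_transform_eventually)
        (auto simp: flat_def eventually_at_right_field divide_inverse intro!: exI[of _ 1])
  qed
  have l: "((\<lambda>h. flat p h / h) \<longlongrightarrow> 0) (at_left 0)"
    by (rule Lim_transform_eventually[OF tendsto_const])
      (auto simp: flat_def eventually_at_left_field intro!: exI[of _ "-1"])
  have "((\<lambda>h. flat p h / h) \<longlongrightarrow> 0) (at 0)"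
    using l r by (simp add: filterlim_at_split)
  then show ?thesis
    using True by (simp add: has_field_derivative_iff flat_def)
qed

lemma isCont_flat: "isCont (flat p) t"
  by (rule DERIV_isCont[OF flat_has_derivative])

lemma continuous_on_flat [continuous_intros]:
  assumes "continuous_on S f"
  shows "continuous_on S (\<lambda>x. flat p (f x))"
  by (rule continuous_on_compose2[OF _ assms subset_UNIV])
    (auto intro!: continuous_at_imp_continuous_on isCont_flat)

section \<open>Optimality\<close>

text \<open>Applied to \<open>\<Phi> (ln |x| / R) / |x|^N\<close>, which is homogeneous of degree \<open>-N\<close> up to the
  logarithmic factor, Euler's identity leaves only the derivative of \<open>\<Phi>\<close>.\<close>

lemma
  fixes k :: "real \<Rightarrow> real"
  assumes k: "continuous_on UNIV k" "\<And>t. t \<le> -2 \<or> -1 \<le> t \<Longrightarrow> k t = 0" and R: "0 < R"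
  shows log_radial_bound: "\<exists>K. \<forall>x::'a::euclidean_space. \<bar>k (ln (norm x) / R) / norm x ^ DIM('a)\<bar> \<le> K"
    and log_radial_zero: "exp (- R) \<le> norm (x::'a) \<Longrightarrow> k (ln (norm x) / R) = 0"
    and log_radial_measurable: "(\<lambda>x::'a. k (ln (norm x) / R) / norm x ^ DIM('a)) \<in> borel_measurable borel"
    and log_radial_integrable: "integrable lborel (\<lambda>x::'a. k (ln (norm x) / R) / norm x ^ DIM('a))"
proof -
  have [measurable]: "k \<in> borel_measurable borel"
    using k(1) by (rule borel_measurable_continuous_onI)
  have "compact (k ` {-2..-1})"
    by (rule compact_continuous_image[OF continuous_on_subset[OF k(1) subset_UNIV]]) simp
  then have "bounded (k ` {-2..-1})"
    by (rule compact_imp_bounded)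
  then obtain M where M: "\<forall>y\<in>k ` {-2..-1}. norm y \<le> M"
    unfolding bounded_iff by blast
  have M0: "0 \<le> M"
    using M by (intro order_trans[OF norm_ge_zero[of "k (-1)"]]) auto
  have kM: "\<bar>k t\<bar> \<le> M" for t
  proof (cases "t \<le> -2 \<or> -1 \<le> t")
    case True
    then show ?thesis using k(2) M0 by simp
  next
    case False
    then show ?thesis using M by auto
  qed
  \<comment> \<open>The function lives in the shell where \<open>norm x\<close> is between
    \<open>exp (- 2 * R)\<close> and \<open>exp (- R)\<close>, which bounds the denominator from
    below. At the origin the quotient is 0 by the convention for division by zero.\<close>
  have bound: "\<bar>k (ln (norm x) / R) / norm x ^ DIM('a)\<bar> \<le> M / exp (-2 * R) ^ DIM('a)" for x :: 'a
  proof (cases "x = 0 \<or> ln (norm x) / R \<le> -2")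
    case True
    then show ?thesis using k(2) M0 by (auto intro!: divide_nonneg_nonneg)
  next
    case False
    then have x: "0 < norm x" by simp
    have "-2 * R \<le> ln (norm x)" using False R by (simp add: not_le field_simps)
    then have "exp (-2 * R) \<le> norm x"
      using x by (metis exp_le_cancel_iff exp_ln)
    then have "exp (-2 * R) ^ DIM('a) \<le> norm x ^ DIM('a)"
      by (intro power_mono) auto
    then show ?thesis
      using kM[of "ln (norm x) / R"] M0 x unfolding abs_divide by (intro frac_le) auto
  qed
  then show "\<exists>K. \<forall>x::'a. \<bar>k (ln (norm x) / R) / norm x ^ DIM('a)\<bar> \<le> K"
    by blast
  have z: "k (ln (norm x) / R) = 0" if "exp (- R) \<le> norm x" for x :: 'a
  proof -
    have "0 < norm x" using that exp_gt_zero[of "- R"] by linarith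
    then have "- R \<le> ln (norm x)" using that by (metis ln_exp ln_le_cancel_iff exp_gt_zero)
    then have "-1 \<le> ln (norm x) / R" using R by (simp add: field_simps)
    then show ?thesis by (intro k(2)) simp
  qed
  then show "exp (- R) \<le> norm (x::'a) \<Longrightarrow> k (ln (norm x) / R) = 0" .
  show m: "(\<lambda>x::'a. k (ln (norm x) / R) / norm x ^ DIM('a)) \<in> borel_measurable borel"
    by measurable
  show "integrable lborel (\<lambda>x::'a. k (ln (norm x) / R) / norm x ^ DIM('a))"
    by (rule integrableI_bounded_set[where A="ball 0 (exp (- R))" and B="M / exp (-2 * R) ^ DIM('a)"])
      (use m bound z in \<open>auto simp: emeasure_ball not_less intro!: AE_I2\<close>)
qed

text \<open>In the variable \<open>t = ln |x| / R\<close> the measure \<open>dx / |x|^N\<close> is a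
  constant multiple of \<open>dt\<close> times the surface measure. The claim is thus the vanishing
  of the integral of \<open>\<Phi>'\<close> over the line.\<close>

lemma integral_log_radial_deriv:
  fixes \<Phi> \<Phi>' :: "real \<Rightarrow> real"
  assumes d: "\<And>t. (\<Phi> has_real_derivative \<Phi>' t) (at t)" and c': "continuous_on UNIV \<Phi>'"
    and z: "\<And>t. t \<le> -2 \<or> -1 \<le> t \<Longrightarrow> \<Phi> t = 0" "\<And>t. t \<le> -2 \<or> -1 \<le> t \<Longrightarrow> \<Phi>' t = 0" and R: "0 < R"
  shows "(\<integral>x. \<Phi>' (ln (norm x) / R) / norm (x :: 'a::euclidean_space) ^ DIM('a) \<partial>lborel) = 0"
proof -
  let ?n = "DIM('a)"
  have c: "continuous_on UNIV \<Phi>"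
    using d by (auto intro!: DERIV_isCont continuous_at_imp_continuous_on)
  define f g where "f x = \<Phi> (ln (norm x) / R) / norm x ^ ?n" and "g x = \<Phi>' (ln (norm x) / R) / norm x ^ ?n" for x :: 'a
  define f' where "f' x = g x / R - ?n * f x" for x
  have mf [measurable]: "f \<in> borel_measurable borel" "g \<in> borel_measurable borel"
    unfolding f_def g_def by (rule log_radial_measurable[OF c z(1) R], simp, rule log_radial_measurable[OF c' z(2) R], simp)
  have i: "integrable lborel f" "integrable lborel g"
    unfolding f_def g_def by (rule log_radial_integrable[OF c z(1) R], simp, rule log_radial_integrable[OF c' z(2) R], simp)
  obtain K1 where K1: "\<And>x. \<bar>f x\<bar> \<le> K1"
    using log_radial_bound[OF c z(1) R, where 'a='a] unfolding f_def by blast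
  obtain K2 where K2: "\<And>x. \<bar>g x\<bar> \<le> K2"
    using log_radial_bound[OF c' z(2) R, where 'a='a] unfolding g_def by blast
  have "(\<integral>x. f' x \<partial>lborel) = - ?n * (\<integral>x. f x \<partial>lborel)"
  proof (rule integral_euler(3)[where K="max K1 (K2 / R + ?n * K1)" and c="exp (- R)"])
    show "\<bar>f x\<bar> \<le> max K1 (K2 / R + ?n * K1)" for x
      using K1[of x] by (simp add: le_max_iff_disj)
    have "\<bar>f' x\<bar> \<le> K2 / R + ?n * K1" for x
      unfolding f'_def using K1[of x] K2[of x] R
      by (intro order_trans[OF abs_triangle_ineq4] add_mono) (auto simp: abs_mult intro!: divide_right_mono mult_left_mono)
    then show "\<bar>f' x\<bar> \<le> max K1 (K2 / R + ?n * K1)" for x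
      by (simp add: le_max_iff_disj)
    show "f x = 0" "f' x = 0" if "exp (- R) \<le> norm x" for x
      using log_radial_zero[OF c z(1) R that] log_radial_zero[OF c' z(2) R that]
      by (simp_all add: f'_def f_def g_def)
    fix r :: real and \<omega> :: 'a assume a: "norm \<omega> = 1" "0 < r" "r < 1"
    have n: "r ^ ?n = r * r ^ (?n - 1)"
      using DIM_positive[where 'a='a] by (cases ?n) auto
    have d1: "((\<lambda>r. \<Phi> (ln r / R)) has_real_derivative \<Phi>' (ln r / R) * (1 / r / R)) (at r)"
      by (rule DERIV_chain2[where f=\<Phi>, OF d]) (use a R in \<open>auto intro!: derivative_eq_intros\<close>)
    have d2: "((\<lambda>r. 1 / r ^ ?n) has_real_derivative - (?n / (r * r ^ ?n))) (at r)"
      using a by (auto intro!: derivative_eq_intros simp: n field_simps)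
    have "((\<lambda>r. \<Phi> (ln r / R) * (1 / r ^ ?n)) has_real_derivative
        \<Phi>' (ln r / R) * (1 / r / R) * (1 / r ^ ?n) + - (?n / (r * r ^ ?n)) * \<Phi> (ln r / R)) (at r)"
      by (rule DERIV_mult[OF d1 d2])
    moreover have "\<Phi>' (ln r / R) * (1 / r / R) * (1 / r ^ ?n) + - (?n / (r * r ^ ?n)) * \<Phi> (ln r / R) = f' (r *\<^sub>R \<omega>) / r"
      using a R by (simp add: f'_def f_def g_def field_simps)
    ultimately have "((\<lambda>r. \<Phi> (ln r / R) * (1 / r ^ ?n)) has_real_derivative f' (r *\<^sub>R \<omega>) / r) (at r)"
      by simp
    then show "((\<lambda>r. f (r *\<^sub>R \<omega>)) has_real_derivative f' (r *\<^sub>R \<omega>) / r) (at r)"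
      by (rule has_field_derivative_transform_within_open[where S="{0<..}"]) (use a in \<open>auto simp: f_def\<close>)
  qed (use R in \<open>auto simp: f'_def[abs_def]\<close>)
  then have "(\<integral>x. g x \<partial>lborel) / R = 0"
    using i by (simp add: f'_def)
  then show ?thesis
    using R by (simp add: g_def)
qed

text \<open>The ratio of the two angular integrals does not depend on the radial profile. It is
  determined from one profile, \<open>r\<^sup>2\<close> on the unit ball, for which
  \<open>integral_ball_inner_square\<close> gives \<open>1 / N\<close>.\<close>

lemma integral_inner_square_radial:
  fixes e :: "real^'n" and k :: "real \<Rightarrow> real"
  assumes e: "norm e = 1" and [measurable]: "k \<in> borel_measurable borel"
    and i: "integrable lborel (\<lambda>x::real^'n. k (norm x))"
  shows "integrable lborel (\<lambda>x. (sgn x \<bullet> e)\<^sup>2 * k (norm x))"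
    and "(\<integral>x. (sgn x \<bullet> e)\<^sup>2 * k (norm x) \<partial>lborel) = (\<integral>x. k (norm (x :: real^'n)) \<partial>lborel) / CARD('n)"
proof -
  show i': "integrable lborel (\<lambda>x. (sgn x \<bullet> e)\<^sup>2 * k (norm x))"
  proof (rule Bochner_Integration.integrable_bound[OF i])
    show "AE x in lborel. norm ((sgn x \<bullet> e)\<^sup>2 * k (norm x)) \<le> norm (k (norm x))"
    proof (intro AE_I2)
      fix x :: "real^'n"
      have "\<bar>sgn x \<bullet> e\<bar> \<le> 1"
        using Cauchy_Schwarz_ineq2[of "sgn x" e] e by (auto simp: norm_sgn split: if_splits)
      then have "(sgn x \<bullet> e)\<^sup>2 \<le> 1"
        by (simp add: abs_square_le_1)
      then show "norm ((sgn x \<bullet> e)\<^sup>2 * k (norm x)) \<le> norm (k (norm x))"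
        by (simp add: abs_mult mult_left_le_one_le)
    qed
  qed measurable
  define S0 A where "S0 = (\<integral>\<omega>. (1::real) \<partial>(surface_measure :: (real^'n) measure))"
    and "A = (\<integral>\<omega>. (\<omega> \<bullet> e)\<^sup>2 \<partial>(surface_measure :: (real^'n) measure))"
  have eqA: "(\<integral>x. (sgn x \<bullet> e)\<^sup>2 * k (norm x) \<partial>lborel) = A * (\<integral>r. k r \<partial>radial_measure DIM(real^'n))"
    if "k \<in> borel_measurable borel" "integrable lborel (\<lambda>x. (sgn x \<bullet> e)\<^sup>2 * k (norm x))" for k
    unfolding A_def using that by (intro integral_sgn_mult_norm[where h="\<lambda>\<omega>. (\<omega> \<bullet> e)\<^sup>2"]) auto
  have eqS: "(\<integral>x. k (norm (x :: real^'n)) \<partial>lborel) = S0 * (\<integral>r. k r \<partial>radial_measure DIM(real^'n))"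
    if "k \<in> borel_measurable borel" "integrable lborel (\<lambda>x :: real^'n. k (norm x))" for k
    using integral_sgn_mult_norm[where h="\<lambda>\<omega>::real^'n. 1" and k=k] that by (simp add: S0_def)
  define q where "q r = of_bool (r < 1) * r\<^sup>2" for r :: real
  have [measurable]: "q \<in> borel_measurable borel"
    unfolding q_def by measurable
  have q1: "(sgn x \<bullet> e)\<^sup>2 * q (norm x) = indicator (ball 0 1) x * (e \<bullet> x)\<^sup>2" for x
    by (cases "x = 0") (simp_all add: q_def indicator_def sgn_div_norm inner_commute power_inverse power_mult_distrib)
  have q2: "q (norm x) = indicator (ball 0 1) x * (norm x)\<^sup>2" for x :: "real^'n"
    by (simp add: q_def indicator_def)
  have iq2: "integrable lborel (\<lambda>x::real^'n. q (norm x))"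
    unfolding q2 by (rule integrable_ball[where K=1]) (simp_all add: power_le_one)
  have iq1: "integrable lborel (\<lambda>x. (sgn x \<bullet> e)\<^sup>2 * q (norm x))"
    unfolding q1
  proof (rule integrable_ball[where K=1])
    show "\<bar>(e \<bullet> y)\<^sup>2\<bar> \<le> 1" if "norm y < 1" for y
      using Cauchy_Schwarz_ineq2[of e y] e that by (simp add: abs_square_le_1)
  qed measurable
  have pos: "0 < (\<integral>x. q (norm (x :: real^'n)) \<partial>lborel)"
    using ball_integral_norm_pos[where 'a="real^'n"] by (simp add: q2 ball_integral_def)
  have "CARD('n) * (\<integral>x. (sgn x \<bullet> e)\<^sup>2 * q (norm x) \<partial>lborel) = (\<integral>x. q (norm (x :: real^'n)) \<partial>lborel)"
    unfolding q1 unfolding q2 using integral_ball_inner_square[of 1 e] e by simp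
  then have "CARD('n) * A = S0"
    using pos unfolding eqA[OF \<open>q \<in> _\<close> iq1] eqS[OF \<open>q \<in> _\<close> iq2] by auto
  then show "(\<integral>x. (sgn x \<bullet> e)\<^sup>2 * k (norm x) \<partial>lborel) = (\<integral>x. k (norm (x :: real^'n)) \<partial>lborel) / CARD('n)"
    unfolding eqA[OF assms(2) i'] eqS[OF assms(2) i] by (simp add: field_simps flip: \<open>CARD('n) * A = S0\<close>)
qed

text \<open>Two polynomials are carried along because the product rule differentiates either factor
  separately. The support lies in \<open>[-2, -1]\<close>, left of 0, so that
  \<open>ln |x| / R\<close> in this range keeps \<open>x\<close> inside the unit ball for every
  positive \<open>R\<close>.\<close>

definition bump :: "real poly \<Rightarrow> real poly \<Rightarrow> real \<Rightarrow> real" where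
  "bump p q t = flat p (t + 2) * flat q (- 1 - t)"

lemma bump_eq_0: "t \<le> -2 \<or> -1 \<le> t \<Longrightarrow> bump p q t = 0"
  by (auto simp: bump_def flat_def)

lemma bump_has_derivative:
  "(bump p q has_real_derivative bump (flat_deriv p) q t - bump p (flat_deriv q) t) (at t)"
proof -
  have "((\<lambda>t. flat p (t + 2)) has_real_derivative flat (flat_deriv p) (t + 2) * 1) (at t)"
    by (rule DERIV_chain2[where f="flat p", OF flat_has_derivative]) (auto intro!: derivative_eq_intros)
  moreover have "((\<lambda>t. flat q (- 1 - t)) has_real_derivative flat (flat_deriv q) (- 1 - t) * (- 1)) (at t)"
    by (rule DERIV_chain2[where f="flat q", OF flat_has_derivative]) (auto intro!: derivative_eq_intros)
  ultimately have "((\<lambda>t. flat p (t + 2) * flat q (- 1 - t)) has_real_derivative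
      flat (flat_deriv p) (t + 2) * 1 * flat q (- 1 - t) + flat (flat_deriv q) (- 1 - t) * (- 1) * flat p (t + 2)) (at t)"
    by (rule DERIV_mult)
  then show ?thesis
    by (simp add: bump_def[abs_def] mult.commute)
qed

lemma continuous_on_bump: "continuous_on S (bump p q)"
  unfolding bump_def[abs_def] by (intro continuous_intros)

text \<open>The argument is meant to be \<open>s = x \<bullet> x\<close>, which is smooth at the
  origin, unlike the norm. This is why the logarithm is divided by \<open>2 * R\<close>, and why an
  exponent \<open>a\<close> stands for the power \<open>2 * a\<close> of the norm.\<close>

definition log_bump :: "real \<Rightarrow> real \<Rightarrow> real poly \<Rightarrow> real poly \<Rightarrow> real \<Rightarrow> real" where
  "log_bump R a p q s = (if s \<le> 0 then 0 else s powr a * bump p q (ln s / (2 * R)))"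

lemma log_bump_has_derivative:
  assumes R: "0 < R"
  shows "(log_bump R a p q has_real_derivative
    a * log_bump R (a - 1) p q s + 1 / (2 * R) * log_bump R (a - 1) (flat_deriv p) q s
      + (- 1 / (2 * R)) * log_bump R (a - 1) p (flat_deriv q) s) (at s)"
proof (cases "0 < s")
  case True
  have d: "((\<lambda>s. bump p q (ln s / (2 * R))) has_real_derivative
      (bump (flat_deriv p) q (ln s / (2 * R)) - bump p (flat_deriv q) (ln s / (2 * R))) * (1 / s / (2 * R))) (at s)"
    by (rule DERIV_chain2[where f="bump p q", OF bump_has_derivative])
      (use True R in \<open>auto intro!: derivative_eq_intros\<close>)
  have "((\<lambda>s. s powr a * bump p q (ln s / (2 * R))) has_real_derivative
      (a * s powr (a - 1)) * bump p q (ln s / (2 * R)) +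
      ((bump (flat_deriv p) q (ln s / (2 * R)) - bump p (flat_deriv q) (ln s / (2 * R))) * (1 / s / (2 * R))) * s powr a) (at s)"
    by (rule DERIV_mult[OF has_real_derivative_powr[OF True] d])
  moreover have "(a * s powr (a - 1)) * bump p q (ln s / (2 * R)) +
      ((bump (flat_deriv p) q (ln s / (2 * R)) - bump p (flat_deriv q) (ln s / (2 * R))) * (1 / s / (2 * R))) * s powr a =
    a * log_bump R (a - 1) p q s + 1 / (2 * R) * log_bump R (a - 1) (flat_deriv p) q s
      + (- 1 / (2 * R)) * log_bump R (a - 1) p (flat_deriv q) s"
    using True R by (simp add: log_bump_def powr_diff field_simps)
  ultimately have "((\<lambda>s. s powr a * bump p q (ln s / (2 * R))) has_real_derivative
     a * log_bump R (a - 1) p q s + 1 / (2 * R) * log_bump R (a - 1) (flat_deriv p) q s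
      + (- 1 / (2 * R)) * log_bump R (a - 1) p (flat_deriv q) s) (at s)"
    by simp
  then show ?thesis
    by (rule has_field_derivative_transform_within_open[where S="{0<..}"]) (use True in \<open>auto simp: log_bump_def\<close>)
next
  case False
  \<comment> \<open>Below \<open>exp (- 4 * R)\<close> the rescaled logarithm is less than -2, the
    left end of the support of \<open>bump\<close>. Hence the function vanishes on a whole
    neighbourhood of the nonpositive axis.\<close>
  have z: "log_bump R a p q t = 0" if "t < exp (- 4 * R)" for t
  proof (cases "0 < t")
    case True
    then have "ln t < - 4 * R"
      using that by (metis exp_gt_zero ln_exp ln_less_cancel_iff)
    then have "ln t / (2 * R) \<le> -2"
      using R by (simp add: field_simps)
    then show ?thesis by (simp add: log_bump_def bump_eq_0)
  qed (simp add: log_bump_def)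
  have "((\<lambda>s. 0) has_real_derivative 0) (at s)" by simp
  then have "(log_bump R a p q has_real_derivative 0) (at s)"
    by (rule has_field_derivative_transform_within_open[where S="{..<exp (- 4 * R)}"])
      (use False z in \<open>auto intro: le_less_trans[of s 0]\<close>)
  then show ?thesis
    using False by (simp add: log_bump_def)
qed

text \<open>The derivative of a \<open>log_bump\<close> is a linear combination of others with
  exponent \<open>a - 1\<close>, so their span is a family as required by
  \<open>smooth_real\<close>.\<close>

inductive_set log_bumps :: "real \<Rightarrow> (real \<Rightarrow> real) set" for R where
  base: "log_bump R a p q \<in> log_bumps R"
| add: "f \<in> log_bumps R \<Longrightarrow> g \<in> log_bumps R \<Longrightarrow> (\<lambda>s. f s + g s) \<in> log_bumps R"
| cmult: "f \<in> log_bumps R \<Longrightarrow> (\<lambda>s. b * f s) \<in> log_bumps R"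

lemma log_bumps_deriv:
  assumes R: "0 < R"
  shows "f \<in> log_bumps R \<Longrightarrow> \<exists>f'\<in>log_bumps R. \<forall>s. (f has_real_derivative f' s) (at s)"
proof (induction rule: log_bumps.induct)
  case (base a p q)
  have "(\<lambda>s. a * log_bump R (a - 1) p q s + 1 / (2 * R) * log_bump R (a - 1) (flat_deriv p) q s
      + (- 1 / (2 * R)) * log_bump R (a - 1) p (flat_deriv q) s) \<in> log_bumps R"
    by (intro log_bumps.intros)
  then show ?case
    using log_bump_has_derivative[OF R] by (intro bexI allI)
next
  case (add f g)
  from add.IH(1) obtain f' where f': "f' \<in> log_bumps R" "\<forall>s. (f has_real_derivative f' s) (at s)" by blast
  from add.IH(2) obtain g' where g': "g' \<in> log_bumps R" "\<forall>s. (g has_real_derivative g' s) (at s)" by blast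
  have "(\<lambda>s. f' s + g' s) \<in> log_bumps R"
    using f' g' by (intro log_bumps.add)
  moreover have "\<forall>s. ((\<lambda>s. f s + g s) has_real_derivative f' s + g' s) (at s)"
    using f' g' by (simp add: DERIV_add)
  ultimately show ?case by (intro bexI[where x="\<lambda>s. f' s + g' s"])
next
  case (cmult f b)
  from cmult.IH obtain f' where f': "f' \<in> log_bumps R" "\<forall>s. (f has_real_derivative f' s) (at s)" by blast
  have "(\<lambda>s. b * f' s) \<in> log_bumps R"
    using f' by (intro log_bumps.cmult)
  moreover have "\<forall>s. ((\<lambda>s. b * f s) has_real_derivative b * f' s) (at s)"
    using f' by (simp add: DERIV_cmult)
  ultimately show ?case by (intro bexI[where x="\<lambda>s. b * f' s"])
qed

lemma smooth_real_log_bump: "0 < R \<Longrightarrow> smooth_real (log_bump R a p q)"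
  unfolding smooth_real_def by (intro exI[of _ "log_bumps R"] conjI ballI log_bumps.base log_bumps_deriv)

section \<open>Almost extremal test functions\<close>

definition chi :: "real \<Rightarrow> real" where
  "chi = bump 1 1"

definition chi' :: "real \<Rightarrow> real" where
  "chi' t = bump (flat_deriv 1) 1 t - bump 1 (flat_deriv 1) t"

lemma chi_has_derivative: "(chi has_real_derivative chi' t) (at t)"
  unfolding chi_def chi'_def by (rule bump_has_derivative)

lemma continuous_on_chi: "continuous_on S chi" "continuous_on S chi'"
  unfolding chi_def chi'_def by (intro continuous_intros continuous_on_bump)+

lemma chi_eq_0: "t \<le> -2 \<or> -1 \<le> t \<Longrightarrow> chi t = 0" "t \<le> -2 \<or> -1 \<le> t \<Longrightarrow> chi' t = 0"
  by (simp_all add: chi_def chi'_def bump_eq_0)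

lemma chi_nonzero: "chi (- (3 / 2)) \<noteq> 0"
  by (simp add: chi_def bump_def flat_def)

text \<open>The mean-zero functions \<open>x\<^sub>1 |x|^(-N/2) \<chi> (ln |x| / R)\<close> almost attain equality for large \<open>R\<close>.\<close>

definition test_fun :: "real \<Rightarrow> real^'n \<Rightarrow> real^'n \<Rightarrow> real" where
  "test_fun R e x = (x \<bullet> e) * log_bump R (- (real CARD('n) / 4)) 1 1 (x \<bullet> x)"

lemma ln_inner_self:
  fixes x :: "real^'n"
  shows "x \<noteq> 0 \<Longrightarrow> ln (x \<bullet> x) / (2 * R) = ln (norm x) / R"
  by (simp add: ln_realpow flip: power2_norm_eq_inner)

lemma test_fun_nonzero_norm:
  assumes R: "0 < R" and "test_fun R e x \<noteq> 0"
  shows "norm x \<le> exp (- R)"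
proof (rule ccontr)
  assume n: "\<not> norm x \<le> exp (- R)"
  then have x: "x \<noteq> 0" by auto
  have "- R \<le> ln (norm x)"
    using n x by (metis exp_gt_zero ln_exp ln_le_cancel_iff not_le less_imp_le zero_less_norm_iff)
  then have "-1 \<le> ln (norm x) / R" using R by (simp add: field_simps)
  then have "bump 1 1 (ln (x \<bullet> x) / (2 * R)) = 0"
    unfolding ln_inner_self[OF x] by (intro bump_eq_0) simp
  then show False using assms(2) by (simp add: test_fun_def log_bump_def split: if_splits)
qed

lemma test_fun_mean_zero:
  fixes e :: "real^'n"
  assumes R: "0 < R"
  shows "test_fun R e \<in> mean_zero_test_functions"
proof -
  have sc: "test_fun R e \<in> smooth_closure"
    unfolding test_fun_def[abs_def]
    by (intro smooth_closure.mult smooth_closure.inner smooth_closure.compose[OF smooth_real_log_bump[OF R]] smooth_closure.inner_self)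
  then have sm: "smooth (test_fun R e)"
    by (rule smooth_closure_smooth)
  have sub: "closure {x. test_fun R e x \<noteq> 0} \<subseteq> cball 0 (exp (- R))"
    using test_fun_nonzero_norm[OF R] by (intro closure_minimal) auto
  have b: "exp (- R) < 1" using R by simp
  have "compact (closure {x. test_fun R e x \<noteq> 0})"
    using sub by (meson bounded_cball bounded_subset closed_closure compact_eq_bounded_closed)
  moreover have "closure {x. test_fun R e x \<noteq> 0} \<subseteq> ball 0 1"
  proof
    fix x assume "x \<in> closure {x. test_fun R e x \<noteq> 0}"
    then have "norm x \<le> exp (- R)" using sub by auto
    with b have "norm x < 1" by linarith
    then show "x \<in> ball 0 1" by simp
  qed
  moreover have "(\<integral>\<omega>. test_fun R e (r *\<^sub>R \<omega>) \<partial>surface_measure) = 0" for r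
  proof -
    interpret C1_function "test_fun R e" "grad (test_fun R e)"
      using sm by (rule C1_function_smooth)
    \<comment> \<open>The test function is odd, so is its extension along \<open>sgn\<close>;
      reflecting the ball integral that defines the surface integral shows that it vanishes.\<close>
    define G where "G x = indicator (ball 0 1) x * test_fun R e (r *\<^sub>R sgn x)" for x :: "real^'n"
    have [measurable]: "(\<lambda>x. test_fun R e (r *\<^sub>R x)) \<in> borel_measurable borel"
      by measurable
    have "G \<in> borel_measurable borel"
      unfolding G_def by (intro borel_measurable_times borel_measurable_indicator) (simp, measurable)
    moreover have "G (- x) = - G x" for x
      by (simp add: G_def test_fun_def indicator_def sgn_minus)
    ultimately have "(\<integral>x. G x \<partial>lborel) = 0"
      using integral_lborel_uminus[of G] by simp
    then show ?thesis
      by (subst integral_surface_measure) (simp_all add: G_def)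
  qed
  ultimately show ?thesis
    using sm by (simp add: mean_zero_test_functions_def test_functions_def)
qed

lemma test_fun_nonzero:
  fixes e :: "real^'n"
  assumes R: "0 < R" and e: "norm e = 1"
  shows "test_fun R e \<noteq> (\<lambda>x. 0)"
proof
  \<comment> \<open>The witness has \<open>ln |x| / R = - 3 / 2\<close>, the midpoint of the support
    of \<open>chi\<close>, and is parallel to \<open>e\<close>.\<close>
  define x where "x = exp (- (3 / 2) * R) *\<^sub>R e"
  assume "test_fun R e = (\<lambda>x. 0)"
  then have z: "test_fun R e x = 0" by simp
  have x: "x \<noteq> 0" "norm x = exp (- (3 / 2) * R)" using e by (auto simp: x_def)
  have "e \<bullet> e = 1" using e by (simp flip: power2_norm_eq_inner)
  then have "x \<bullet> e \<noteq> 0" by (simp add: x_def)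
  moreover have "log_bump R (- (real CARD('n) / 4)) 1 1 (x \<bullet> x) \<noteq> 0"
  proof -
    have "ln (x \<bullet> x) / (2 * R) = - (3 / 2)"
      unfolding ln_inner_self[OF x(1)] using x R by simp
    then show ?thesis
      using x chi_nonzero inner_gt_zero_iff[of x] by (simp add: log_bump_def chi_def not_le del: inner_gt_zero_iff)
  qed
  ultimately show False using z by (simp add: test_fun_def)
qed

text \<open>Here \<open>m\<close> is the quotient of the integrals of \<open>chi'\<^sup>2\<close>
  and \<open>chi\<^sup>2\<close>. Subtracting that multiple makes the total integral zero, so the
  antiderivative vanishes on both sides of the support and can be fed to
  \<open>integral_log_radial_deriv\<close>. No value of a one-dimensional integral has to be
  computed.\<close>

lemma ratio_antiderivative:
  obtains \<Phi> m where "\<And>t. (\<Phi> has_real_derivative (chi' t)\<^sup>2 - m * (chi t)\<^sup>2) (at t)"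
    "\<And>t. t \<le> -2 \<or> -1 \<le> t \<Longrightarrow> \<Phi> t = 0"
proof -
  have ci: "(\<lambda>t. (chi t)\<^sup>2) integrable_on {a..b}" "(\<lambda>t. (chi' t)\<^sup>2) integrable_on {a..b}" for a b
    by (intro integrable_continuous_interval continuous_intros continuous_on_chi)+
  define J where "J = integral {-3..-1} (\<lambda>t. (chi t)\<^sup>2)"
  define m where "m = integral {-3..-1} (\<lambda>t. (chi' t)\<^sup>2) / J"
  define k where "k t = (chi' t)\<^sup>2 - m * (chi t)\<^sup>2" for t
  have J: "J \<noteq> 0"
  proof
    assume "J = 0"
    then have "\<forall>t\<in>{-3..-1}. (chi t)\<^sup>2 = 0"
      unfolding J_def by (subst (asm) integral_eq_0_iff) (auto intro!: continuous_intros continuous_on_chi)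
    then show False using chi_nonzero by (auto dest!: bspec[of _ _ "- (3 / 2)"])
  qed
  have ck: "continuous_on S k" for S
    unfolding k_def by (intro continuous_intros continuous_on_chi)
  have k0: "k t = 0" if "t \<le> -2 \<or> -1 \<le> t" for t
    using chi_eq_0[OF that] by (simp add: k_def)
  \<comment> \<open>Starting at -3 leaves room to the left of the support: the fundamental theorem
    applies for \<open>t > -3\<close>, and for smaller \<open>t\<close> the function is locally
    zero.\<close>
  define \<Phi> where "\<Phi> t = integral {-3..t} k" for t
  have int: "integral {-3..-1} k = 0"
  proof -
    have "(k has_integral (integral {-3..-1} (\<lambda>t. (chi' t)\<^sup>2) - m * J)) {-3..-1}"
      unfolding k_def J_def
      by (intro has_integral_diff has_integral_mult_right integrable_integral ci)
    then show ?thesis using J by (simp add: m_def integral_unique)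
  qed
  have low: "\<Phi> t = 0" if "t \<le> -2" for t
  proof -
    have "integral {-3..t} k = integral {-3..t} (\<lambda>_. 0)"
      using that by (intro integral_cong) (simp add: k0)
    then show ?thesis by (simp add: \<Phi>_def)
  qed
  have high: "\<Phi> t = 0" if "-1 \<le> t" for t
  proof -
    have "integral {-3..-1} k + integral {-1..t} k = integral {-3..t} k"
      using that by (intro Henstock_Kurzweil_Integration.integral_combine integrable_continuous_interval ck) auto
    moreover have "integral {-1..t} k = integral {-1..t} (\<lambda>_. 0)"
      by (rule integral_cong) (simp add: k0)
    ultimately show ?thesis using int by (simp add: \<Phi>_def)
  qed
  have "(\<Phi> has_real_derivative k t) (at t)" for t
  proof (cases "-3 < t")
    case True
    have "(\<Phi> has_real_derivative k t) (at t within {-3..t + 1})"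
      unfolding \<Phi>_def by (rule integral_has_real_derivative[OF ck]) (use True in auto)
    then show ?thesis
      using True by (simp add: at_within_Icc_at)
  next
    case False
    have "((\<lambda>t. 0) has_real_derivative 0) (at t)" by simp
    then have "(\<Phi> has_real_derivative 0) (at t)"
      by (rule has_field_derivative_transform_within_open[where S="{..<-2}"]) (use False low in auto)
    then show ?thesis using False k0[of t] by simp
  qed
  then show ?thesis
    using that[of \<Phi> m] low high by (auto simp: k_def)
qed

text \<open>The energy density has terms in \<open>chi\<^sup>2\<close>, \<open>chi * chi'\<close>
  and \<open>chi'\<^sup>2\<close>. The mixed term integrates to 0 as a total derivative, and the
  last one is \<open>m\<close> times the first by the choice of \<open>m\<close>. Since
  \<open>m\<close> is fixed before \<open>R\<close> and \<open>e\<close>, letting \<open>R\<close>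
  grow drives the quotient to \<open>N^2 / 4\<close>.\<close>

lemma test_fun_energy:
  obtains m where "\<And>R (e :: real^'n). 0 < R \<Longrightarrow> norm e = 1 \<Longrightarrow>
    (\<integral>x. (norm (grad (test_fun R e) x))\<^sup>2 \<partial>lborel) =
      ((real CARD('n))\<^sup>2 / 4 + m / R\<^sup>2) * (\<integral>x. (test_fun R e x / norm x)\<^sup>2 \<partial>lborel)"
proof -
  obtain \<Phi> m where \<Phi>: "\<And>t. (\<Phi> has_real_derivative (chi' t)\<^sup>2 - m * (chi t)\<^sup>2) (at t)"
    "\<And>t. t \<le> -2 \<or> -1 \<le> t \<Longrightarrow> \<Phi> t = 0"
    by (rule ratio_antiderivative) blast
  have "(\<integral>x. (norm (grad (test_fun R e) x))\<^sup>2 \<partial>lborel) =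
      ((real CARD('n))\<^sup>2 / 4 + m / R\<^sup>2) * (\<integral>x. (test_fun R e x / norm x)\<^sup>2 \<partial>lborel)"
    if R: "0 < R" and e: "norm e = 1" for R and e :: "real^'n"
  proof -
    let ?N = "real CARD('n)"
    define a where "a = - (?N / 4)"
    define X Y Z where "X r = (chi (ln r / R))\<^sup>2 / r ^ CARD('n)"
      and "Y r = chi (ln r / R) * chi' (ln r / R) / r ^ CARD('n)"
      and "Z r = (chi' (ln r / R))\<^sup>2 / r ^ CARD('n)" for r :: real
    have [measurable]: "chi \<in> borel_measurable borel" "chi' \<in> borel_measurable borel"
      by (auto intro!: borel_measurable_continuous_onI continuous_on_chi)
    have [measurable]: "X \<in> borel_measurable borel" "Y \<in> borel_measurable borel" "Z \<in> borel_measurable borel"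
      unfolding X_def Y_def Z_def by measurable
    have iX: "integrable lborel (\<lambda>x::real^'n. X (norm x))"
      unfolding X_def using log_radial_integrable[of "\<lambda>t. (chi t)\<^sup>2" R, where 'a="real^'n"] R
      by (simp add: chi_eq_0 continuous_intros continuous_on_chi)
    have iY: "integrable lborel (\<lambda>x::real^'n. Y (norm x))"
      unfolding Y_def using log_radial_integrable[of "\<lambda>t. chi t * chi' t" R, where 'a="real^'n"] R
      by (simp add: chi_eq_0 continuous_intros continuous_on_chi)
    have iZ: "integrable lborel (\<lambda>x::real^'n. Z (norm x))"
      unfolding Z_def using log_radial_integrable[of "\<lambda>t. (chi' t)\<^sup>2" R, where 'a="real^'n"] R
      by (simp add: chi_eq_0 continuous_intros continuous_on_chi)
    have intY: "(\<integral>x. Y (norm (x :: real^'n)) \<partial>lborel) = 0"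
    proof -
      have "(\<integral>x. (2 * (chi (ln (norm x) / R) * chi' (ln (norm x) / R))) / norm (x :: real^'n) ^ DIM(real^'n) \<partial>lborel) = 0"
      proof (rule integral_log_radial_deriv[where \<Phi>="\<lambda>t. (chi t)\<^sup>2" and \<Phi>'="\<lambda>t. 2 * (chi t * chi' t)"])
        show "((\<lambda>t. (chi t)\<^sup>2) has_real_derivative 2 * (chi t * chi' t)) (at t)" for t
          by (auto intro!: derivative_eq_intros chi_has_derivative)
        show "continuous_on UNIV (\<lambda>t. 2 * (chi t * chi' t))"
          by (intro continuous_intros continuous_on_chi)
      qed (use R in \<open>auto simp: chi_eq_0\<close>)
      moreover have "(2 * (chi (ln (norm x) / R) * chi' (ln (norm x) / R))) / norm x ^ DIM(real^'n) = 2 * Y (norm x)" for x :: "real^'n"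
        by (simp add: Y_def)
      ultimately show ?thesis by simp
    qed
    have intZ: "(\<integral>x. Z (norm (x :: real^'n)) \<partial>lborel) = m * (\<integral>x. X (norm (x :: real^'n)) \<partial>lborel)"
    proof -
      have "(\<integral>x. ((chi' (ln (norm x) / R))\<^sup>2 - m * (chi (ln (norm x) / R))\<^sup>2) / norm (x :: real^'n) ^ DIM(real^'n) \<partial>lborel) = 0"
      proof (rule integral_log_radial_deriv[where \<Phi>'="\<lambda>t. (chi' t)\<^sup>2 - m * (chi t)\<^sup>2", OF \<Phi>(1)])
        show "continuous_on UNIV (\<lambda>t. (chi' t)\<^sup>2 - m * (chi t)\<^sup>2)"
          by (intro continuous_intros continuous_on_chi)
      qed (use R \<Phi>(2) in \<open>auto simp: chi_eq_0\<close>)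
      moreover have "((chi' (ln (norm x) / R))\<^sup>2 - m * (chi (ln (norm x) / R))\<^sup>2) / norm x ^ DIM(real^'n) = Z (norm x) - m * X (norm x)" for x :: "real^'n"
        by (simp add: X_def Z_def diff_divide_distrib)
      ultimately show ?thesis using iX iZ by simp
    qed
    note rad = integral_inner_square_radial[OF e]
    define h where "h = log_bump R a 1 1"
    define h' where "h' s = a * log_bump R (a - 1) 1 1 s + 1 / (2 * R) * log_bump R (a - 1) (flat_deriv 1) 1 s
      + (- 1 / (2 * R)) * log_bump R (a - 1) 1 (flat_deriv 1) s" for s
    have dh: "(h has_real_derivative h' s) (at s)" for s
      unfolding h_def h'_def by (rule log_bump_has_derivative[OF R])
    have u: "test_fun R e x = (x \<bullet> e) * h (x \<bullet> x)" for x
      by (simp add: test_fun_def h_def a_def)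
    have grad: "grad (test_fun R e) x = h (x \<bullet> x) *\<^sub>R e + (2 * (x \<bullet> e) * h' (x \<bullet> x)) *\<^sub>R x" for x
    proof (rule grad_eqI)
      have "((\<lambda>x. x \<bullet> x) has_derivative (\<lambda>w. x \<bullet> w + w \<bullet> x)) (at x)"
        by (rule has_derivative_inner[OF has_derivative_ident has_derivative_ident])
      from has_derivative_compose[OF this dh[unfolded has_field_derivative_def]]
      have "((\<lambda>x. h (x \<bullet> x)) has_derivative (\<lambda>w. h' (x \<bullet> x) * (x \<bullet> w + w \<bullet> x))) (at x)" .
      from has_derivative_mult[OF bounded_linear_imp_has_derivative[OF bounded_linear_inner_left] this]
      have "((\<lambda>x. (x \<bullet> e) * h (x \<bullet> x)) has_derivative
          (\<lambda>w. (x \<bullet> e) * (h' (x \<bullet> x) * (x \<bullet> w + w \<bullet> x)) + (w \<bullet> e) * h (x \<bullet> x))) (at x)" .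
      moreover have "(x \<bullet> e) * (h' (x \<bullet> x) * (x \<bullet> w + w \<bullet> x)) + (w \<bullet> e) * h (x \<bullet> x) =
          (h (x \<bullet> x) *\<^sub>R e + (2 * (x \<bullet> e) * h' (x \<bullet> x)) *\<^sub>R x) \<bullet> w" for w
        by (simp add: inner_simps inner_commute algebra_simps)
      ultimately show "(test_fun R e has_derivative (\<lambda>w. (h (x \<bullet> x) *\<^sub>R e + (2 * (x \<bullet> e) * h' (x \<bullet> x)) *\<^sub>R x) \<bullet> w)) (at x)"
        by (simp add: u[abs_def])
    qed
    have ee: "e \<bullet> e = 1" using e by (simp flip: power2_norm_eq_inner)
    have pw: "(norm (grad (test_fun R e) x))\<^sup>2 = X (norm x) + ((4 * a + 4 * a\<^sup>2) * ((sgn x \<bullet> e)\<^sup>2 * X (norm x))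
        + (2 / R + 4 * a / R) * ((sgn x \<bullet> e)\<^sup>2 * Y (norm x)) + 1 / R\<^sup>2 * ((sgn x \<bullet> e)\<^sup>2 * Z (norm x)))"
      and pwW: "(test_fun R e x / norm x)\<^sup>2 = (sgn x \<bullet> e)\<^sup>2 * X (norm x)" if x: "x \<noteq> 0" for x
    proof -
      define s P t y where "s = x \<bullet> x" and "P = s powr a" and "t = ln (norm x) / R" and "y = sgn x \<bullet> e"
      have s: "0 < s" "s = norm x * norm x"
        using x by (simp_all add: s_def flip: power2_norm_eq_inner) (simp add: power2_eq_square)
      have P: "P\<^sup>2 = 1 / norm x ^ CARD('n)"
      proof -
        have "P\<^sup>2 = s powr (2 * a)"
          using s by (simp add: P_def power2_eq_square flip: powr_add)
        also have "s = norm x powr 2"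
          using x s(2) by (simp add: power2_eq_square)
        also have "(norm x powr 2) powr (2 * a) = norm x powr (- ?N)"
          unfolding powr_powr by (simp add: a_def)
        also have "\<dots> = 1 / norm x ^ CARD('n)"
          using x by (simp add: powr_minus powr_realpow divide_inverse)
        finally show ?thesis .
      qed
      have lt: "ln s / (2 * R) = t"
        unfolding s_def t_def by (rule ln_inner_self[OF x])
      have lb: "log_bump R b p q s = s powr b * bump p q t" for b p q
        using s(1) by (simp add: log_bump_def lt)
      have hs: "h s = P * chi t"
        by (simp add: h_def lb P_def chi_def)
      \<comment> \<open>The product \<open>s * h' s\<close> is the derivative in
        \<open>ln s\<close>. It keeps the power \<open>P\<close>, and the cutoff contributes only at
        order \<open>1 / R\<close>.\<close>
      have hs': "s * h' s = P * (a * chi t + chi' t / (2 * R))"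
        using s(1) R by (simp add: h'_def lb P_def chi_def chi'_def powr_diff field_simps)
      have xe: "(x \<bullet> e)\<^sup>2 = s * y\<^sup>2"
        using x by (simp add: s y_def sgn_div_norm power2_eq_square field_simps)
      have "(norm (grad (test_fun R e) x))\<^sup>2 = (h s)\<^sup>2 + 4 * (x \<bullet> e)\<^sup>2 * h s * h' s + 4 * (x \<bullet> e)\<^sup>2 * (h' s)\<^sup>2 * s"
        unfolding grad power2_norm_eq_inner s_def
        by (simp add: inner_simps inner_commute ee algebra_simps power2_eq_square)
      also have "\<dots> = (h s)\<^sup>2 + 4 * y\<^sup>2 * h s * (s * h' s) + 4 * y\<^sup>2 * (s * h' s)\<^sup>2"
        unfolding xe by (simp add: algebra_simps power2_eq_square)
      also have "\<dots> = P\<^sup>2 * ((chi t)\<^sup>2 + y\<^sup>2 * ((4 * a + 4 * a\<^sup>2) * (chi t)\<^sup>2 + (2 / R + 4 * a / R) * (chi t * chi' t) + 1 / R\<^sup>2 * (chi' t)\<^sup>2))"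
        unfolding hs hs' using R by (simp add: field_simps power2_eq_square)
      finally show "(norm (grad (test_fun R e) x))\<^sup>2 = X (norm x) + ((4 * a + 4 * a\<^sup>2) * ((sgn x \<bullet> e)\<^sup>2 * X (norm x))
        + (2 / R + 4 * a / R) * ((sgn x \<bullet> e)\<^sup>2 * Y (norm x)) + 1 / R\<^sup>2 * ((sgn x \<bullet> e)\<^sup>2 * Z (norm x)))"
        unfolding P X_def Y_def Z_def t_def[symmetric] y_def[symmetric]
        by (simp add: distrib_left add_divide_distrib mult.left_commute[of "y\<^sup>2"])
      have "(test_fun R e x / norm x)\<^sup>2 = ((x \<bullet> e)\<^sup>2 / s) * (h s)\<^sup>2"
        by (simp add: u s_def power_divide power_mult_distrib flip: power2_norm_eq_inner)
      also have "\<dots> = y\<^sup>2 * (P\<^sup>2 * (chi t)\<^sup>2)"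
        unfolding xe hs using s(1) by (simp add: power_mult_distrib)
      finally show "(test_fun R e x / norm x)\<^sup>2 = (sgn x \<bullet> e)\<^sup>2 * X (norm x)"
        unfolding P X_def t_def[symmetric] y_def[symmetric] by simp
    qed
    interpret C1_function "test_fun R e" "grad (test_fun R e)"
      using test_fun_mean_zero[OF R] by (intro C1_function_smooth) (auto simp: mean_zero_test_functions_def test_functions_def)
    have "(\<integral>x. (norm (grad (test_fun R e) x))\<^sup>2 \<partial>lborel) =
        (\<integral>x. X (norm x) + ((4 * a + 4 * a\<^sup>2) * ((sgn x \<bullet> e)\<^sup>2 * X (norm x))
        + (2 / R + 4 * a / R) * ((sgn x \<bullet> e)\<^sup>2 * Y (norm x)) + 1 / R\<^sup>2 * ((sgn x \<bullet> e)\<^sup>2 * Z (norm x))) \<partial>lborel)"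
      by (rule integral_cong_AE, measurable, rule eventually_mono[OF AE_lborel_singleton[of 0]]) (rule pw)
    also have "\<dots> = (\<integral>x. X (norm (x :: real^'n)) \<partial>lborel) + ((4 * a + 4 * a\<^sup>2) * ((\<integral>x. X (norm (x :: real^'n)) \<partial>lborel) / ?N)
        + (2 / R + 4 * a / R) * ((\<integral>x. Y (norm (x :: real^'n)) \<partial>lborel) / ?N) + 1 / R\<^sup>2 * ((\<integral>x. Z (norm (x :: real^'n)) \<partial>lborel) / ?N))"
      using rad[OF \<open>X \<in> _\<close> iX] rad[OF \<open>Y \<in> _\<close> iY] rad[OF \<open>Z \<in> _\<close> iZ] iX by simp
    \<comment> \<open>For \<open>a = - N / 4\<close> one has
      \<open>N + 4 * a + 4 * a\<^sup>2 = N\<^sup>2 / 4\<close>; this is where the exponent of the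
      test function gives the sharp constant.\<close>
    also have "\<dots> = (?N\<^sup>2 / 4 + m / R\<^sup>2) * ((\<integral>x. X (norm (x :: real^'n)) \<partial>lborel) / ?N)"
      unfolding intY intZ using R by (simp add: a_def field_simps power2_eq_square)
    also have "(\<integral>x. X (norm (x :: real^'n)) \<partial>lborel) / ?N = (\<integral>x. (sgn x \<bullet> e)\<^sup>2 * X (norm x) \<partial>lborel)"
      using rad(2)[OF \<open>X \<in> _\<close> iX] by simp
    also have "\<dots> = (\<integral>x. (test_fun R e x / norm x)\<^sup>2 \<partial>lborel)"
      by (rule integral_cong_AE, measurable, rule eventually_mono[OF AE_lborel_singleton[of 0]]) (rule pwW[symmetric])
    finally show ?thesis .
  qed
  then show ?thesis by (rule that)
qed

lemma
  fixes f :: "'a::euclidean_space \<Rightarrow> real"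
  assumes "\<And>x. 1 \<le> norm x \<Longrightarrow> f x = 0"
  shows set_integrable_ball_iff: "set_integrable lborel (ball 0 1) f \<longleftrightarrow> integrable lborel f"
    and set_integral_ball_eq: "(LINT x:ball 0 1|lborel. f x) = (\<integral>x. f x \<partial>lborel)"
proof -
  have "(\<lambda>x. indicator (ball 0 1) x *\<^sub>R f x) = f"
    using assms by (auto simp: fun_eq_iff indicator_def not_less)
  then show "set_integrable lborel (ball 0 1) f \<longleftrightarrow> integrable lborel f"
    "(LINT x:ball 0 1|lborel. f x) = (\<integral>x. f x \<partial>lborel)"
    by (simp_all add: set_integrable_def set_lebesgue_integral_def)
qed

theorem proposition2:
  assumes "2 \<le> CARD('n::finite)"
  shows
    "(\<forall>u \<in> (mean_zero_test_functions :: (real ^ 'n \<Rightarrow> real) set).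
       set_integrable lborel (ball 0 1) (\<lambda>x. \<bar>u x\<bar>\<^sup>2 / (norm x)\<^sup>2) \<and>
       set_integrable lborel (ball 0 1) (\<lambda>x. (norm (grad u x))\<^sup>2) \<and>
       (real CARD('n))\<^sup>2 / 4 * (LINT x:ball 0 1|lborel. \<bar>u x\<bar>\<^sup>2 / (norm x)\<^sup>2)
         \<le> (LINT x:ball 0 1|lborel. (norm (grad u x))\<^sup>2)) \<and>
     (CARD('n) = 2 \<longrightarrow>
     (\<forall>u \<in> (mean_zero_test_functions :: (real ^ 'n \<Rightarrow> real) set).
       set_integrable lborel (ball 0 1)
         (\<lambda>x. \<bar>u x\<bar>\<^sup>2 / ((norm x)\<^sup>2 * (ln (exp 1 / norm x))\<^sup>2)) \<and>
       5 / 4 * (LINT x:ball 0 1|lborel. \<bar>u x\<bar>\<^sup>2 / ((norm x)\<^sup>2 * (ln (exp 1 / norm x))\<^sup>2))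
         \<le> (LINT x:ball 0 1|lborel. (norm (grad u x))\<^sup>2))) \<and>
     (\<forall>C::real.
       (\<forall>u \<in> (mean_zero_test_functions :: (real ^ 'n \<Rightarrow> real) set).
          C * (LINT x:ball 0 1|lborel. \<bar>u x\<bar>\<^sup>2 / (norm x)\<^sup>2)
            \<le> (LINT x:ball 0 1|lborel. (norm (grad u x))\<^sup>2))
       \<longrightarrow> C \<le> (real CARD('n))\<^sup>2 / 4) \<and>
     (\<forall>u \<in> (mean_zero_test_functions :: (real ^ 'n \<Rightarrow> real) set).
       u \<noteq> (\<lambda>x. 0) \<longrightarrow>
       (real CARD('n))\<^sup>2 / 4 * (LINT x:ball 0 1|lborel. \<bar>u x\<bar>\<^sup>2 / (norm x)\<^sup>2)
         \<noteq> (LINT x:ball 0 1|lborel. (norm (grad u x))\<^sup>2))"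
proof -
  let ?N = "real CARD('n)"
  let ?H = "\<lambda>(u :: real^'n \<Rightarrow> real) x. \<bar>u x\<bar>\<^sup>2 / (norm x)\<^sup>2"
    and ?Hl = "\<lambda>(u :: real^'n \<Rightarrow> real) x. \<bar>u x\<bar>\<^sup>2 / ((norm x)\<^sup>2 * (ln (exp 1 / norm x))\<^sup>2)"
    and ?G = "\<lambda>(u :: real^'n \<Rightarrow> real) x. (norm (grad u x))\<^sup>2"
  have main: "set_integrable lborel (ball 0 1) (?H u) \<and> set_integrable lborel (ball 0 1) (?G u) \<and>
      ?N\<^sup>2 / 4 * (LINT x:ball 0 1|lborel. ?H u x) \<le> (LINT x:ball 0 1|lborel. ?G u x) \<and>
      (CARD('n) = 2 \<longrightarrow> set_integrable lborel (ball 0 1) (?Hl u) \<and>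
        5 / 4 * (LINT x:ball 0 1|lborel. ?Hl u x) \<le> (LINT x:ball 0 1|lborel. ?G u x)) \<and>
      (u \<noteq> (\<lambda>x. 0) \<longrightarrow> ?N\<^sup>2 / 4 * (LINT x:ball 0 1|lborel. ?H u x) \<noteq> (LINT x:ball 0 1|lborel. ?G u x)) \<and>
      (LINT x:ball 0 1|lborel. ?H u x) = (\<integral>x. (u x / norm x)\<^sup>2 \<partial>lborel) \<and>
      (LINT x:ball 0 1|lborel. ?G u x) = (\<integral>x. ?G u x \<partial>lborel)"
    if u: "u \<in> mean_zero_test_functions" for u :: "real^'n \<Rightarrow> real"
  proof -
    obtain c L where "compactly_supported_C1 u (grad u) c L"
      using compactly_supported_C1_mean_zero[OF assms u] .
    then interpret compactly_supported_C1 u "grad u" c L .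
    have H: "?H u = W" and Hl: "?Hl u = Wl"
      by (auto simp: fun_eq_iff W_def Wl_def ell_def power_divide power_mult_distrib)
    have zW: "W x = 0" and zWl: "Wl x = 0" and zG: "?G u x = 0" if "1 \<le> norm x" for x
      using that c v0[of x] D0[of x] by (auto simp: W_def Wl_def)
    have WW: "W = (\<lambda>x. (u x / norm x)\<^sup>2)"
      by (simp add: fun_eq_iff W_def)
    have si: "set_integrable lborel (ball 0 1) W" "set_integrable lborel (ball 0 1) Wl" "set_integrable lborel (ball 0 1) (?G u)"
      using integrable_W integrable_Wl integrable_D by (simp_all add: set_integrable_ball_iff zW zWl zG)
    have e: "(LINT x:ball 0 1|lborel. W x) = (\<integral>x. W x \<partial>lborel)"
      "(LINT x:ball 0 1|lborel. Wl x) = (\<integral>x. Wl x \<partial>lborel)"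
      "(LINT x:ball 0 1|lborel. ?G u x) = (\<integral>x. ?G u x \<partial>lborel)"
      by (simp_all add: set_integral_ball_eq zW zWl zG)
    have "?N\<^sup>2 / 4 * (\<integral>x. W x \<partial>lborel) \<noteq> (\<integral>x. ?G u x \<partial>lborel)" if "u \<noteq> (\<lambda>x. 0)"
      using that hardy_strict by blast
    then show ?thesis
      unfolding H Hl e using si hardy hardy_log by (simp add: WW)
  qed
  have best: "C \<le> ?N\<^sup>2 / 4"
    if C: "\<And>u. u \<in> (mean_zero_test_functions :: (real^'n \<Rightarrow> real) set) \<Longrightarrow>
      C * (LINT x:ball 0 1|lborel. ?H u x) \<le> (LINT x:ball 0 1|lborel. ?G u x)" for C
  proof -
    obtain m where m: "\<And>R (e :: real^'n). 0 < R \<Longrightarrow> norm e = 1 \<Longrightarrow>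
      (\<integral>x. (norm (grad (test_fun R e) x))\<^sup>2 \<partial>lborel) =
        (?N\<^sup>2 / 4 + m / R\<^sup>2) * (\<integral>x. (test_fun R e x / norm x)\<^sup>2 \<partial>lborel)"
      by (rule test_fun_energy) blast
    define e :: "real^'n" where "e = axis undefined 1"
    have e: "norm e = 1" by (simp add: e_def)
    have CR: "C \<le> ?N\<^sup>2 / 4 + m / R\<^sup>2" if R: "0 < R" for R
    proof -
      let ?u = "test_fun R e"
      have u: "?u \<in> mean_zero_test_functions" "?u \<noteq> (\<lambda>x. 0)"
        using test_fun_mean_zero[OF R] test_fun_nonzero[OF R e] by auto
      define w where "w = (\<integral>x. (?u x / norm x)\<^sup>2 \<partial>lborel)"
      have G: "(LINT x:ball 0 1|lborel. ?G ?u x) = (?N\<^sup>2 / 4 + m / R\<^sup>2) * w"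
        and H: "(LINT x:ball 0 1|lborel. ?H ?u x) = w"
        using main[OF u(1)] m[OF R e] by (simp_all add: w_def)
      have "0 \<le> w" unfolding w_def by (rule Bochner_Integration.integral_nonneg) simp
      moreover have "w \<noteq> 0"
      proof
        assume "w = 0"
        \<comment> \<open>Positivity comes from strictness: if \<open>w\<close> were 0, both
          integrals would vanish, and a nonzero function would attain equality.\<close>
        then have "?N\<^sup>2 / 4 * (LINT x:ball 0 1|lborel. ?H ?u x) = (LINT x:ball 0 1|lborel. ?G ?u x)"
          unfolding G H by simp
        then show False using main[OF u(1)] u(2) by blast
      qed
      ultimately have "0 < w" by simp
      moreover have "C * w \<le> (?N\<^sup>2 / 4 + m / R\<^sup>2) * w"
        using C[OF u(1)] unfolding G H .
      ultimately show ?thesis by simp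
    qed
    show ?thesis
    proof (rule ccontr)
      assume "\<not> C \<le> ?N\<^sup>2 / 4"
      then have d: "0 < C - ?N\<^sup>2 / 4" by simp
      \<comment> \<open>This choice makes \<open>m / R\<^sup>2\<close> smaller than the assumed
        excess of \<open>C\<close>; the numerator \<open>\<bar>m\<bar> + 1\<close> is positive and
        exceeds \<open>m\<close> whatever the sign of \<open>m\<close>.\<close>
      define R where "R = sqrt ((\<bar>m\<bar> + 1) / (C - ?N\<^sup>2 / 4))"
      have R: "0 < R" "R\<^sup>2 = (\<bar>m\<bar> + 1) / (C - ?N\<^sup>2 / 4)"
        using d by (simp_all add: R_def add_nonneg_pos)
      have "m / R\<^sup>2 = m / (\<bar>m\<bar> + 1) * (C - ?N\<^sup>2 / 4)"
        unfolding R(2) by simp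
      also have "\<dots> < 1 * (C - ?N\<^sup>2 / 4)"
      proof (rule mult_strict_right_mono[OF _ d])
        have "0 < \<bar>m\<bar> + 1"
          using abs_ge_zero[of m] by linarith
        moreover have "m < 1 * (\<bar>m\<bar> + 1)"
          unfolding mult_1 by (rule le_less_trans[OF abs_ge_self less_add_one])
        ultimately show "m / (\<bar>m\<bar> + 1) < 1" by (simp only: pos_divide_less_eq)
      qed
      finally show False using CR[OF R(1)] by simp
    qed
  qed
  show ?thesis
    using main best by blast
qed

end
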